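(* Let $\varphi$ be an Orlicz function. Let $I=(0,a)$, $0<a\le\infty$, and let $w$ be a positive decreasing weight function on $I$. Then $(\mathcal{M}_{\varphi,w},\|\cdot\|_{\mathcal{M}})$ is a rearrangement invariant Banach function space satisfying the Fatou property. Likewise, for a positive decreasing weight sequence $w=\{w(n)\}$, $(\mathfrak{m}_{\varphi,w},\|\cdot\|_{\mathfrak{m}})$ is a rearrangement invariant Banach sequence space satisfying the Fatou property.
   Context: An Orlicz function is a convex, strictly increasing $\varphi:\mathbb{R}_+\to\mathbb{R}_+$ with $\varphi(0)=0$. "Decreasing" means non-increasing. $L^0$ is the set of Lebesgue measurable $f:I\to\mathbb{R}$ (identified a.e.). For $f\in L^0$, $d_f(s)=|\{t\in I:|f(t)|>s\}|$ and $f^*(t)=\inf\{s\ge0:d_f(s)\le t\}$, $t\in I$. For a sequence $x$, $d_x(s)=|\{k\in\mathbb{N}:|x(k)|>s\}|$ and $x^*(n)=\inf\{s>0:d_x(s)\le n-1\}$. A weight function (sequence) is a non-negative decreasing real-valued function (sequence); a weight function need not be integrable near $0$. $g\prec f$ means $\int_0^tg^*\le\int_0^tf^*$ for all $t\in I$; for sequences $y\prec x$ means $\sum_{n=1}^my^*(n)\le\sum_{n=1}^mx^*(n)$ for all $m$. Define $P(f)=\inf\{\int_I\varphi(|f|/v)v: v\prec w,\ v\ge0\}$ and $p(x)=\inf\{\sum_{n}\varphi(|x(n)|/v(n))v(n): v\prec w,\ v\ge0\}$, with the convention that where $v(t)=0$ the expression $\varphi(|f(t)|/v(t))v(t)$ is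 $0$ if $f(t)=0$ and $\infty$ otherwise (similarly for sequences). Put $\|f\|_{\mathcal{M}}=\inf\{\epsilon>0:P(f/\epsilon)\le1\}$, $\|x\|_{\mathfrak{m}}=\inf\{\epsilon>0:p(x/\epsilon)\le1\}$; $\mathcal{M}_{\varphi,w}=\{f\in L^0:\|f\|_{\mathcal{M}}<\infty\}$ and $\mathfrak{m}_{\varphi,w}=\{x:\|x\|_{\mathfrak{m}}<\infty\}$. A Banach function space $(E,\|\cdot\|_E)$ is a complete normed linear subspace $E\subset L^0$ such that $f\in E$, $g\in L^0$, $|g|\le|f|$ imply $g\in E$ and $\|g\|_E\le\|f\|_E$. It is rearrangement invariant if $f\in E$ implies $f^*\in E$ and $\|f\|_E=\|f^*\|_E$. It has the Fatou property if whenever $f_n\in E$ are non-negative, $f_n\uparrow f$ a.e. and $\sup_n\|f_n\|_E<\infty$, then $f\in E$ and $\|f_n\|_E\uparrow\|f\|_E$. The notions for sequence spaces are analogous.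
   Formalization: For the function space it is also assumed that w is integrable near 0 or φ(u)/u does not tend to 0 as u→0+; otherwise the claim fails: for I=(0,1), φ(u)=u², w(t)=1/t every v≥0 satisfies v≺w, so ‖1‖=0. *)

theory Defs
  imports "HOL-Analysis.Analysis"
begin

definition orlicz_function :: "(real \<Rightarrow> real) \<Rightarrow> bool" where
  "orlicz_function \<phi> \<longleftrightarrow> convex_on {0..} \<phi> \<and> strict_mono_on {0..} \<phi> \<and> \<phi> 0 = 0"

definition ival :: "ereal \<Rightarrow> real set" where
  "ival a = {t. 0 < t \<and> ereal t < a}"

text \<open>Functions on \<open>(0,a)\<close> live on the measure space \<open>lebesgue_on (ival a)\<close>; sequences live on
  \<open>count_space UNIV\<close> over \<^typ>\<open>nat\<close>, indexed from 0, so that \<open>x i\<close> is the entry with number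
  \<open>i + 1\<close>. Elements of \<open>L\<^sup>0\<close> are represented by measurable functions; identification of
  functions that agree almost everywhere is expressed by \<open>AE\<close>.\<close>

definition distribution_fun :: "'a measure \<Rightarrow> ('a \<Rightarrow> real) \<Rightarrow> real \<Rightarrow> ennreal" where
  "distribution_fun M f s = emeasure M {t \<in> space M. s < \<bar>f t\<bar>}"

text \<open>Rearrangements take values in \<open>[0,\<infinity>]\<close>: the infimum of the empty set is \<open>\<infinity>\<close>.\<close>

definition rearr :: "ereal \<Rightarrow> (real \<Rightarrow> real) \<Rightarrow> real \<Rightarrow> ennreal" where
  "rearr a f t =
     Inf (ennreal ` {s. 0 \<le> s \<and> distribution_fun (lebesgue_on (ival a)) f s \<le> ennreal t})"

text \<open>The bound \<open>n - 1\<close> for the entry with number \<open>n = i + 1\<close> is \<open>i\<close>.\<close>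

definition seq_rearr :: "(nat \<Rightarrow> real) \<Rightarrow> nat \<Rightarrow> ennreal" where
  "seq_rearr x i =
     Inf (ennreal ` {s. 0 < s \<and> distribution_fun (count_space UNIV) x s \<le> of_nat i})"

definition submaj :: "ereal \<Rightarrow> (real \<Rightarrow> real) \<Rightarrow> (real \<Rightarrow> real) \<Rightarrow> bool" where
  "submaj a g f \<longleftrightarrow> (\<forall>t\<in>ival a.
     (\<integral>\<^sup>+s\<in>{0<..<t}. rearr a g s \<partial>lebesgue) \<le> (\<integral>\<^sup>+s\<in>{0<..<t}. rearr a f s \<partial>lebesgue))"

definition seq_submaj :: "(nat \<Rightarrow> real) \<Rightarrow> (nat \<Rightarrow> real) \<Rightarrow> bool" where
  "seq_submaj y x \<longleftrightarrow> (\<forall>m. (\<Sum>i<m. seq_rearr y i) \<le> (\<Sum>i<m. seq_rearr x i))"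

text \<open>The expression \<open>\<phi>(|y|/v) v\<close> with its convention for \<open>v = 0\<close>.\<close>

definition orlicz_term :: "(real \<Rightarrow> real) \<Rightarrow> real \<Rightarrow> real \<Rightarrow> ennreal" where
  "orlicz_term \<phi> y v =
     (if v = 0 then (if y = 0 then 0 else \<infinity>) else ennreal (\<phi> (\<bar>y\<bar> / v) * v))"

definition fun_modular ::
    "ereal \<Rightarrow> (real \<Rightarrow> real) \<Rightarrow> (real \<Rightarrow> real) \<Rightarrow> (real \<Rightarrow> real) \<Rightarrow> ennreal" where
  "fun_modular a \<phi> w f =
     Inf {(\<integral>\<^sup>+t. orlicz_term \<phi> (f t) (v t) \<partial>lebesgue_on (ival a)) | v.
            v \<in> borel_measurable (lebesgue_on (ival a)) \<and> (\<forall>t\<in>ival a. 0 \<le> v t) \<and> submaj a v w}"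

definition seq_modular ::
    "(real \<Rightarrow> real) \<Rightarrow> (nat \<Rightarrow> real) \<Rightarrow> (nat \<Rightarrow> real) \<Rightarrow> ennreal" where
  "seq_modular \<phi> w x =
     Inf {(\<Sum>i. orlicz_term \<phi> (x i) (v i)) | v. (\<forall>i. 0 \<le> v i) \<and> seq_submaj v w}"

definition luxemburg :: "(('a \<Rightarrow> real) \<Rightarrow> ennreal) \<Rightarrow> ('a \<Rightarrow> real) \<Rightarrow> ennreal" where
  "luxemburg P f = Inf (ennreal ` {\<epsilon>. 0 < \<epsilon> \<and> P (\<lambda>t. f t / \<epsilon>) \<le> 1})"

definition fun_norm :: "ereal \<Rightarrow> (real \<Rightarrow> real) \<Rightarrow> (real \<Rightarrow> real) \<Rightarrow> (real \<Rightarrow> real) \<Rightarrow> real" where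
  "fun_norm a \<phi> w f = enn2real (luxemburg (fun_modular a \<phi> w) f)"

definition fun_space :: "ereal \<Rightarrow> (real \<Rightarrow> real) \<Rightarrow> (real \<Rightarrow> real) \<Rightarrow> (real \<Rightarrow> real) set" where
  "fun_space a \<phi> w =
     {f \<in> borel_measurable (lebesgue_on (ival a)). luxemburg (fun_modular a \<phi> w) f < \<infinity>}"

definition seq_norm :: "(real \<Rightarrow> real) \<Rightarrow> (nat \<Rightarrow> real) \<Rightarrow> (nat \<Rightarrow> real) \<Rightarrow> real" where
  "seq_norm \<phi> w x = enn2real (luxemburg (seq_modular \<phi> w) x)"

definition seq_space :: "(real \<Rightarrow> real) \<Rightarrow> (nat \<Rightarrow> real) \<Rightarrow> (nat \<Rightarrow> real) set" where
  "seq_space \<phi> w = {x. luxemburg (seq_modular \<phi> w) x < \<infinity>}"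

text \<open>The last clause, being stated with \<open>AE\<close>, includes that membership and norm do not depend
  on the representative.\<close>

definition banach_function_space ::
    "'a measure \<Rightarrow> ('a \<Rightarrow> real) set \<Rightarrow> (('a \<Rightarrow> real) \<Rightarrow> real) \<Rightarrow> bool" where
  "banach_function_space M E N \<longleftrightarrow>
     E \<subseteq> borel_measurable M \<and>
     (\<lambda>_. 0) \<in> E \<and>
     (\<forall>f\<in>E. \<forall>g\<in>E. (\<lambda>t. f t + g t) \<in> E \<and> N (\<lambda>t. f t + g t) \<le> N f + N g) \<and>
     (\<forall>f\<in>E. \<forall>c. (\<lambda>t. c * f t) \<in> E \<and> N (\<lambda>t. c * f t) = \<bar>c\<bar> * N f) \<and>
     (\<forall>f\<in>E. 0 \<le> N f \<and> (N f = 0 \<longleftrightarrow> (AE t in M. f t = 0))) \<and>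
     (\<forall>F. (\<forall>n. F n \<in> E) \<and>
          (\<forall>e>0. \<exists>n\<^sub>0. \<forall>m\<ge>n\<^sub>0. \<forall>n\<ge>n\<^sub>0. N (\<lambda>t. F m t - F n t) < e) \<longrightarrow>
          (\<exists>f\<in>E. (\<lambda>n. N (\<lambda>t. F n t - f t)) \<longlonglongrightarrow> 0)) \<and>
     (\<forall>f\<in>E. \<forall>g\<in>borel_measurable M.
          (AE t in M. \<bar>g t\<bar> \<le> \<bar>f t\<bar>) \<longrightarrow> g \<in> E \<and> N g \<le> N f)"

text \<open>\<open>R\<close> is the decreasing rearrangement on \<open>M\<close>. Membership of \<open>f\<^sup>*\<close> in a space of
  real-valued functions includes that \<open>f\<^sup>*\<close> is finite.\<close>

definition rearrangement_invariant ::
    "'a measure \<Rightarrow> (('a \<Rightarrow> real) \<Rightarrow> 'a \<Rightarrow> ennreal) \<Rightarrow>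
     ('a \<Rightarrow> real) set \<Rightarrow> (('a \<Rightarrow> real) \<Rightarrow> real) \<Rightarrow> bool" where
  "rearrangement_invariant M R E N \<longleftrightarrow>
     (\<forall>f\<in>E. (\<forall>t\<in>space M. R f t < \<infinity>) \<and>
        (\<lambda>t. enn2real (R f t)) \<in> E \<and> N f = N (\<lambda>t. enn2real (R f t)))"

definition fatou_property ::
    "'a measure \<Rightarrow> ('a \<Rightarrow> real) set \<Rightarrow> (('a \<Rightarrow> real) \<Rightarrow> real) \<Rightarrow> bool" where
  "fatou_property M E N \<longleftrightarrow>
     (\<forall>F. \<forall>f\<in>borel_measurable M.
        (\<forall>n. F n \<in> E) \<and> (\<forall>n. AE t in M. 0 \<le> F n t) \<and>
        (AE t in M. incseq (\<lambda>n. F n t) \<and> (\<lambda>n. F n t) \<longlonglongrightarrow> f t) \<and>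
        bdd_above (range (\<lambda>n. N (F n))) \<longrightarrow>
        f \<in> E \<and> incseq (\<lambda>n. N (F n)) \<and> (\<lambda>n. N (F n)) \<longlonglongrightarrow> N f)"

definition weight_fun :: "ereal \<Rightarrow> (real \<Rightarrow> real) \<Rightarrow> bool" where
  "weight_fun a w \<longleftrightarrow> (\<forall>t\<in>ival a. 0 \<le> w t) \<and> antimono_on (ival a) w"

definition weight_seq :: "(nat \<Rightarrow> real) \<Rightarrow> bool" where
  "weight_seq w \<longleftrightarrow> (\<forall>i. 0 \<le> w i) \<and> antimono w"

text \<open>A weight need not be integrable near 0. If it is not, every \<open>v \<ge> 0\<close> is submajorized by
  \<open>w\<close>, and if in addition \<open>\<phi>(u)/u \<rightarrow> 0\<close> as \<open>u \<rightarrow> 0\<close>, large constant \<open>v\<close> show that the modular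
  vanishes at bounded functions of bounded support, so that \<open>fun_norm\<close> is not a norm (see
  \<open>degenerate_not_banach\<close> below). The following condition excludes exactly this case.\<close>

definition nondegenerate :: "ereal \<Rightarrow> (real \<Rightarrow> real) \<Rightarrow> (real \<Rightarrow> real) \<Rightarrow> bool" where
  "nondegenerate a \<phi> w \<longleftrightarrow>
     (\<exists>t\<in>ival a. (\<integral>\<^sup>+s\<in>{0<..<t}. ennreal (w s) \<partial>lebesgue) < \<infinity>) \<or>
     \<not> ((\<lambda>u. \<phi> u / u) \<longlongrightarrow> 0) (at_right 0)"

lemma ival_lebesgue: "ival a \<in> sets lebesgue"
proof -
  have "ival a = {0<..} \<inter> (ereal -` {..<a})" by (auto simp: ival_def)
  moreover have "open (ereal -` {..<a})" by (intro open_ereal_vimage) auto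
  ultimately have "open (ival a)" by auto
  then show ?thesis by (intro sets_completionI_sets) simp
qed

lemma rearr_ge_weight:
  assumes w: "weight_fun a w" and s: "0 < s" "s < r" "r \<in> ival a"
  shows "ennreal (w r) \<le> rearr a w s"
  unfolding rearr_def
proof (rule Inf_greatest, clarify)
  fix y assume y: "0 \<le> y" "distribution_fun (lebesgue_on (ival a)) w y \<le> ennreal s"
  have sub: "{0<..r} \<subseteq> ival a" using s
    by (auto simp: ival_def) (meson ereal_less_eq(3) le_less_trans)
  have "w r \<le> y"
  proof (rule ccontr)
    assume "\<not> w r \<le> y"
    then have "{t \<in> space (lebesgue_on (ival a)). y < \<bar>w t\<bar>} \<supseteq> {0<..r}"
      using w sub s unfolding weight_fun_def monotone_on_def by (auto; force)
    moreover have "{t \<in> space (lebesgue_on (ival a)). y < \<bar>w t\<bar>} \<in> sets (lebesgue_on (ival a))"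
    proof -
      have "mono_on (ival a) (\<lambda>t. - w t)"
        using w unfolding weight_fun_def monotone_on_def by auto
      then have "(\<lambda>t. - w t) \<in> borel_measurable (restrict_space borel (ival a))"
        by (rule borel_measurable_mono_on_fnc)
      then have "(\<lambda>t. - (- w t)) \<in> borel_measurable (restrict_space borel (ival a))"
        by (rule borel_measurable_uminus)
      then have "w \<in> borel_measurable (lebesgue_on (ival a))"
        by (simp add: measurable_def space_restrict_space sets_restrict_space) 
          (smt (verit, best) image_iff sets_completionI_sets sets_lborel)
      then show ?thesis by measurable
    qed
    ultimately have "emeasure (lebesgue_on (ival a)) {0<..r} \<le> ennreal s"
      using y(2) unfolding distribution_fun_def by (meson emeasure_mono order_trans)
    then have "ennreal r \<le> ennreal s"
      using s ival_lebesgue sub by (simp add: emeasure_restrict_space)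
    then show False using s by (simp add: ennreal_le_iff)
  qed
  then show "ennreal (w r) \<le> ennreal y" by (rule ennreal_leI)
qed

lemma degenerate_not_banach:
  assumes a: "0 < a" and \<phi>: "orlicz_function \<phi>" and w: "weight_fun a w"
    and deg: "\<not> nondegenerate a \<phi> w"
  shows "\<not> banach_function_space (lebesgue_on (ival a)) (fun_space a \<phi> w) (fun_norm a \<phi> w)"
proof
  assume B: "banach_function_space (lebesgue_on (ival a)) (fun_space a \<phi> w) (fun_norm a \<phi> w)"
  have down: "s \<in> ival a" if "0 < s" "s \<le> t" "t \<in> ival a" for s t
    using that by (auto simp: ival_def) (meson ereal_less_eq(3) le_less_trans)
  obtain b where b: "b \<in> ival a"
    using ereal_dense2[OF a] by (auto simp: ival_def zero_ereal_def)
  have b0: "0 < b" using b by (simp add: ival_def)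
  have W: "(\<integral>\<^sup>+s\<in>{0<..<t}. ennreal (w s) \<partial>lebesgue) = \<infinity>" if "t \<in> ival a" for t
    using deg that unfolding nondegenerate_def by (metis infinity_ennreal_def less_top)
  have lim: "((\<lambda>u. \<phi> u / u) \<longlongrightarrow> 0) (at_right 0)"
    using deg by (auto simp: nondegenerate_def)
  have Wr: "(\<integral>\<^sup>+s\<in>{0<..<t}. rearr a w s \<partial>lebesgue) = \<infinity>" if t: "t \<in> ival a" for t
  proof -
    define h where "h = (\<lambda>s. ennreal (w s) * indicator {0<..<t} s)"
    have t0: "0 < t" using t by (simp add: ival_def)
    have "mono_on {0<..<t} (\<lambda>s. - w s)"
      using w down[OF _ _ t] unfolding weight_fun_def monotone_on_def by (meson greaterThanLessThan_iff less_eq_real_def neg_le_iff_le)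
    then have "(\<lambda>s. - w s) \<in> borel_measurable (restrict_space borel {0<..<t})"
      by (rule borel_measurable_mono_on_fnc)
    then have "(\<lambda>s. - (- w s)) \<in> borel_measurable (restrict_space borel {0<..<t})"
      by (rule borel_measurable_uminus)
    then have "(\<lambda>s. ennreal (w s)) \<in> borel_measurable (restrict_space borel {0<..<t})"
      by simp
    then have hm: "h \<in> borel_measurable borel" unfolding h_def
      by (subst (asm) borel_measurable_restrict_space_iff_ennreal) auto
    have "(\<infinity>::ennreal) = (\<integral>\<^sup>+s. h s \<partial>lborel)"
      using W[OF t] by (simp add: h_def nn_integral_completion)
    also have "\<dots> = ennreal 2 * (\<integral>\<^sup>+s. h (2 * s) \<partial>lborel)"
      using nn_integral_real_affine[OF hm, of 2 0] by simp
    finally have "(\<integral>\<^sup>+s. h (2 * s) \<partial>lborel) = \<infinity>"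
      by (metis ennreal_mult_less_top ennreal_less_top infinity_ennreal_def less_top)
    moreover have "(\<integral>\<^sup>+s. h (2 * s) \<partial>lborel) \<le> (\<integral>\<^sup>+s\<in>{0<..<t}. rearr a w s \<partial>lborel)"
    proof (rule nn_integral_mono)
      fix s
      show "h (2 * s) \<le> rearr a w s * indicator {0<..<t} s"
        using rearr_ge_weight[OF w, of s "2 * s"] down[OF _ _ t, of "2 * s"] t0
        by (auto simp: h_def indicator_def)
    qed
    ultimately show ?thesis by (simp add: nn_integral_completion top_unique)
  qed
  define f :: "real \<Rightarrow> real" where "f = indicator {0<..b}"
  have fm: "f \<in> borel_measurable (lebesgue_on (ival a))"
    unfolding f_def by (intro measurable_restrict_space1 borel_measurable_indicator) simp
  have P: "fun_modular a \<phi> w (\<lambda>t. f t / \<epsilon>) \<le> 1" if e: "0 < \<epsilon>" for \<epsilon>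
  proof -
    have "\<forall>\<^sub>F u in at_right 0. \<phi> u / u < \<epsilon> / b"
      using order_tendstoD(2)[OF lim] e b0 by simp
    moreover have "\<forall>\<^sub>F u in at_right 0. 0 < (u::real)" by (simp add: eventually_at_right_less)
    ultimately have "\<forall>\<^sub>F u in at_right 0. 0 < u \<and> \<phi> u / u < \<epsilon> / b"
      by eventually_elim auto
    then obtain u where u: "0 < u" "\<phi> u / u < \<epsilon> / b"
      using eventually_happens'[OF trivial_limit_at_right_real] by blast
    define c where "c = 1 / (\<epsilon> * u)"
    have c: "0 < c" using e u by (simp add: c_def)
    have "\<phi> 0 < \<phi> u"
      using \<phi> u strict_mono_onD[of "{0..}" \<phi> 0 u] unfolding orlicz_function_def by auto
    then have pu: "0 \<le> \<phi> u" using \<phi> by (simp add: orlicz_function_def)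
    have eq: "orlicz_term \<phi> (f t / \<epsilon>) c = ennreal (\<phi> u * c) * indicator {0<..b} t" for t
      using c e u \<phi> by (auto simp: orlicz_term_def f_def indicator_def c_def orlicz_function_def)
    have sub: "{0<..b} \<subseteq> ival a" using down b by auto
    have "fun_modular a \<phi> w (\<lambda>t. f t / \<epsilon>)
        \<le> (\<integral>\<^sup>+t. orlicz_term \<phi> (f t / \<epsilon>) c \<partial>lebesgue_on (ival a))"
      unfolding fun_modular_def
    proof (rule Inf_lower, rule CollectI, rule exI[of _ "\<lambda>_. c"], intro conjI)
      show "submaj a (\<lambda>_. c) w" using Wr by (simp add: submaj_def)
    qed (use c in auto)
    also have "\<dots> = ennreal (\<phi> u * c) * emeasure (lebesgue_on (ival a)) {0<..b}"
      unfolding eq using ival_lebesgue sub by (intro nn_integral_cmult_indicator) (auto simp: sets_restrict_space_iff)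
    also have "\<dots> = ennreal (\<phi> u * c) * ennreal b"
      using ival_lebesgue sub b0 by (simp add: emeasure_restrict_space)
    also have "\<dots> = ennreal (\<phi> u * c * b)"
      using pu c b0 by (simp add: ennreal_mult)
    also have "\<dots> \<le> ennreal 1"
      using u e b0 by (intro ennreal_leI) (simp add: c_def field_simps)
    finally show ?thesis by simp
  qed
  have le: "luxemburg (fun_modular a \<phi> w) f \<le> ennreal \<epsilon>" if "0 < \<epsilon>" for \<epsilon>
    unfolding luxemburg_def using that P by (intro Inf_lower) auto
  have L0: "luxemburg (fun_modular a \<phi> w) f = 0"
    by (rule antisym, rule ennreal_le_epsilon) (use le in auto)
  then have fE: "f \<in> fun_space a \<phi> w" and N0: "fun_norm a \<phi> w f = 0"
    using fm by (auto simp: fun_space_def fun_norm_def)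
  have "AE t in lebesgue_on (ival a). f t = 0"
    using B fE N0 unfolding banach_function_space_def by blast
  then have "AE t in lebesgue. t \<in> ival a \<longrightarrow> f t = 0"
    using ival_lebesgue by (simp add: AE_restrict_space_iff)
  then have "AE t in lebesgue. t \<notin> {0<..b}"
    by eventually_elim (use down[OF _ _ b] in \<open>auto simp: f_def indicator_def split: if_splits\<close>)
  then have "emeasure lebesgue {0<..b} = 0"
    by (subst (asm) AE_iff_measurable[of "{0<..b}"]) auto
  then show False using b0 by simp
qed

end

theory Submission
  imports Defs
begin

text \<open>For \<open>t\<close> in the relevant range, \<open>\<integral>\<^sub>0\<^sup>t v\<^sup>*\<close> is the minimum of \<open>l t + \<integral> (v - l)\<^sub>+\<close> over \<open>l \<ge> 0\<close>.
  Hence, if \<open>w\<close> is integrable near 0, the set \<open>V\<close> of all \<open>v \<ge> 0\<close> with \<open>v \<prec> w\<close> is convex, closed under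
  convergence almost everywhere, and uniformly small in measure at large heights. Since
  \<open>\<Phi> y v = \<phi> (\<bar>y\<bar> / v) v\<close> is jointly convex, the Luxemburg functional is a norm. For the Fatou
  property let \<open>f\<^sub>n \<up> f\<close> with modulars at most 1. The sets of \<open>v \<in> V\<close> that almost realize the modular
  of \<open>f\<^sub>n\<close> are convex and decrease with \<open>n\<close>, so a sequence of their members converges almost
  everywhere to some \<open>v \<in> V\<close>. The function \<open>\<Phi>\<close> need not be lower semicontinuous at \<open>v = 0\<close>, which
  is repaired by mixing in a little of the positive weight \<open>w\<close>. Completeness follows from the Fatou
  property, because small norm forces smallness in measure.

  For rearrangement invariance, \<open>\<phi>\<close> is a limit of positive combinations of hinges \<open>(u - s)\<^sub>+\<close>, and
  \<open>\<integral> (f\<^sup>* - s v\<^sup>*)\<^sub>+ \<le> \<integral> (\<bar>f\<bar> - s v)\<^sub>+\<close> by comparing layers. Conversely, a competitor for \<open>f\<^sup>*\<close> is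
  transported to \<open>f\<close> by averaging it over the sets where \<open>f\<^sup>*\<close> lies between consecutive powers of a
  number close to 1.

  If \<open>w\<close> is not integrable near 0, every \<open>v \<ge> 0\<close> is admissible and the norm is a multiple of the
  norm of \<open>L\<^sup>1\<close>.\<close>

section \<open>Convergence in measure and convex sets of functions\<close>

text \<open>The factor \<open>c < 1\<close> in \<open>P_fatou\<close> and \<open>P_R_le\<close> pays
  for the repair at weight 0. If \<phi> grows only linearly, \<open>\<Phi> y v\<close> stays bounded
  as v decreases to 0, although \<open>\<Phi> y 0\<close> is infinite for y \<noteq> 0. The weight
  \<open>c * v + (1 - c) * w\<close> is positive and still admissible, and since
  \<open>\<Phi>\<close> is homogeneous of degree one in the pair (y, v) and decreasing in v, passing
  from f to \<open>c * f\<close> absorbs the change. The Luxemburg functional is homogeneous, so the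
  factor can be removed at the end. In \<open>P_le_P_R\<close> the factor c has another origin: it
  is the ratio of consecutive band edges.

  Almost optimal weights need be neither bounded nor, on a space of infinite measure, integrable, so
  no compactness is at hand. Convexity replaces it: minimizing the integral of
  \<open>exp (- g)\<close> against an equivalent finite measure yields convergence almost
  everywhere, with \<infinity> as a possible limit, which tightness of V rules out.

  Functions and sequences are treated together through a position function \<tau>; facts about
  rearrangements come mainly from level sets of f having the measure of initial segments of
  \<tau>.\<close>

lemma cauchy_in_measure_AE_subseq:
  fixes F :: "nat \<Rightarrow> 'a \<Rightarrow> real"
  assumes F[measurable]: "\<And>n. F n \<in> borel_measurable M"
    and C: "\<And>s d. 0 < s \<Longrightarrow> 0 < d \<Longrightarrow>
      \<exists>n0. \<forall>m\<ge>n0. \<forall>n\<ge>n0. emeasure M {x \<in> space M. s < \<bar>F m x - F n x\<bar>} \<le> ennreal d"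
  obtains r f where "strict_mono (r :: nat \<Rightarrow> nat)" "f \<in> borel_measurable M"
    "AE x in M. (\<lambda>n. F (r n) x) \<longlonglongrightarrow> f x"
proof -
  have "\<forall>k. \<exists>n0. \<forall>m\<ge>n0. \<forall>n\<ge>n0.
      emeasure M {x \<in> space M. (1/2)^k < \<bar>F m x - F n x\<bar>} \<le> ennreal ((1/2)^k)"
    using C by simp
  from choice[OF this] obtain N where "\<forall>k. \<forall>m\<ge>N k. \<forall>n\<ge>N k.
      emeasure M {x \<in> space M. (1/2)^k < \<bar>F m x - F n x\<bar>} \<le> ennreal ((1/2)^k)"
    by (rule exE)
  then have N: "emeasure M {x \<in> space M. (1/2)^k < \<bar>F m x - F n x\<bar>} \<le> ennreal ((1/2)^k)"
    if "N k \<le> m" "N k \<le> n" for k m n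
    using that by blast
  \<comment> \<open>The sum dominates each \<open>N k\<close>, and the summand k makes r strictly
    increasing.\<close>
  define r where "r k = (\<Sum>i\<le>k. N i) + k" for k
  have r: "strict_mono r" by (rule strict_monoI_Suc) (simp add: r_def)
  have rN: "N k \<le> r k" for k
    unfolding r_def by (rule trans_le_add1) (rule member_le_sum, auto)
  define A where "A k = {x \<in> space M. (1/2)^k < \<bar>F (r (Suc k)) x - F (r k) x\<bar>}" for k
  have A[measurable]: "A k \<in> sets M" for k unfolding A_def by measurable
  have AN: "emeasure M (A k) \<le> ennreal ((1/2)^k)" for k
    unfolding A_def
    using N[of k "r (Suc k)" "r k"] rN[of k] strict_monoD[OF r, of k "Suc k"] by simp
  \<comment> \<open>Borel-Cantelli: almost every x lies in finitely many \<open>A k\<close> only,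
    after which the increments are dominated by a geometric series.\<close>
  then have "AE x in M. eventually (\<lambda>k. x \<in> space M - A k) sequentially"
  proof (intro borel_cantelli_AE1)
    show "emeasure M (A k) < \<infinity>" for k using AN[of k] by (simp add: le_less_trans)
    have "measure M (A k) \<le> (1/2)^k" for k
      using AN[of k] unfolding measure_def by (simp add: enn2real_leI)
    then show "summable (\<lambda>k. measure M (A k))"
      by (intro summable_comparison_test'[OF summable_geometric[of "1/2::real"], of 0]) auto
  qed simp
  then have conv: "AE x in M. convergent (\<lambda>n. F (r n) x)"
  proof eventually_elim
    case (elim x)
    then obtain K where K: "\<And>k. k \<ge> K \<Longrightarrow> \<bar>F (r (Suc k)) x - F (r k) x\<bar> \<le> (1/2)^k"
      unfolding eventually_sequentially A_def by force
    have "summable (\<lambda>k. F (r (Suc k)) x - F (r k) x)"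
      using K by (intro summable_comparison_test'[OF summable_geometric[of "1/2::real"], of K]) auto
    then have "convergent (\<lambda>n. \<Sum>k<n. F (r (Suc k)) x - F (r k) x)"
      by (simp add: summable_iff_convergent)
    then have "convergent (\<lambda>n. F (r n) x - F (r 0) x)"
      by (simp add: sum_lessThan_telescope[where f = "\<lambda>k. F (r k) x"])
    then show ?case
      using convergent_add[OF _ convergent_const[of "F (r 0) x"]] by fastforce
  qed
  show ?thesis
  proof (rule that[OF r])
    show "(\<lambda>x. lim (\<lambda>n. F (r n) x)) \<in> borel_measurable M" by measurable
    show "AE x in M. (\<lambda>n. F (r n) x) \<longlonglongrightarrow> lim (\<lambda>n. F (r n) x)"
      using conv by eventually_elim (simp add: convergent_LIMSEQ_iff)
  qed
qed

text \<open>Since \<open>exp (- g)\<close> lies between 0 and 1, its integral over a finite measure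
  can be minimized over each \<open>C n\<close> without any bound on the members, and strict
  convexity of the exponential makes near-minimizers close in measure. The conclusion speaks of
  \<open>exp (- g / 2)\<close>, whose square is \<open>exp (- g)\<close>; h may be 0 where the
  functions tend to \<infinity>.\<close>

lemma (in sigma_finite_measure) midpoint_closed_AE_limit:
  fixes C :: "nat \<Rightarrow> ('a \<Rightarrow> real) set"
  assumes dec: "decseq C" and ne: "\<And>n. C n \<noteq> {}"
    and meas: "\<And>n g. g \<in> C n \<Longrightarrow> g \<in> borel_measurable M"
    and nonneg: "\<And>n g x. g \<in> C n \<Longrightarrow> x \<in> space M \<Longrightarrow> 0 \<le> g x"
    and mid: "\<And>n f g. f \<in> C n \<Longrightarrow> g \<in> C n \<Longrightarrow> (\<lambda>x. (f x + g x) / 2) \<in> C n"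
  obtains g h where "\<And>n. g n \<in> C n" "h \<in> borel_measurable M"
    "AE x in M. (\<lambda>n. exp (- g n x / 2)) \<longlonglongrightarrow> h x"
proof -
  \<comment> \<open>The density w makes \<open>N\<close> finite; being positive, it gives
    \<open>N\<close> the null sets of \<open>M\<close>, so that limits almost everywhere carry
    back.\<close>
  obtain w where [measurable]: "w \<in> borel_measurable M" and w: "integral\<^sup>N M w \<noteq> \<infinity>"
      "\<And>x. x \<in> space M \<Longrightarrow> 0 < w x \<and> w x < \<infinity>"
    using Ex_finite_integrable_function by blast
  define N where "N = density M w"
  have "emeasure N (space N) = integral\<^sup>N M w"
    by (auto simp: N_def emeasure_density intro!: nn_integral_cong)
  then interpret N: finite_measure N using w by (intro finite_measureI) simp
  have sN[measurable_cong]: "sets N = sets M" and spN: "space N = space M" by (auto simp: N_def)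
  have bm: "borel_measurable N = borel_measurable M" using sN by (simp add: measurable_def spN)
  define I where "I g = (LINT x|N. exp (- g x))" for g :: "'a \<Rightarrow> real"
  have int: "integrable N (\<lambda>x. exp (- g x))" if "g \<in> C n" for g n
    using meas[OF that] nonneg[OF that]
    by (intro N.integrable_const_bound[of _ 1] AE_I2) (auto simp: bm spN)
  have I0: "0 \<le> I g" for g unfolding I_def by simp
  have bdd: "bdd_below (I ` C n)" for n using I0 by (auto intro!: bdd_belowI[of _ 0])
  define D where "D n = Inf (I ` C n)" for n
  have D_le: "D n \<le> I g" if "g \<in> C n" for g n
    unfolding D_def by (rule cInf_lower) (use that bdd in auto)
  have I_le: "I g \<le> measure N (space N)" if "g \<in> C n" for g n
  proof -
    have "I g \<le> (\<integral>x. 1 \<partial>N)" unfolding I_def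
      by (rule integral_mono) (use int[OF that] nonneg[OF that] in \<open>auto simp: spN\<close>)
    then show ?thesis by simp
  qed
  \<comment> \<open>The infima increase because the sets shrink, and they are bounded. Hence the
    difference \<open>D m - D n\<close> in \<open>key\<close> becomes small.\<close>
  have "incseq D"
    unfolding D_def
    by (intro monoI cInf_superset_mono image_mono) (use ne bdd dec in \<open>auto simp: decseq_def\<close>)
  moreover have "D n \<le> measure N (space N)" for n
    using ne[of n] D_le[of _ n] I_le[of _ n] by (meson all_not_in_conv order_trans)
  ultimately have Dconv: "convergent D"
    by (metis incseq_convergent convergentI)
  have "\<exists>g\<in>C n. I g < D n + 1 / real (Suc n)" for n
    using cInf_lessD[of "I ` C n" "D n + 1 / real (Suc n)"] ne[of n] unfolding D_def by auto
  then obtain g where g: "\<And>n. g n \<in> C n" "\<And>n. I (g n) < D n + 1 / real (Suc n)"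
    by metis
  have gC: "g m \<in> C n" if "n \<le> m" for m n using g(1)[of m] dec that by (auto simp: decseq_def)
  have gm[measurable]: "g n \<in> borel_measurable M" for n using g meas by blast
  define e where "e n x = exp (- g n x / 2)" for n x
  have em[measurable]: "e n \<in> borel_measurable M" for n unfolding e_def by measurable
  text \<open>The defect of \<open>exp (-_)\<close> at midpoints is exactly a square, so near-minimizers of \<open>I\<close>
    are close to each other.\<close>
  have key: "(\<integral>x. (e m x - e n x)\<^sup>2 \<partial>N) \<le> D m - D n + 2 / real (Suc n)"
    and sqint: "integrable N (\<lambda>x. (e m x - e n x)\<^sup>2)" if nm: "n \<le> m" for m n
  proof -
    have id: "(e m x - e n x)\<^sup>2 = exp (- g m x) + exp (- g n x) - 2 * exp (- ((g m x + g n x) / 2))" for x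
    proof -
      have sq: "(exp (- u / 2))\<^sup>2 = exp (- u)" for u :: real
        by (simp add: power2_eq_square flip: exp_add)
      have pr: "exp (- ((g m x + g n x) / 2)) = e m x * e n x"
        by (simp add: e_def add_divide_distrib flip: exp_add)
      show ?thesis
        unfolding pr power2_diff by (simp only: e_def sq mult.assoc)
    qed
    have mC: "(\<lambda>x. (g m x + g n x) / 2) \<in> C n" using mid[OF gC[OF nm] g(1)] by simp
    show "integrable N (\<lambda>x. (e m x - e n x)\<^sup>2)"
      unfolding id using int[OF g(1)[of m]] int[OF g(1)[of n]] int[OF mC] by simp
    have "(\<integral>x. (e m x - e n x)\<^sup>2 \<partial>N) = I (g m) + I (g n) - 2 * I (\<lambda>x. (g m x + g n x) / 2)"
      unfolding id I_def using int[OF g(1)[of m]] int[OF g(1)[of n]] int[OF mC] by simp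
    also have "\<dots> \<le> (D m + 1 / real (Suc m)) + (D n + 1 / real (Suc n)) - 2 * D n"
      using g(2)[of m] g(2)[of n] D_le[OF mC] by linarith
    also have "1 / real (Suc m) \<le> 1 / real (Suc n)" using nm by (simp add: frac_le)
    finally show "(\<integral>x. (e m x - e n x)\<^sup>2 \<partial>N) \<le> D m - D n + 2 / real (Suc n)" by simp
  qed
  have mk: "emeasure N {x \<in> space N. s < \<bar>e m x - e n x\<bar>} \<le> ennreal ((D m - D n + 2 / real (Suc n)) / s\<^sup>2)"
    if nm: "n \<le> m" and s: "0 < s" for m n s
  proof -
    have "{x \<in> space N. s < \<bar>e m x - e n x\<bar>} \<subseteq> {x \<in> space N. s\<^sup>2 \<le> (e m x - e n x)\<^sup>2}"
      using s by (auto simp: power2_le_iff_abs_le less_imp_le simp flip: abs_le_square_iff)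
    then have "emeasure N {x \<in> space N. s < \<bar>e m x - e n x\<bar>} \<le> emeasure N {x \<in> space N. s\<^sup>2 \<le> (e m x - e n x)\<^sup>2}"
      by (intro emeasure_mono) (auto simp: sN spN)
    also have "\<dots> \<le> ennreal ((\<integral>x. (e m x - e n x)\<^sup>2 \<partial>N) / s\<^sup>2)"
      unfolding N.emeasure_eq_measure
      using integral_Markov_inequality_measure[OF sqint[OF nm], of "{}" "s\<^sup>2"] s
      by (intro ennreal_leI) (auto simp: bm)
    also have "\<dots> \<le> ennreal ((D m - D n + 2 / real (Suc n)) / s\<^sup>2)"
      using key[OF nm] s by (intro ennreal_leI divide_right_mono) auto
    finally show ?thesis .
  qed
  have "\<exists>n0. \<forall>m\<ge>n0. \<forall>n\<ge>n0. emeasure N {x \<in> space N. s < \<bar>e m x - e n x\<bar>} \<le> ennreal d"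
    if s: "0 < s" and d: "0 < d" for s d
  proof -
    \<comment> \<open>Two errors below q add up to at most \<open>d * s\<^sup>2\<close>, which the
      division by \<open>s\<^sup>2\<close> in \<open>mk\<close> turns into d.\<close>
    define q where "q = d * s\<^sup>2 / 2"
    have q: "0 < q" using s d by (simp add: q_def)
    obtain n1 where n1: "\<And>m n. m \<ge> n1 \<Longrightarrow> n \<ge> n1 \<Longrightarrow> \<bar>D m - D n\<bar> < q"
      using convergent_Cauchy[OF Dconv] q unfolding Cauchy_def dist_real_def by meson
    obtain n2 where n2: "2 / real (Suc n2) < q"
      using reals_Archimedean[of "q / 2"] q by (auto simp: inverse_eq_divide field_simps)
    have le: "(D m - D n + 2 / real (Suc n)) / s\<^sup>2 \<le> d" if "m \<ge> max n1 n2" "n \<ge> max n1 n2" for m n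
    proof -
      have "2 / real (Suc n) \<le> 2 / real (Suc n2)" using that by (simp add: frac_le)
      then have "D m - D n + 2 / real (Suc n) \<le> 2 * q" using n1[of m n] n2 that by auto
      then show ?thesis using s by (simp add: q_def divide_le_eq)
    qed
    have "emeasure N {x \<in> space N. s < \<bar>e m x - e n x\<bar>} \<le> ennreal d"
      if mn: "m \<ge> max n1 n2" "n \<ge> max n1 n2" for m n
    proof (cases "n \<le> m")
      case True
      show ?thesis using order_trans[OF mk[OF True s] ennreal_leI[OF le[OF mn]]] .
    next
      case False
      then have "m \<le> n" by simp
      from order_trans[OF mk[OF this s] ennreal_leI[OF le[OF mn(2,1)]]]
      show ?thesis by (simp add: abs_minus_commute)
    qed
    then show ?thesis by blast
  qed
  then obtain r h where r: "strict_mono (r :: nat \<Rightarrow> nat)" and h: "h \<in> borel_measurable N"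
      and lim: "AE x in N. (\<lambda>n. e (r n) x) \<longlonglongrightarrow> h x"
    using cauchy_in_measure_AE_subseq[of e N] em bm by blast
  have "AE x in M. 0 < w x \<longrightarrow> (\<lambda>n. e (r n) x) \<longlonglongrightarrow> h x"
    using lim unfolding N_def by (simp add: AE_density)
  then have "AE x in M. (\<lambda>n. e (r n) x) \<longlonglongrightarrow> h x"
    using w(2) by (auto elim!: AE_mp intro!: AE_I2)
  then show ?thesis
    using that[of "\<lambda>n. g (r n)" h] gC[OF seq_suble[OF r]] h bm by (auto simp: e_def)
qed

section \<open>Function norms with the Fatou property\<close>

text \<open>Turns plain convergence into monotone convergence, so that a Fatou property stated for
  increasing sequences applies in \<open>complete\<close>.\<close>

lemma tail_INF_tendsto:
  fixes a :: "nat \<Rightarrow> real"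
  assumes lim: "a \<longlonglongrightarrow> L" and bdd: "\<And>j. b \<le> a j"
  shows "incseq (\<lambda>k. INF j\<in>{k..}. a j)" "(\<lambda>k. INF j\<in>{k..}. a j) \<longlonglongrightarrow> L"
proof -
  have B: "bdd_below (a ` {k..})" for k using bdd by (auto intro: bdd_belowI[of _ b])
  show "incseq (\<lambda>k. INF j\<in>{k..}. a j)"
    by (intro monoI cINF_superset_mono B) auto
  show "(\<lambda>k. INF j\<in>{k..}. a j) \<longlonglongrightarrow> L"
  proof (rule LIMSEQ_I)
    fix e :: real assume e: "0 < e"
    obtain K where K: "\<And>k. k \<ge> K \<Longrightarrow> \<bar>a k - L\<bar> < e / 2"
      using LIMSEQ_D[OF lim, of "e/2"] e by auto
    have "norm ((INF j\<in>{k..}. a j) - L) < e" if k: "k \<ge> K" for k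
    proof -
      have "(INF j\<in>{k..}. a j) \<le> a k" by (rule cINF_lower[OF B]) simp
      moreover have "L - e / 2 \<le> (INF j\<in>{k..}. a j)"
      proof (rule cINF_greatest)
        fix j assume "j \<in> {k..}"
        then have "\<bar>a j - L\<bar> < e / 2" using K[of j] k by simp
        then show "L - e / 2 \<le> a j" by linarith
      qed simp
      ultimately show ?thesis using K[OF k] e unfolding real_norm_def by linarith
    qed
    then show "\<exists>no. \<forall>n\<ge>no. norm ((INF j\<in>{n..}. a j) - L) < e" by blast
  qed
qed

text \<open>Values in \<open>ennreal\<close> let \<rho> be used on all measurable functions.
  \<open>rho_fatou\<close> is only the upper bound in the Fatou property; convergence of the norms
  follows with \<open>rho_mono\<close>. \<open>rho_small\<close> gives definiteness as well as
  convergence in measure of Cauchy sequences.\<close>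

locale fatou_norm =
  fixes M :: "'a measure" and \<rho> :: "('a \<Rightarrow> real) \<Rightarrow> ennreal"
  assumes rho_0: "\<rho> (\<lambda>_. 0) = 0"
    and rho_add: "f \<in> borel_measurable M \<Longrightarrow> g \<in> borel_measurable M \<Longrightarrow>
      \<rho> (\<lambda>t. f t + g t) \<le> \<rho> f + \<rho> g"
    and rho_scale: "f \<in> borel_measurable M \<Longrightarrow> c \<noteq> 0 \<Longrightarrow> \<rho> (\<lambda>t. c * f t) = ennreal \<bar>c\<bar> * \<rho> f"
    and rho_mono: "f \<in> borel_measurable M \<Longrightarrow> g \<in> borel_measurable M \<Longrightarrow>
      AE t in M. \<bar>g t\<bar> \<le> \<bar>f t\<bar> \<Longrightarrow> \<rho> g \<le> \<rho> f"
    and rho_fatou: "(\<And>n. F n \<in> borel_measurable M) \<Longrightarrow> f \<in> borel_measurable M \<Longrightarrow>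
      (\<And>n. AE t in M. 0 \<le> F n t) \<Longrightarrow>
      AE t in M. incseq (\<lambda>n. F n t) \<and> (\<lambda>n. F n t) \<longlonglongrightarrow> f t \<Longrightarrow>
      0 \<le> K \<Longrightarrow> (\<And>n. \<rho> (F n) \<le> ennreal K) \<Longrightarrow> \<rho> f \<le> ennreal K"
    and rho_small: "0 < s \<Longrightarrow> 0 < d \<Longrightarrow>
      \<exists>e>0. \<forall>f\<in>borel_measurable M. \<rho> f < ennreal e \<longrightarrow> distribution_fun M f s \<le> ennreal d"
begin

abbreviation "E \<equiv> {f \<in> borel_measurable M. \<rho> f < \<infinity>}"

lemma ennreal_rho: "f \<in> E \<Longrightarrow> ennreal (enn2real (\<rho> f)) = \<rho> f"
  by simp

lemma add_mem: "f \<in> E \<Longrightarrow> g \<in> E \<Longrightarrow> (\<lambda>t. f t + g t) \<in> E"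
  using le_less_trans[OF rho_add[of f g]] by (auto simp: ennreal_add_less_top)

lemma scale_mem: "f \<in> E \<Longrightarrow> (\<lambda>t. c * f t) \<in> E"
  using rho_scale[of f c] rho_0 by (cases "c = 0") (auto simp: ennreal_mult_less_top)

lemma diff_mem: "f \<in> E \<Longrightarrow> g \<in> E \<Longrightarrow> (\<lambda>t. f t - g t) \<in> E"
  using add_mem[OF _ scale_mem, of f g "-1"] by simp

lemma rho_eq_0_iff:
  assumes f: "f \<in> borel_measurable M"
  shows "\<rho> f = 0 \<longleftrightarrow> (AE t in M. f t = 0)"
proof
  assume 0: "\<rho> f = 0"
  have "AE t in M. \<not> 1 / real (Suc n) < \<bar>f t\<bar>" for n
  proof -
    have "distribution_fun M f (1 / real (Suc n)) \<le> ennreal d" if "0 < d" for d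
      using rho_small[of "1 / real (Suc n)" d] that f 0 by auto
    then have "emeasure M {t \<in> space M. 1 / real (Suc n) < \<bar>f t\<bar>} \<le> 0"
      unfolding distribution_fun_def by - (rule ennreal_le_epsilon, auto)
    then show ?thesis
      using f by (subst AE_iff_measurable[OF _ refl]) (auto intro: antisym)
  qed
  then have "AE t in M. \<forall>n. \<not> 1 / real (Suc n) < \<bar>f t\<bar>" by (simp add: AE_all_countable)
  then show "AE t in M. f t = 0"
  proof eventually_elim
    case (elim t)
    show ?case
    proof (rule ccontr)
      assume "f t \<noteq> 0"
      then obtain n where "inverse (real (Suc n)) < \<bar>f t\<bar>" using reals_Archimedean[of "\<bar>f t\<bar>"] by auto
      then show False using elim by (simp add: inverse_eq_divide)
    qed
  qed
next
  assume "AE t in M. f t = 0"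
  then have "AE t in M. \<bar>f t\<bar> \<le> \<bar>0::real\<bar>" by simp
  then have "\<rho> f \<le> 0" using rho_mono[of "\<lambda>_. 0" f] f rho_0 by simp
  then show "\<rho> f = 0" by simp
qed

text \<open>A subsequence converges almost everywhere to some f. Norm convergence then follows by
  writing \<open>\<bar>F n - f\<bar>\<close> as an increasing limit of functions of small norm,
  namely the tail infima of the distances from \<open>F n\<close> to later members.\<close>

lemma complete:
  assumes F: "\<And>n. F n \<in> E"
    and cauchy: "\<And>e. 0 < e \<Longrightarrow>
      \<exists>n0. \<forall>m\<ge>n0. \<forall>n\<ge>n0. enn2real (\<rho> (\<lambda>t. F m t - F n t)) < e"
  shows "\<exists>f\<in>E. (\<lambda>n. enn2real (\<rho> (\<lambda>t. F n t - f t))) \<longlonglongrightarrow> 0"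
proof -
  have Fm[measurable]: "F n \<in> borel_measurable M" for n using F by simp
  have C: "\<exists>n0. \<forall>m\<ge>n0. \<forall>n\<ge>n0. \<rho> (\<lambda>t. F m t - F n t) < ennreal e" if e: "0 < e" for e
  proof -
    have "\<rho> (\<lambda>t. F m t - F n t) < ennreal e"
      if "enn2real (\<rho> (\<lambda>t. F m t - F n t)) < e" for m n
      using that diff_mem[OF F F, of m n] ennreal_rho[of "\<lambda>t. F m t - F n t"] e
      by (metis enn2real_nonneg ennreal_lessI)
    then show ?thesis using cauchy[OF e] by meson
  qed
  have "\<exists>n0. \<forall>m\<ge>n0. \<forall>n\<ge>n0. emeasure M {x \<in> space M. s < \<bar>F m x - F n x\<bar>} \<le> ennreal d"
    if "0 < s" "0 < d" for s d
  proof -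
    obtain e where e: "0 < e" "\<And>f. f \<in> borel_measurable M \<Longrightarrow> \<rho> f < ennreal e \<Longrightarrow>
        distribution_fun M f s \<le> ennreal d"
      using rho_small[OF \<open>0 < s\<close> \<open>0 < d\<close>] by blast
    obtain n0 where n0: "\<And>m n. m \<ge> n0 \<Longrightarrow> n \<ge> n0 \<Longrightarrow> \<rho> (\<lambda>t. F m t - F n t) < ennreal e"
      using C[OF e(1)] by blast
    have "emeasure M {x \<in> space M. s < \<bar>F m x - F n x\<bar>} \<le> ennreal d" if "m \<ge> n0" "n \<ge> n0" for m n
      using e(2)[OF _ n0[OF that]] by (simp add: distribution_fun_def)
    then show ?thesis by blast
  qed
  then obtain r f where r: "strict_mono (r :: nat \<Rightarrow> nat)" and f[measurable]: "f \<in> borel_measurable M"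
      and lim: "AE x in M. (\<lambda>n. F (r n) x) \<longlonglongrightarrow> f x"
    using cauchy_in_measure_AE_subseq[of F M] Fm by blast
  have close: "\<exists>n0. \<forall>n\<ge>n0. \<rho> (\<lambda>t. F n t - f t) \<le> ennreal e" if e: "0 < e" for e
  proof -
    obtain n0 where n0: "\<And>m n. m \<ge> n0 \<Longrightarrow> n \<ge> n0 \<Longrightarrow> \<rho> (\<lambda>t. F m t - F n t) < ennreal e"
      using C[OF e] by blast
    have "\<rho> (\<lambda>t. F n t - f t) \<le> ennreal e" if n: "n \<ge> n0" for n
    proof -
      \<comment> \<open>The shift by n0 keeps every index \<open>r (j + n0)\<close> in the range
        where the Cauchy bound holds.\<close>
      define a where "a j x = \<bar>F n x - F (r (j + n0)) x\<bar>" for j x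
      define m where "m k x = (INF j\<in>{k..}. a j x)" for k x
      have am[measurable]: "a j \<in> borel_measurable M" for j unfolding a_def by measurable
      have mm[measurable]: "m k \<in> borel_measurable M" for k
        unfolding m_def by (intro borel_measurable_cINF_real) (auto simp: a_def intro!: bdd_belowI[of _ 0])
      have m0: "0 \<le> m k x" for k x unfolding m_def by (intro cINF_greatest) (auto simp: a_def)
      have ma: "m k x \<le> a k x" for k x
        unfolding m_def by (intro cINF_lower) (auto simp: a_def intro!: bdd_belowI[of _ 0])
      have "\<rho> (\<lambda>t. \<bar>F n t - f t\<bar>) \<le> ennreal e"
      proof (rule rho_fatou[of m])
        show "AE t in M. incseq (\<lambda>k. m k t) \<and> (\<lambda>k. m k t) \<longlonglongrightarrow> \<bar>F n t - f t\<bar>"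
          using lim
        proof eventually_elim
          case (elim t)
          have "(\<lambda>j. a j t) \<longlonglongrightarrow> \<bar>F n t - f t\<bar>"
            unfolding a_def by (intro tendsto_intros LIMSEQ_ignore_initial_segment elim)
          from tail_INF_tendsto[OF this, of 0] show ?case by (simp add: m_def a_def)
        qed
        show "\<rho> (m k) \<le> ennreal e" for k
        proof -
          have "\<rho> (m k) \<le> \<rho> (\<lambda>t. F n t - F (r (k + n0)) t)"
            using m0 ma[of k] by (intro rho_mono AE_I2) (auto simp: a_def)
          also have "\<dots> < ennreal e"
            using n0[OF n, of "r (k + n0)"] seq_suble[OF r, of "k + n0"] by simp
          finally show ?thesis by simp
        qed
      qed (use m0 e in auto)
      moreover have "\<rho> (\<lambda>t. F n t - f t) \<le> \<rho> (\<lambda>t. \<bar>F n t - f t\<bar>)"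
        by (intro rho_mono) auto
      ultimately show ?thesis by (rule order_trans[rotated])
    qed
    then show ?thesis by blast
  qed
  obtain n where n: "\<rho> (\<lambda>t. F n t - f t) \<le> ennreal 1" using close[of 1] by auto
  have "(\<lambda>t. F n t - f t) \<in> E" using le_less_trans[OF n] by auto
  from diff_mem[OF F this, of n] have "f \<in> E" by simp
  moreover have "(\<lambda>n. enn2real (\<rho> (\<lambda>t. F n t - f t))) \<longlonglongrightarrow> 0"
  proof (rule LIMSEQ_I)
    fix e :: real assume e: "0 < e"
    obtain n0 where n0: "\<And>n. n \<ge> n0 \<Longrightarrow> \<rho> (\<lambda>t. F n t - f t) \<le> ennreal (e/2)"
      using close[of "e/2"] e by auto
    have "norm (enn2real (\<rho> (\<lambda>t. F n t - f t)) - 0) < e" if "n \<ge> n0" for n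
      using enn2real_leI[OF _ n0[OF that]] e by simp
    then show "\<exists>no. \<forall>n\<ge>no. norm (enn2real (\<rho> (\<lambda>t. F n t - f t)) - 0) < e" by blast
  qed
  ultimately show ?thesis by blast
qed

lemma enn2real_rho_mono:
  assumes "f \<in> E" "g \<in> borel_measurable M" "AE t in M. \<bar>g t\<bar> \<le> \<bar>f t\<bar>"
  shows "g \<in> E \<and> enn2real (\<rho> g) \<le> enn2real (\<rho> f)"
  using rho_mono[of f g] assms by (auto intro: enn2real_mono le_less_trans)

theorem banach_function_space: "banach_function_space M E (\<lambda>f. enn2real (\<rho> f))"
  unfolding banach_function_space_def
proof (intro conjI ballI allI impI)
  show "E \<subseteq> borel_measurable M" by auto
  show "(\<lambda>_. 0) \<in> E" using rho_0 by simp
next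
  fix f g assume fg: "f \<in> E" "g \<in> E"
  show "(\<lambda>t. f t + g t) \<in> E" using add_mem[OF fg] .
  have "enn2real (\<rho> (\<lambda>t. f t + g t)) \<le> enn2real (\<rho> f + \<rho> g)"
    using rho_add[of f g] fg by (intro enn2real_mono) (auto simp: ennreal_add_less_top)
  also have "\<dots> = enn2real (\<rho> f) + enn2real (\<rho> g)" using fg by (intro enn2real_plus) auto
  finally show "enn2real (\<rho> (\<lambda>t. f t + g t)) \<le> enn2real (\<rho> f) + enn2real (\<rho> g)" .
next
  fix f c assume f: "f \<in> E"
  show "(\<lambda>t. c * f t) \<in> E" using scale_mem[OF f] .
  show "enn2real (\<rho> (\<lambda>t. c * f t)) = \<bar>c\<bar> * enn2real (\<rho> f)"
    using rho_scale[of f c] rho_0 f by (cases "c = 0") (auto simp: enn2real_mult)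
next
  fix f assume f: "f \<in> E"
  show "0 \<le> enn2real (\<rho> f)" by simp
  show "(enn2real (\<rho> f) = 0) = (AE t in M. f t = 0)"
    using rho_eq_0_iff[of f] f by (auto simp: enn2real_eq_0_iff)
next
  fix F :: "nat \<Rightarrow> 'a \<Rightarrow> real"
  assume "(\<forall>n. F n \<in> E) \<and> (\<forall>e>0. \<exists>n\<^sub>0. \<forall>m\<ge>n\<^sub>0. \<forall>n\<ge>n\<^sub>0. enn2real (\<rho> (\<lambda>t. F m t - F n t)) < e)"
  then show "\<exists>f\<in>E. (\<lambda>n. enn2real (\<rho> (\<lambda>t. F n t - f t))) \<longlonglongrightarrow> 0"
    by (intro complete) auto
next
  fix f g assume "f \<in> E" "g \<in> borel_measurable M" "AE t in M. \<bar>g t\<bar> \<le> \<bar>f t\<bar>"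
  from enn2real_rho_mono[OF this]
  show "g \<in> E" "enn2real (\<rho> g) \<le> enn2real (\<rho> f)" by auto
qed

theorem fatou_property: "fatou_property M E (\<lambda>f. enn2real (\<rho> f))"
  unfolding fatou_property_def
proof (intro allI ballI impI, elim conjE)
  fix F f
  assume f: "f \<in> borel_measurable M" and F: "\<forall>n. F n \<in> E" and F0: "\<forall>n. AE t in M. 0 \<le> F n t"
    and inc: "AE t in M. incseq (\<lambda>n. F n t) \<and> (\<lambda>n. F n t) \<longlonglongrightarrow> f t"
    and bdd: "bdd_above (range (\<lambda>n. enn2real (\<rho> (F n))))"
  let ?N = "\<lambda>n. enn2real (\<rho> (F n))"
  define K where "K = (SUP n. ?N n)"
  have NK: "?N n \<le> K" for n unfolding K_def by (intro cSUP_upper bdd) simp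
  have K0: "0 \<le> K" using NK[of 0] enn2real_nonneg order_trans by blast
  have F0': "AE t in M. \<forall>n. 0 \<le> F n t" using F0 by (simp add: AE_all_countable)
  have rf: "\<rho> f \<le> ennreal K"
  proof (rule rho_fatou[of F, OF _ f _ inc K0])
    show "\<rho> (F n) \<le> ennreal K" for n
      using ennreal_leI[OF NK[of n]] ennreal_rho[of "F n"] F by simp
  qed (use F F0 in auto)
  then have fE: "f \<in> E" using f le_less_trans[of "\<rho> f" "ennreal K"] by auto
  have incN: "incseq ?N"
  proof (rule monoI)
    fix m n :: nat assume mn: "m \<le> n"
    have "AE t in M. \<bar>F m t\<bar> \<le> \<bar>F n t\<bar>" using inc F0'
      by eventually_elim (use mn in \<open>auto simp: incseq_def\<close>)
    then show "?N m \<le> ?N n" using enn2real_rho_mono F by blast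
  qed
  have "?N n \<le> enn2real (\<rho> f)" for n
  proof -
    have "AE t in M. \<bar>F n t\<bar> \<le> \<bar>f t\<bar>" using inc F0'
    proof eventually_elim
      case (elim t)
      then have "0 \<le> F n t" "F n t \<le> f t" by (auto intro: incseq_le)
      then show ?case by simp
    qed
    then show ?thesis using enn2real_rho_mono[OF fE] F by blast
  qed
  then have "K \<le> enn2real (\<rho> f)" unfolding K_def by (intro cSUP_least) auto
  moreover have "enn2real (\<rho> f) \<le> K" using enn2real_leI[OF K0 rf] .
  ultimately have "K = enn2real (\<rho> f)" by simp
  then have "?N \<longlonglongrightarrow> enn2real (\<rho> f)"
    using LIMSEQ_incseq_SUP[OF bdd incN] unfolding K_def by simp
  then show "f \<in> E \<and> incseq ?N \<and> ?N \<longlonglongrightarrow> enn2real (\<rho> f)"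
    using fE incN by blast
qed

end

section \<open>Modulars given by an infimum over a convex set of weights\<close>

locale orlicz =
  fixes \<phi> :: "real \<Rightarrow> real"
  assumes orlicz: "orlicz_function \<phi>"
begin

abbreviation "\<Phi> \<equiv> orlicz_term \<phi>"

lemma phi_0 [simp]: "\<phi> 0 = 0"
  using orlicz by (simp add: orlicz_function_def)

lemma phi_mono: "0 \<le> x \<Longrightarrow> x \<le> y \<Longrightarrow> \<phi> x \<le> \<phi> y"
  using orlicz strict_mono_on_leD[of "{0..}" \<phi> x y] by (auto simp: orlicz_function_def)

lemma phi_nonneg [simp]: "0 \<le> x \<Longrightarrow> 0 \<le> \<phi> x"
  using phi_mono[of 0 x] by simp

lemma phi_pos: "0 < x \<Longrightarrow> 0 < \<phi> x"
  using orlicz strict_mono_onD[of "{0..}" \<phi> 0 x] by (auto simp: orlicz_function_def)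

lemma phi_convex:
  "0 \<le> x \<Longrightarrow> 0 \<le> y \<Longrightarrow> 0 \<le> a \<Longrightarrow> 0 \<le> b \<Longrightarrow> a + b = 1 \<Longrightarrow>
    \<phi> (a * x + b * y) \<le> a * \<phi> x + b * \<phi> y"
  using orlicz unfolding orlicz_function_def convex_on_def by auto

lemma phi_ge_linear: "1 \<le> u \<Longrightarrow> u * \<phi> 1 \<le> \<phi> u"
  using phi_convex[of u 0 "1 / u" "1 - 1 / u"] by (simp add: field_simps)

text \<open>The even extension is convex because \<phi> is increasing, and it makes 0 an interior
  point; convexity on an open set then gives continuity there too.\<close>

lemma continuous_phi_abs: "continuous_on UNIV (\<lambda>u. \<phi> \<bar>u\<bar>)"
proof (rule convex_on_continuous)
  show "convex_on UNIV (\<lambda>u. \<phi> \<bar>u\<bar>)"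
  proof (rule convex_onI)
    fix t x y :: real assume t: "0 < t" "t < 1"
    have "\<bar>(1 - t) * x + t * y\<bar> \<le> (1 - t) * \<bar>x\<bar> + t * \<bar>y\<bar>"
      using t by (intro order_trans[OF abs_triangle_ineq]) (simp add: abs_mult)
    then have "\<phi> \<bar>(1 - t) * x + t * y\<bar> \<le> \<phi> ((1 - t) * \<bar>x\<bar> + t * \<bar>y\<bar>)" by (intro phi_mono) auto
    also have "\<dots> \<le> (1 - t) * \<phi> \<bar>x\<bar> + t * \<phi> \<bar>y\<bar>" using t by (intro phi_convex) auto
    finally show "\<phi> \<bar>(1 - t) *\<^sub>R x + t *\<^sub>R y\<bar> \<le> (1 - t) * \<phi> \<bar>x\<bar> + t * \<phi> \<bar>y\<bar>" by simp
  qed simp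
qed simp

section \<open>The perspective function of \<phi>\<close>

lemma Phi_0 [simp]: "\<Phi> 0 v = 0"
  by (simp add: orlicz_term_def)

lemma Phi_abs [simp]: "\<Phi> \<bar>y\<bar> v = \<Phi> y v"
  by (simp add: orlicz_term_def)

lemma Phi_pos: "0 < v \<Longrightarrow> \<Phi> y v = ennreal (\<phi> \<bar>y / v\<bar> * v)"
  by (simp add: orlicz_term_def)

lemma Phi_mono: "\<bar>y\<bar> \<le> \<bar>z\<bar> \<Longrightarrow> 0 \<le> v \<Longrightarrow> \<Phi> y v \<le> \<Phi> z v"
  by (auto simp: orlicz_term_def intro!: ennreal_leI mult_right_mono phi_mono divide_right_mono)

lemma Phi_scale: "0 < c \<Longrightarrow> 0 \<le> v \<Longrightarrow> \<Phi> (c * y) (c * v) = ennreal c * \<Phi> y v"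
  by (auto simp: orlicz_term_def abs_mult ennreal_mult[symmetric] ennreal_mult_top mult_ac)

text \<open>Together with the homogeneity \<open>Phi_scale\<close> this is joint convexity of the
  perspective \<open>\<Phi>\<close>. If one weight is 0, either the right side is infinite or the
  corresponding argument is 0.\<close>

lemma Phi_add:
  assumes "0 \<le> u" "0 \<le> v" shows "\<Phi> (x + y) (u + v) \<le> \<Phi> x u + \<Phi> y v"
proof (cases "u = 0 \<or> v = 0")
  case True
  then show ?thesis by (auto simp: orlicz_term_def)
next
  case False
  then have uv: "0 < u" "0 < v" using assms by auto
  have "\<bar>x + y\<bar> / (u + v) \<le> (\<bar>x\<bar> + \<bar>y\<bar>) / (u + v)" using uv by (intro divide_right_mono) auto
  also have "\<dots> = (u / (u + v)) * (\<bar>x\<bar> / u) + (v / (u + v)) * (\<bar>y\<bar> / v)"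
    using uv by (simp add: add_divide_distrib)
  finally have "\<phi> (\<bar>x + y\<bar> / (u + v)) \<le> \<phi> ((u / (u + v)) * (\<bar>x\<bar> / u) + (v / (u + v)) * (\<bar>y\<bar> / v))"
    using uv by (intro phi_mono) auto
  also have "\<dots> \<le> (u / (u + v)) * \<phi> (\<bar>x\<bar> / u) + (v / (u + v)) * \<phi> (\<bar>y\<bar> / v)"
    using uv by (intro phi_convex) (auto simp: add_divide_distrib[symmetric])
  finally have "\<phi> (\<bar>x + y\<bar> / (u + v)) * (u + v)
      \<le> ((u / (u + v)) * \<phi> (\<bar>x\<bar> / u) + (v / (u + v)) * \<phi> (\<bar>y\<bar> / v)) * (u + v)"
    using uv by (intro mult_right_mono) auto
  also have "\<dots> = \<phi> (\<bar>x\<bar> / u) * u + \<phi> (\<bar>y\<bar> / v) * v"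
    using uv by (simp add: distrib_right)
  finally show ?thesis using uv
    by (simp add: orlicz_term_def ennreal_plus[symmetric] ennreal_leI del: ennreal_plus)
qed

text \<open>The additional weight \<open>v - u\<close> is paired with the argument 0, which costs
  nothing.\<close>

lemma Phi_antimono: "0 \<le> u \<Longrightarrow> u \<le> v \<Longrightarrow> \<Phi> y v \<le> \<Phi> y u"
  using Phi_add[of u "v - u" y 0] by simp

lemma measurable_Phi:
  assumes [measurable]: "f \<in> borel_measurable M" "v \<in> borel_measurable M"
    and v: "\<And>x. x \<in> space M \<Longrightarrow> 0 \<le> v x"
  shows "(\<lambda>x. \<Phi> (f x) (v x)) \<in> borel_measurable M"
proof -
  have [measurable]: "(\<lambda>u. \<phi> \<bar>u\<bar>) \<in> borel_measurable borel"
    by (rule borel_measurable_continuous_onI[OF continuous_phi_abs])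
  have "(\<lambda>x. if v x = 0 then (if f x = 0 then 0 else \<infinity>) else ennreal ((\<lambda>u. \<phi> \<bar>u\<bar>) (f x / v x) * v x))
      \<in> borel_measurable M"
    by measurable
  then show ?thesis
    by (rule measurable_cong[THEN iffD1, rotated]) (use v in \<open>auto simp: orlicz_term_def\<close>)
qed

lemma tendsto_Phi:
  assumes "f \<longlonglongrightarrow> y" "v \<longlonglongrightarrow> u" "0 < u"
  shows "(\<lambda>n. \<Phi> (f n) (v n)) \<longlonglongrightarrow> \<Phi> y u"
proof -
  have "isCont (\<lambda>u. \<phi> \<bar>u\<bar>) (y / u)"
    using continuous_phi_abs by (simp add: continuous_on_eq_continuous_at)
  then have "(\<lambda>n. ennreal (\<phi> \<bar>f n / v n\<bar> * v n)) \<longlonglongrightarrow> ennreal (\<phi> \<bar>y / u\<bar> * u)"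
    using assms
    by (intro tendsto_intros isCont_tendsto_compose[where g = "\<lambda>u. \<phi> \<bar>u\<bar>"]) auto
  moreover have "\<forall>\<^sub>F n in sequentially. ennreal (\<phi> \<bar>f n / v n\<bar> * v n) = \<Phi> (f n) (v n)"
    using order_tendstoD(1)[OF assms(2,3)] by eventually_elim (simp add: Phi_pos)
  ultimately show ?thesis using assms(3) by (simp add: Phi_pos tendsto_cong)
qed

end

text \<open>What the norm needs from submajorization. \<open>V_tight\<close> keeps members of V from
  being large on large sets, uniformly in V; it prevents escape to \<infinity> in the Fatou argument
  and ties the norm to convergence in measure. The positive member w serves for mixing.\<close>

locale orlicz_modular = sigma_finite_measure M + orlicz \<phi>
  for M :: "'a measure" and \<phi> :: "real \<Rightarrow> real" +
  fixes V :: "('a \<Rightarrow> real) set" and w :: "'a \<Rightarrow> real"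
  assumes V_measurable: "v \<in> V \<Longrightarrow> v \<in> borel_measurable M"
    and V_nonneg: "v \<in> V \<Longrightarrow> x \<in> space M \<Longrightarrow> 0 \<le> v x"
    and V_convex: "u \<in> V \<Longrightarrow> v \<in> V \<Longrightarrow> 0 < c \<Longrightarrow> c < 1 \<Longrightarrow> (\<lambda>x. c * u x + (1 - c) * v x) \<in> V"
    and w_mem: "w \<in> V"
    and w_pos: "x \<in> space M \<Longrightarrow> 0 < w x"
    and V_tight: "0 < d \<Longrightarrow> \<exists>\<mu>>0. \<forall>v\<in>V. emeasure M {x \<in> space M. \<mu> < v x} \<le> ennreal d"
    and V_closed: "(\<And>n. g n \<in> V) \<Longrightarrow> v \<in> borel_measurable M \<Longrightarrow> (\<And>x. x \<in> space M \<Longrightarrow> 0 \<le> v x) \<Longrightarrow>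
      AE x in M. (\<lambda>n. g n x) \<longlonglongrightarrow> v x \<Longrightarrow> v \<in> V"
begin

definition J :: "('a \<Rightarrow> real) \<Rightarrow> ('a \<Rightarrow> real) \<Rightarrow> ennreal" where
  "J f v = (\<integral>\<^sup>+x. \<Phi> (f x) (v x) \<partial>M)"

definition P :: "('a \<Rightarrow> real) \<Rightarrow> ennreal" where
  "P f = (INF v\<in>V. J f v)"

abbreviation "\<rho> \<equiv> luxemburg P"

lemma P_le: "v \<in> V \<Longrightarrow> P f \<le> J f v"
  unfolding P_def by (rule INF_lower)

lemma P_less: "P f < a \<Longrightarrow> \<exists>v\<in>V. J f v < a"
  unfolding P_def by (simp add: INF_less_iff)

lemma J_measurable:
  "f \<in> borel_measurable M \<Longrightarrow> v \<in> V \<Longrightarrow> (\<lambda>x. \<Phi> (f x) (v x)) \<in> borel_measurable M"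
  by (rule measurable_Phi) (auto intro: V_measurable V_nonneg)

lemma J_mono:
  assumes le: "AE x in M. \<bar>f x\<bar> \<le> \<bar>g x\<bar>" and v: "v \<in> V"
  shows "J f v \<le> J g v"
  unfolding J_def
proof (rule nn_integral_mono_AE)
  show "AE x in M. \<Phi> (f x) (v x) \<le> \<Phi> (g x) (v x)"
    using le AE_space by eventually_elim (intro Phi_mono V_nonneg v)
qed

lemma P_mono: "AE x in M. \<bar>f x\<bar> \<le> \<bar>g x\<bar> \<Longrightarrow> P f \<le> P g"
  unfolding P_def by (rule INF_mono) (use J_mono in blast)

lemma P_0: "P (\<lambda>_. 0) = 0"
  using P_le[OF w_mem, of "\<lambda>_. 0"] by (simp add: J_def)

text \<open>Near-optimal weights for f and g are combined with the same coefficients, so that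
  subadditivity and homogeneity of \<open>\<Phi>\<close> apply pointwise.\<close>

lemma P_convex:
  assumes [measurable]: "f \<in> borel_measurable M" "g \<in> borel_measurable M"
    and P: "P f \<le> 1" "P g \<le> 1" and c: "0 < c" "c < 1"
  shows "P (\<lambda>x. c * f x + (1 - c) * g x) \<le> 1"
proof (rule ennreal_le_epsilon)
  fix e :: real assume e: "0 < e"
  have "1 < 1 + ennreal e" using e by (metis ennreal_1 ennreal_less_iff ennreal_plus less_add_same_cancel1 less_imp_le zero_le_one)
  then obtain u v where u: "u \<in> V" "J f u < 1 + ennreal e" and v: "v \<in> V" "J g v < 1 + ennreal e"
    using P_less[of f "1 + ennreal e"] P_less[of g "1 + ennreal e"] P le_less_trans by blast
  note [measurable] = J_measurable[OF _ u(1)] J_measurable[OF _ v(1)]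
  have "P (\<lambda>x. c * f x + (1 - c) * g x) \<le> J (\<lambda>x. c * f x + (1 - c) * g x) (\<lambda>x. c * u x + (1 - c) * v x)"
    by (intro P_le V_convex u v c)
  also have "\<dots> \<le> (\<integral>\<^sup>+x. ennreal c * \<Phi> (f x) (u x) + ennreal (1 - c) * \<Phi> (g x) (v x) \<partial>M)"
    unfolding J_def
  proof (rule nn_integral_mono)
    fix x assume x: "x \<in> space M"
    have "\<Phi> (c * f x + (1 - c) * g x) (c * u x + (1 - c) * v x)
        \<le> \<Phi> (c * f x) (c * u x) + \<Phi> ((1 - c) * g x) ((1 - c) * v x)"
      using c V_nonneg[OF u(1) x] V_nonneg[OF v(1) x] by (intro Phi_add) auto
    then show "\<Phi> (c * f x + (1 - c) * g x) (c * u x + (1 - c) * v x)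
        \<le> ennreal c * \<Phi> (f x) (u x) + ennreal (1 - c) * \<Phi> (g x) (v x)"
      using c V_nonneg[OF u(1) x] V_nonneg[OF v(1) x] by (simp add: Phi_scale)
  qed
  also have "\<dots> = ennreal c * J f u + ennreal (1 - c) * J g v"
    unfolding J_def by (simp add: nn_integral_add nn_integral_cmult)
  also have "\<dots> \<le> ennreal c * (1 + ennreal e) + ennreal (1 - c) * (1 + ennreal e)"
    using u v by (intro add_mono mult_left_mono) auto
  also have "\<dots> = 1 + ennreal e"
    using c by (simp add: distrib_right[symmetric] ennreal_plus[symmetric] del: ennreal_plus)
  finally show "P (\<lambda>x. c * f x + (1 - c) * g x) \<le> 1 + ennreal e" .
qed

text \<open>Where \<open>\<bar>f\<bar>\<close> exceeds s, either v exceeds \<mu>, which is rare by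
  tightness, or \<open>\<Phi> (f x) (v x)\<close> is at least \<open>\<Phi> s \<mu>\<close>, which
  Markov's inequality controls. The constant 2 leaves room above 1, since the infimum
  \<open>P f\<close> need not be attained.\<close>

lemma P_small_distribution:
  assumes d: "0 < d"
  shows "\<exists>\<mu>>0. \<forall>f\<in>borel_measurable M. \<forall>s>0. P f \<le> 1 \<longrightarrow>
    distribution_fun M f s \<le> ennreal d + ennreal (2 / (\<phi> (s / \<mu>) * \<mu>))"
proof -
  obtain \<mu> where mu: "0 < \<mu>" "\<And>v. v \<in> V \<Longrightarrow> emeasure M {x \<in> space M. \<mu> < v x} \<le> ennreal d"
    using V_tight[OF d] by blast
  have "distribution_fun M f s \<le> ennreal d + ennreal (2 / (\<phi> (s / \<mu>) * \<mu>))"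
    if f[measurable]: "f \<in> borel_measurable M" and s: "0 < s" and P: "P f \<le> 1" for f s
  proof -
    have "P f < 2" using P by (rule le_less_trans) simp
    then obtain v where v: "v \<in> V" "J f v < 2" using P_less[of f 2] by blast
    note [measurable] = V_measurable[OF v(1)] J_measurable[OF f v(1)]
    define b where "b = \<phi> (s / \<mu>) * \<mu>"
    have b: "0 < b" unfolding b_def using s mu phi_pos[of "s / \<mu>"] by simp
    define B where "B = {x \<in> space M. ennreal b \<le> \<Phi> (f x) (v x)}"
    have Bm[measurable]: "B \<in> sets M" unfolding B_def by measurable
    have "{x \<in> space M. s < \<bar>f x\<bar>} \<subseteq> {x \<in> space M. \<mu> < v x} \<union> B"
    proof
      fix x assume x: "x \<in> {x \<in> space M. s < \<bar>f x\<bar>}"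
      have "ennreal b \<le> \<Phi> (f x) (v x)" if "v x \<le> \<mu>"
      proof -
        have "ennreal b = \<Phi> s \<mu>" using s mu by (simp add: b_def Phi_pos)
        also have "\<dots> \<le> \<Phi> (f x) \<mu>" using x s mu by (intro Phi_mono) auto
        also have "\<dots> \<le> \<Phi> (f x) (v x)" using x that V_nonneg[OF v(1)] by (intro Phi_antimono) auto
        finally show ?thesis .
      qed
      then show "x \<in> {x \<in> space M. \<mu> < v x} \<union> B" using x unfolding B_def by force
    qed
    then have "distribution_fun M f s \<le> emeasure M ({x \<in> space M. \<mu> < v x} \<union> B)"
      unfolding distribution_fun_def by (intro emeasure_mono) auto
    also have "\<dots> \<le> emeasure M {x \<in> space M. \<mu> < v x} + emeasure M B"
      by (intro emeasure_subadditive) auto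
    also have "\<dots> \<le> ennreal d + ennreal (2 / b)"
    proof (intro add_mono mu v)
      have "ennreal b * emeasure M B = (\<integral>\<^sup>+x. ennreal b * indicator B x \<partial>M)"
        by (simp add: nn_integral_cmult_indicator)
      also have "\<dots> \<le> J f v" unfolding J_def
        by (intro nn_integral_mono) (auto simp: B_def indicator_def)
      also have "\<dots> \<le> 2" using v by simp
      finally have "ennreal (1 / b) * (ennreal b * emeasure M B) \<le> ennreal (1 / b) * 2"
        by (rule mult_left_mono) simp
      moreover have "ennreal (1 / b) * ennreal b = 1"
        using b by (simp add: ennreal_mult[symmetric])
      moreover have "ennreal (1 / b) * 2 = ennreal (2 / b)"
        using b ennreal_mult[of "1 / b" 2] by simp
      ultimately show "emeasure M B \<le> ennreal (2 / b)"
        by (simp add: mult.assoc[symmetric])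
    qed
    finally show ?thesis unfolding b_def .
  qed
  with mu(1) show ?thesis by blast
qed

lemma P_fatou:
  assumes Fm[measurable]: "\<And>n. F n \<in> borel_measurable M" and f[measurable]: "f \<in> borel_measurable M"
    and F0: "\<And>n. AE x in M. 0 \<le> F n x"
    and inc: "AE x in M. incseq (\<lambda>n. F n x) \<and> (\<lambda>n. F n x) \<longlonglongrightarrow> f x"
    and P: "\<And>n. P (F n) \<le> 1" and c: "0 < c" "c < 1"
  shows "P (\<lambda>x. c * f x) \<le> 1"
proof -
  \<comment> \<open>The tolerance makes these sets nonempty when the infimum is not attained; they
    shrink because both the tolerance decreases and \<open>F n\<close> increases.\<close>
  define C where "C n = {v \<in> V. J (F n) v \<le> 1 + ennreal (1 / Suc n)}" for n
  have F0': "AE x in M. \<forall>n. 0 \<le> F n x" using F0 by (simp add: AE_all_countable)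
  have C_mono: "C m \<subseteq> C n" if "n \<le> m" for m n
  proof
    fix v assume v: "v \<in> C m"
    have "AE x in M. \<bar>F n x\<bar> \<le> \<bar>F m x\<bar>" using inc F0'
      by eventually_elim (use that in \<open>auto simp: incseq_def\<close>)
    then have "J (F n) v \<le> J (F m) v" using v by (intro J_mono) (auto simp: C_def)
    also have "\<dots> \<le> 1 + ennreal (1 / Suc m)" using v by (simp add: C_def)
    also have "\<dots> \<le> 1 + ennreal (1 / Suc n)"
      using that by (intro add_left_mono ennreal_leI) (simp add: frac_le)
    finally show "v \<in> C n" using v by (simp add: C_def)
  qed
  have C_ne: "C n \<noteq> {}" for n
  proof -
    have "(1::ennreal) < 1 + ennreal (1 / Suc n)"
      by (metis ennreal_1 ennreal_less_iff ennreal_plus less_add_same_cancel1 less_imp_le zero_le_one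
          of_nat_0_less_iff zero_less_Suc zero_less_divide_1_iff)
    then obtain v where "v \<in> V" "J (F n) v < 1 + ennreal (1 / Suc n)"
      using P_less[of "F n" "1 + ennreal (1 / Suc n)"] P[of n] le_less_trans by blast
    then show ?thesis by (auto simp: C_def intro!: less_imp_le)
  qed
  have C_mid: "(\<lambda>x. (u x + v x) / 2) \<in> C n" if u: "u \<in> C n" and v: "v \<in> C n" for u v n
  proof -
    let ?K = "1 + ennreal (1 / Suc n)"
    have uV: "u \<in> V" "v \<in> V" using u v by (auto simp: C_def)
    note [measurable] = J_measurable[OF Fm uV(1)] J_measurable[OF Fm uV(2)]
    have eq: "(\<lambda>x. (u x + v x) / 2) = (\<lambda>x. (1/2) * u x + (1 - 1/2) * v x)" by (auto simp: field_simps)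
    have V: "(\<lambda>x. (u x + v x) / 2) \<in> V" unfolding eq using uV by (intro V_convex) auto
    have "J (F n) (\<lambda>x. (u x + v x) / 2) \<le> (\<integral>\<^sup>+x. ennreal (1/2) * \<Phi> (F n x) (u x) + ennreal (1/2) * \<Phi> (F n x) (v x) \<partial>M)"
      unfolding J_def
    proof (rule nn_integral_mono)
      fix x assume x: "x \<in> space M"
      have "\<Phi> ((1/2) * F n x + (1/2) * F n x) ((1/2) * u x + (1/2) * v x)
          \<le> \<Phi> ((1/2) * F n x) ((1/2) * u x) + \<Phi> ((1/2) * F n x) ((1/2) * v x)"
        using V_nonneg[OF uV(1) x] V_nonneg[OF uV(2) x] by (intro Phi_add) auto
      also have "\<dots> = ennreal (1/2) * \<Phi> (F n x) (u x) + ennreal (1/2) * \<Phi> (F n x) (v x)"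
        using V_nonneg[OF uV(1) x] V_nonneg[OF uV(2) x] by (simp only: Phi_scale)
      finally show "\<Phi> (F n x) ((u x + v x) / 2) \<le> ennreal (1/2) * \<Phi> (F n x) (u x) + ennreal (1/2) * \<Phi> (F n x) (v x)"
        by (simp add: add_divide_distrib)
    qed
    also have "\<dots> = ennreal (1/2) * J (F n) u + ennreal (1/2) * J (F n) v"
      unfolding J_def by (simp only: nn_integral_add nn_integral_cmult measurable_compose[OF J_measurable[OF Fm uV(1)]] borel_measurable_times_ennreal borel_measurable_const J_measurable[OF Fm uV(1)] J_measurable[OF Fm uV(2)])
    also have "\<dots> \<le> ennreal (1/2) * ?K + ennreal (1/2) * ?K"
      using u v by (intro add_mono mult_left_mono) (auto simp: C_def)
    also have "\<dots> = (ennreal (1/2) + ennreal (1/2)) * ?K" by (simp only: distrib_right)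
    also have "ennreal (1/2) + ennreal (1/2) = 1" by (subst ennreal_plus[symmetric]) auto
    finally show ?thesis using V by (simp add: C_def)
  qed
  obtain g h where g: "\<And>n. g n \<in> C n" and h[measurable]: "h \<in> borel_measurable M"
    and lim: "AE x in M. (\<lambda>n. exp (- g n x / 2)) \<longlonglongrightarrow> h x"
  proof (rule midpoint_closed_AE_limit[of C])
    show "decseq C" using C_mono by (auto simp: decseq_def)
  qed (use C_ne C_mid V_measurable V_nonneg in \<open>auto simp: C_def\<close>)
  have gV: "g n \<in> V" for n using g by (auto simp: C_def)
  have gm[measurable]: "g n \<in> borel_measurable M" for n by (rule V_measurable[OF gV])
  \<comment> \<open>Where h vanishes, \<open>g n x\<close> tends to \<infinity>, so x belongs to
    \<open>?A n\<close> eventually. Fatou's lemma bounds the measure of such points by the tightness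
    bound d.\<close>
  have "emeasure M {x \<in> space M. h x = 0} \<le> ennreal d" if d: "0 < d" for d
  proof -
    obtain \<mu> where mu: "0 < \<mu>" "\<And>v. v \<in> V \<Longrightarrow> emeasure M {x \<in> space M. \<mu> < v x} \<le> ennreal d"
      using V_tight[OF d] by blast
    let ?A = "\<lambda>n. {x \<in> space M. \<mu> < g n x}"
    have "emeasure M {x \<in> space M. h x = 0} = (\<integral>\<^sup>+x. indicator {x \<in> space M. h x = 0} x \<partial>M)" by simp
    also have "\<dots> \<le> (\<integral>\<^sup>+x. liminf (\<lambda>n. indicator (?A n) x) \<partial>M)"
    proof (rule nn_integral_mono_AE)
      show "AE x in M. indicator {x \<in> space M. h x = 0} x \<le> (liminf (\<lambda>n. indicator (?A n) x) :: ennreal)"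
        using lim AE_space
      proof eventually_elim
        case (elim x)
        show ?case
        proof (cases "h x = 0")
          case True
          have "\<forall>\<^sub>F n in sequentially. exp (- g n x / 2) < exp (- \<mu> / 2)"
            using order_tendstoD(2)[OF elim(1), of "exp (- \<mu> / 2)"] True by simp
          then have "\<forall>\<^sub>F n in sequentially. 1 \<le> (indicator (?A n) x :: ennreal)"
            by eventually_elim (use elim in \<open>auto simp: indicator_def\<close>)
          then have "1 \<le> liminf (\<lambda>n. indicator (?A n) x :: ennreal)" by (rule Liminf_bounded)
          then show ?thesis using elim True by simp
        qed simp
      qed
    qed
    also have "\<dots> \<le> liminf (\<lambda>n. \<integral>\<^sup>+x. indicator (?A n) x \<partial>M)"
      by (rule nn_integral_liminf) measurable
    also have "\<dots> \<le> limsup (\<lambda>n. \<integral>\<^sup>+x. indicator (?A n) x \<partial>M)"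
      by (intro Liminf_le_Limsup) simp
    also have "\<dots> \<le> ennreal d"
      using mu(2)[OF gV] by (intro Limsup_bounded) auto
    finally show ?thesis .
  qed
  then have "emeasure M {x \<in> space M. h x = 0} \<le> 0"
    by - (rule ennreal_le_epsilon, auto)
  then have h0: "AE x in M. h x \<noteq> 0"
    by (subst AE_iff_measurable[OF _ refl]) (auto intro: antisym)
  \<comment> \<open>Inverts \<open>h = exp (- v / 2)\<close>. The maximum and the default 0 matter
    on a null set only; they make v nonnegative everywhere.\<close>
  define v where "v x = (if 0 < h x then max 0 (- 2 * ln (h x)) else 0)" for x
  have vm: "v \<in> borel_measurable M" unfolding v_def by measurable
  have gv: "AE x in M. (\<lambda>n. g n x) \<longlonglongrightarrow> v x"
    using lim h0 AE_space
  proof eventually_elim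
    case (elim x)
    have "0 \<le> h x" by (rule LIMSEQ_le_const[OF elim(1)]) auto
    then have hx: "0 < h x" using elim by simp
    have "(\<lambda>n. - 2 * ln (exp (- g n x / 2))) \<longlonglongrightarrow> - 2 * ln (h x)"
      by (intro tendsto_intros elim)
    then have l: "(\<lambda>n. g n x) \<longlonglongrightarrow> - 2 * ln (h x)" by simp
    have "0 \<le> - 2 * ln (h x)" by (rule LIMSEQ_le_const[OF l]) (use V_nonneg[OF gV] elim in auto)
    then show ?case using l hx by (simp add: v_def)
  qed
  have vV: "v \<in> V" by (rule V_closed[OF gV vm _ gv]) (simp add: v_def)
  \<comment> \<open>Positivity of \<open>v'\<close> is what makes \<open>tendsto_Phi\<close>
    applicable at every point of convergence.\<close>
  define v' where "v' x = c * v x + (1 - c) * w x" for x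
  have v'V: "v' \<in> V" unfolding v'_def by (intro V_convex vV w_mem c)
  define u where "u n x = c * g n x + (1 - c) * w x" for n x
  have uV: "u n \<in> V" for n unfolding u_def by (intro V_convex gV w_mem c)
  have "P (\<lambda>x. c * f x) \<le> J (\<lambda>x. c * f x) v'" by (rule P_le[OF v'V])
  also have "\<dots> \<le> (\<integral>\<^sup>+x. liminf (\<lambda>n. \<Phi> (c * F n x) (u n x)) \<partial>M)"
    unfolding J_def
  proof (rule nn_integral_mono_AE)
    show "AE x in M. \<Phi> (c * f x) (v' x) \<le> liminf (\<lambda>n. \<Phi> (c * F n x) (u n x))"
      using gv inc AE_space
    proof eventually_elim
      case (elim x)
      have "(\<lambda>n. \<Phi> (c * F n x) (u n x)) \<longlonglongrightarrow> \<Phi> (c * f x) (v' x)"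
        unfolding u_def v'_def using elim c V_nonneg[OF vV, of x] w_pos[of x]
        by (intro tendsto_Phi tendsto_intros add_nonneg_pos) auto
      then have "liminf (\<lambda>n. \<Phi> (c * F n x) (u n x)) = \<Phi> (c * f x) (v' x)"
        by (intro lim_imp_Liminf) auto
      then show ?case by simp
    qed
  qed
  also have "\<dots> \<le> liminf (\<lambda>n. \<integral>\<^sup>+x. \<Phi> (c * F n x) (u n x) \<partial>M)"
    by (rule nn_integral_liminf) (intro J_measurable uV borel_measurable_times borel_measurable_const Fm)
  also have "\<dots> \<le> liminf (\<lambda>n. 1 + ennreal (1 / Suc n))"
  proof (intro Liminf_mono always_eventually allI)
    fix n
    have "(\<integral>\<^sup>+x. \<Phi> (c * F n x) (u n x) \<partial>M) \<le> (\<integral>\<^sup>+x. \<Phi> (F n x) (g n x) \<partial>M)"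
    proof (rule nn_integral_mono)
      fix x assume x: "x \<in> space M"
      \<comment> \<open>The mixed weight is at least \<open>c * g n x\<close>, so by homogeneity the
        mixing costs nothing once F n is scaled by c.\<close>
      have "\<Phi> (c * F n x) (u n x) \<le> \<Phi> (c * F n x) (c * g n x)"
        unfolding u_def using c V_nonneg[OF gV x] w_pos[OF x] by (intro Phi_antimono) auto
      also have "\<dots> = ennreal c * \<Phi> (F n x) (g n x)" using c V_nonneg[OF gV x] by (intro Phi_scale)
      also have "\<dots> \<le> 1 * \<Phi> (F n x) (g n x)" using c by (intro mult_right_mono) auto
      finally show "\<Phi> (c * F n x) (u n x) \<le> \<Phi> (F n x) (g n x)" by simp
    qed
    also have "\<dots> \<le> 1 + ennreal (1 / Suc n)" using g[of n] by (simp add: C_def J_def)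
    finally show "(\<integral>\<^sup>+x. \<Phi> (c * F n x) (u n x) \<partial>M) \<le> 1 + ennreal (1 / Suc n)" .
  qed
  also have "\<dots> = 1"
  proof (rule lim_imp_Liminf)
    have "(\<lambda>n. 1 + ennreal (1 / Suc n)) \<longlonglongrightarrow> 1 + ennreal 0"
      by (intro tendsto_intros LIMSEQ_Suc[OF lim_1_over_n])
    then show "(\<lambda>n. 1 + ennreal (1 / Suc n)) \<longlonglongrightarrow> 1" by simp
  qed simp
  finally show ?thesis .
qed

section \<open>The Luxemburg functional of the modular\<close>

lemma luxemburg_le: "0 < k \<Longrightarrow> P (\<lambda>x. f x / k) \<le> 1 \<Longrightarrow> \<rho> f \<le> ennreal k"
  unfolding luxemburg_def by (intro Inf_lower) auto

lemma luxemburg_lessD: "\<rho> f < a \<Longrightarrow> \<exists>k>0. P (\<lambda>x. f x / k) \<le> 1 \<and> ennreal k < a"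
  unfolding luxemburg_def Inf_less_iff by auto

lemma P_le_1:
  assumes "\<rho> f < ennreal k"
  shows "P (\<lambda>x. f x / k) \<le> 1"
proof -
  obtain e where e: "0 < e" "P (\<lambda>x. f x / e) \<le> 1" "ennreal e < ennreal k"
    using luxemburg_lessD[OF assms] by blast
  have ek: "e < k" using e by (simp add: ennreal_less_iff)
  have "P (\<lambda>x. f x / k) \<le> P (\<lambda>x. f x / e)"
    using e(1) ek by (intro P_mono AE_I2) (auto intro!: divide_left_mono)
  then show ?thesis using e by simp
qed

lemma luxemburg_zero: "\<rho> (\<lambda>_. 0) = 0"
proof -
  have "\<rho> (\<lambda>_. 0) \<le> 0 + ennreal e" if "0 < e" for e
    using luxemburg_le[of e "\<lambda>_. 0"] that P_0 by simp
  then have "\<rho> (\<lambda>_. 0) \<le> 0" by (rule ennreal_le_epsilon)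
  then show ?thesis by simp
qed

lemma luxemburg_scale_le: "0 < c \<Longrightarrow> \<rho> (\<lambda>x. c * f x) \<le> ennreal c * \<rho> f"
proof -
  assume c: "0 < c"
  have "ennreal (1 / c) * \<rho> (\<lambda>x. c * f x) \<le> \<rho> f"
    unfolding luxemburg_def[of P f]
  proof (rule Inf_greatest, clarify)
    fix e :: real assume e: "0 < e" "P (\<lambda>x. f x / e) \<le> 1"
    have "\<rho> (\<lambda>x. c * f x) \<le> ennreal (c * e)"
      using c e by (intro luxemburg_le) auto
    then have "ennreal (1 / c) * \<rho> (\<lambda>x. c * f x) \<le> ennreal (1 / c) * ennreal (c * e)"
      by (rule mult_left_mono) simp
    also have "\<dots> = ennreal e" using c e by (simp add: ennreal_mult[symmetric])
    finally show "ennreal (1 / c) * \<rho> (\<lambda>x. c * f x) \<le> ennreal e" .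
  qed
  then have "ennreal c * (ennreal (1 / c) * \<rho> (\<lambda>x. c * f x)) \<le> ennreal c * \<rho> f"
    by (rule mult_left_mono) simp
  then show ?thesis
    using c by (simp add: mult.assoc[symmetric] ennreal_mult[symmetric])
qed

lemma luxemburg_mono: "AE x in M. \<bar>g x\<bar> \<le> \<bar>f x\<bar> \<Longrightarrow> \<rho> g \<le> \<rho> f"
  unfolding luxemburg_def[of P f]
proof (rule Inf_greatest, clarify)
  fix e :: real assume le: "AE x in M. \<bar>g x\<bar> \<le> \<bar>f x\<bar>" and e: "0 < e" "P (\<lambda>x. f x / e) \<le> 1"
  have "AE x in M. \<bar>g x / e\<bar> \<le> \<bar>f x / e\<bar>"
    using le by eventually_elim (use e in \<open>simp add: divide_right_mono\<close>)
  from P_mono[OF this] show "\<rho> g \<le> ennreal e" using e by (intro luxemburg_le) auto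
qed

lemma luxemburg_scale: "c \<noteq> 0 \<Longrightarrow> \<rho> (\<lambda>x. c * f x) = ennreal \<bar>c\<bar> * \<rho> f"
proof -
  assume c: "c \<noteq> 0"
  have eq: "\<rho> (\<lambda>x. c * f x) = \<rho> (\<lambda>x. \<bar>c\<bar> * f x)"
    by (intro antisym luxemburg_mono AE_I2) (auto simp: abs_mult)
  \<comment> \<open>The reverse inequality is the one-sided scaling bound applied with the factor
    \<open>1 / \<bar>c\<bar>\<close>.\<close>
  have "ennreal \<bar>c\<bar> * \<rho> f = ennreal \<bar>c\<bar> * \<rho> (\<lambda>x. (1 / \<bar>c\<bar>) * (\<bar>c\<bar> * f x))" using c by simp
  also have "\<dots> \<le> ennreal \<bar>c\<bar> * (ennreal (1 / \<bar>c\<bar>) * \<rho> (\<lambda>x. \<bar>c\<bar> * f x))"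
    using c by (intro mult_left_mono luxemburg_scale_le) auto
  also have "\<dots> = \<rho> (\<lambda>x. \<bar>c\<bar> * f x)"
    using c by (simp add: mult.assoc[symmetric] ennreal_mult[symmetric])
  finally show ?thesis using luxemburg_scale_le[of "\<bar>c\<bar>" f] c eq by (intro antisym) auto
qed

lemma luxemburg_add:
  assumes [measurable]: "f \<in> borel_measurable M" "g \<in> borel_measurable M"
  shows "\<rho> (\<lambda>x. f x + g x) \<le> \<rho> f + \<rho> g"
proof -
  have step: "\<rho> (\<lambda>x. f x + g x) \<le> ennreal a + ennreal b"
    if a: "0 < a" "P (\<lambda>x. f x / a) \<le> 1" and b: "0 < b" "P (\<lambda>x. g x / b) \<le> 1" for a b
  proof -
    \<comment> \<open>With this c the quotient \<open>(f + g) / (a + b)\<close> is a convex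
      combination of \<open>f / a\<close> and \<open>g / b\<close>.\<close>
    define c where "c = a / (a + b)"
    have "P (\<lambda>x. c * (f x / a) + (1 - c) * (g x / b)) \<le> 1"
      using a b by (intro P_convex) (auto simp: c_def)
    moreover have "c * (f x / a) + (1 - c) * (g x / b) = (f x + g x) / (a + b)" for x
    proof -
      have "1 - c = b / (a + b)" using a b by (simp add: c_def field_simps)
      then show ?thesis using a b by (simp add: c_def add_divide_distrib)
    qed
    ultimately have "\<rho> (\<lambda>x. f x + g x) \<le> ennreal (a + b)" using a b by (intro luxemburg_le) auto
    then show ?thesis using a b by simp
  qed
  show ?thesis
  proof (rule ennreal_le_epsilon)
    fix e :: real assume e: "0 < e" and fin: "\<rho> f + \<rho> g < top"
    have "\<rho> f < \<rho> f + ennreal (e/2)" "\<rho> g < \<rho> g + ennreal (e/2)"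
      using e fin by (auto simp: ennreal_add_less_top)
    from luxemburg_lessD[OF this(1)] luxemburg_lessD[OF this(2)]
    obtain a b where "0 < a" "P (\<lambda>x. f x / a) \<le> 1" "ennreal a < \<rho> f + ennreal (e/2)"
        "0 < b" "P (\<lambda>x. g x / b) \<le> 1" "ennreal b < \<rho> g + ennreal (e/2)"
      by blast
    then have "\<rho> (\<lambda>x. f x + g x) \<le> (\<rho> f + ennreal (e/2)) + (\<rho> g + ennreal (e/2))"
      using step[of a b] by (meson add_mono less_imp_le order_trans)
    also have "\<dots> = \<rho> f + \<rho> g + (ennreal (e/2) + ennreal (e/2))" by (simp add: ac_simps)
    also have "ennreal (e/2) + ennreal (e/2) = ennreal e" using e by (subst ennreal_plus[symmetric]) auto
    finally show "\<rho> (\<lambda>x. f x + g x) \<le> \<rho> f + \<rho> g + ennreal e" .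
  qed
qed

lemma luxemburg_fatou:
  assumes [measurable]: "\<And>n. F n \<in> borel_measurable M" "f \<in> borel_measurable M"
    and F0: "\<And>n. AE x in M. 0 \<le> F n x"
    and inc: "AE x in M. incseq (\<lambda>n. F n x) \<and> (\<lambda>n. F n x) \<longlonglongrightarrow> f x"
    and K: "0 \<le> K" "\<And>n. \<rho> (F n) \<le> ennreal K"
  shows "\<rho> f \<le> ennreal K"
proof (rule ennreal_le_epsilon)
  fix e :: real assume e: "0 < e"
  \<comment> \<open>Half of e makes k exceed K, so the modular of \<open>F n / k\<close> is at most
    1. The other half pays for the factor c below, for which
    \<open>c / k = 1 / (K + e)\<close>.\<close>
  define k where "k = K + e / 2"
  have k: "0 < k" "K < k" using K e by (auto simp: k_def)
  have P: "P (\<lambda>x. F n x / k) \<le> 1" for n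
    using K(2)[of n] k K(1) by (intro P_le_1) (meson ennreal_lessI le_less_trans)
  define c where "c = k / (K + e)"
  have c: "0 < c" "c < 1" using K e k by (auto simp: c_def k_def)
  have "P (\<lambda>x. c * (f x / k)) \<le> 1"
  proof (rule P_fatou[OF _ _ _ _ P c])
    show "AE x in M. 0 \<le> F n x / k" for n using F0[of n] by eventually_elim (use k in auto)
    show "AE x in M. incseq (\<lambda>n. F n x / k) \<and> (\<lambda>n. F n x / k) \<longlonglongrightarrow> f x / k"
      using inc by eventually_elim
        (use k in \<open>auto simp: incseq_def divide_right_mono intro!: tendsto_intros\<close>)
  qed auto
  moreover have "c * (y / k) = y / (K + e)" for y using k by (simp add: c_def)
  ultimately have "\<rho> f \<le> ennreal (K + e)" using K e by (intro luxemburg_le) auto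
  then show "\<rho> f \<le> ennreal K + ennreal e" using K e by simp
qed

lemma luxemburg_small_distribution:
  assumes "0 < s" "0 < d"
  shows "\<exists>e>0. \<forall>f\<in>borel_measurable M. \<rho> f < ennreal e \<longrightarrow> distribution_fun M f s \<le> ennreal d"
proof -
  obtain \<mu> where mu: "0 < \<mu>" "\<And>f s. f \<in> borel_measurable M \<Longrightarrow> 0 < s \<Longrightarrow> P f \<le> 1 \<Longrightarrow>
      distribution_fun M f s \<le> ennreal (d / 2) + ennreal (2 / (\<phi> (s / \<mu>) * \<mu>))"
    using P_small_distribution[of "d/2"] \<open>0 < d\<close> by (meson half_gt_zero)
  \<comment> \<open>With \<open>e = s / K\<close> the rescaled level is K. The bound
    \<open>\<mu> \<le> K\<close> brings in the linear growth of \<phi>, and the other bound then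
    makes the Markov term at most \<open>d / 2\<close>.\<close>
  define K where "K = max \<mu> (4 / (d * \<phi> 1))"
  have phi1: "0 < \<phi> 1" by (rule phi_pos) simp
  have K: "0 < K" "\<mu> \<le> K" "4 / (d * \<phi> 1) \<le> K" using mu by (auto simp: K_def)
  define e where "e = s / K"
  have e: "0 < e" using assms K by (simp add: e_def)
  have "distribution_fun M f s \<le> ennreal d"
    if f: "f \<in> borel_measurable M" and r: "\<rho> f < ennreal e" for f
  proof -
    have "distribution_fun M f s = distribution_fun M (\<lambda>x. f x / e) (s / e)"
      unfolding distribution_fun_def using e by (simp add: divide_less_cancel)
    also have "\<dots> \<le> ennreal (d / 2) + ennreal (2 / (\<phi> (s / e / \<mu>) * \<mu>))"
      using f P_le_1[OF r] assms e by (intro mu(2)) auto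
    also have "\<dots> \<le> ennreal (d / 2) + ennreal (d / 2)"
    proof (intro add_left_mono ennreal_leI)
      have se: "s / e = K" using assms by (simp add: e_def)
      have "K / \<mu> * \<phi> 1 \<le> \<phi> (K / \<mu>)" using K mu by (intro phi_ge_linear) simp
      then have "K * \<phi> 1 \<le> \<phi> (K / \<mu>) * \<mu>" using mu by (simp add: field_simps)
      moreover have "4 / d \<le> K * \<phi> 1" using K(3) phi1 assms by (simp add: field_simps)
      ultimately have le: "4 / d \<le> \<phi> (s / e / \<mu>) * \<mu>" by (simp add: se)
      have "2 / (\<phi> (s / e / \<mu>) * \<mu>) \<le> 2 / (4 / d)"
        using le assms mult_pos_pos[OF less_le_trans[OF _ le], of "4 / d"]
        by (intro divide_left_mono) auto
      then show "2 / (\<phi> (s / e / \<mu>) * \<mu>) \<le> d / 2" by simp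
    qed
    also have "\<dots> = ennreal d" using assms by (subst ennreal_plus[symmetric]) auto
    finally show ?thesis .
  qed
  with e show ?thesis by blast
qed

sublocale fatou_norm M "luxemburg P"
proof (standard, goal_cases)
  case 1
  show ?case by (rule luxemburg_zero)
next
  case 2
  then show ?case by (rule luxemburg_add)
next
  case 3
  then show ?case by (intro luxemburg_scale)
next
  case 4
  then show ?case by (intro luxemburg_mono)
next
  case 5
  then show ?case by (rule luxemburg_fatou)
next
  case 6
  then show ?case by (rule luxemburg_small_distribution)
qed

text \<open>Finite level sets allow the measures of bands to be computed by subtraction in
  \<open>P_le_P_R\<close>.\<close>

lemma distribution_finite:
  assumes f: "f \<in> E" and s: "0 < s"
  shows "distribution_fun M f s < \<infinity>"
proof -
  obtain k where k: "0 < k" "P (\<lambda>x. f x / k) \<le> 1"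
    using f luxemburg_lessD[of f \<infinity>] by blast
  obtain \<mu> where mu: "0 < \<mu>" "\<And>f s. f \<in> borel_measurable M \<Longrightarrow> 0 < s \<Longrightarrow> P f \<le> 1 \<Longrightarrow>
      distribution_fun M f s \<le> ennreal 1 + ennreal (2 / (\<phi> (s / \<mu>) * \<mu>))"
    using P_small_distribution[of 1] by (meson zero_less_one)
  have "distribution_fun M f s = distribution_fun M (\<lambda>x. f x / k) (s / k)"
    unfolding distribution_fun_def using k by (simp add: divide_less_cancel)
  also have "\<dots> \<le> ennreal 1 + ennreal (2 / (\<phi> (s / k / \<mu>) * \<mu>))"
    using f k s by (intro mu(2)) auto
  also have "\<dots> < \<infinity>" by simp
  finally show ?thesis .
qed

end

section \<open>Decreasing rearrangements\<close>

lemma ennreal_eqI_less: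
  fixes a b :: ennreal
  assumes "\<And>s. 0 \<le> s \<Longrightarrow> ennreal s < a \<longleftrightarrow> ennreal s < b"
  shows "a = b"
proof -
  have le: "a \<le> b" if *: "\<And>s. 0 \<le> s \<Longrightarrow> ennreal s < a \<Longrightarrow> ennreal s < b" for a b :: ennreal
  proof (rule ccontr)
    assume "\<not> a \<le> b"
    then have ba: "b < a" by simp
    then obtain s where "0 \<le> s" "b = ennreal s" by (cases b) auto
    then show False using *[of s] ba by simp
  qed
  show ?thesis using assms by (intro antisym le) auto
qed

lemma (in sigma_finite_measure) nn_integral_diff_layers:
  fixes F :: "'a \<Rightarrow> ennreal" and g :: "'a \<Rightarrow> real"
  assumes [measurable]: "F \<in> borel_measurable M" "g \<in> borel_measurable M"
    and g: "\<And>x. x \<in> space M \<Longrightarrow> 0 \<le> g x"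
  shows "(\<integral>\<^sup>+x. F x - ennreal (g x) \<partial>M)
    = (\<integral>\<^sup>+\<sigma>. emeasure M {x \<in> space M. g x \<le> \<sigma> \<and> ennreal \<sigma> < F x} \<partial>lborel)"
proof -
  interpret pair_sigma_finite M lborel ..
  let ?k = "\<lambda>x \<sigma>. if g x \<le> \<sigma> \<and> ennreal \<sigma> < F x then 1 else (0::ennreal)"
  have "(\<integral>\<^sup>+x. F x - ennreal (g x) \<partial>M) = (\<integral>\<^sup>+x. (\<integral>\<^sup>+\<sigma>. ?k x \<sigma> \<partial>lborel) \<partial>M)"
  proof (rule nn_integral_cong)
    fix x assume x: "x \<in> space M"
    define S where "S = {\<sigma>. g x \<le> \<sigma> \<and> ennreal \<sigma> < F x}"
    have "emeasure lborel S = F x - ennreal (g x)"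
    proof (cases "F x")
      case (real b)
      then have S: "S = {g x ..< b}" using g[OF x] by (auto simp: S_def ennreal_less_iff)
      show ?thesis
      proof (cases "g x \<le> b")
        case True
        then show ?thesis unfolding S using real g[OF x] by (simp add: ennreal_minus)
      next
        case False
        then show ?thesis unfolding S using real g[OF x] by (simp add: ennreal_minus ennreal_neg)
      qed
    next
      case top
      then have S: "S = {g x ..}" by (auto simp: S_def)
      have "ennreal (real n) \<le> emeasure lborel S" for n :: nat
      proof -
        have "emeasure lborel {g x .. g x + real n} \<le> emeasure lborel S"
          unfolding S by (intro emeasure_mono) auto
        then show ?thesis by simp
      qed
      then have "emeasure lborel S = top"
        by (metis ennreal_Ex_less_of_nat ennreal_of_nat_eq_real_of_nat leD less_top)
      then show ?thesis using top by simp
    qed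
    moreover have "S \<in> sets lborel" unfolding S_def by measurable
    moreover have "(\<lambda>\<sigma>. ?k x \<sigma>) = indicator S" by (auto simp: S_def indicator_def)
    ultimately show "F x - ennreal (g x) = (\<integral>\<^sup>+\<sigma>. ?k x \<sigma> \<partial>lborel)" by simp
  qed
  also have "\<dots> = (\<integral>\<^sup>+\<sigma>. (\<integral>\<^sup>+x. ?k x \<sigma> \<partial>M) \<partial>lborel)"
    using Fubini[of "\<lambda>(x, \<sigma>). ?k x \<sigma>"] by simp
  also have "\<dots> = (\<integral>\<^sup>+\<sigma>. emeasure M {x \<in> space M. g x \<le> \<sigma> \<and> ennreal \<sigma> < F x} \<partial>lborel)"
  proof (rule nn_integral_cong)
    fix \<sigma> :: real
    have "(\<integral>\<^sup>+x. ?k x \<sigma> \<partial>M) = (\<integral>\<^sup>+x. indicator {x \<in> space M. g x \<le> \<sigma> \<and> ennreal \<sigma> < F x} x \<partial>M)"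
      by (intro nn_integral_cong) (auto simp: indicator_def)
    then show "(\<integral>\<^sup>+x. ?k x \<sigma> \<partial>M) = emeasure M {x \<in> space M. g x \<le> \<sigma> \<and> ennreal \<sigma> < F x}"
      by simp
  qed
  finally show ?thesis .
qed

text \<open>Taking the position as an \<open>ennreal\<close> parameter lets \<open>rearr\<close> and
  \<open>seq_rearr\<close> be instances, the latter up to the admission of s = 0.\<close>

definition decreasing_inverse :: "'a measure \<Rightarrow> ('a \<Rightarrow> real) \<Rightarrow> ennreal \<Rightarrow> ennreal" where
  "decreasing_inverse M f u = Inf (ennreal ` {s. 0 \<le> s \<and> distribution_fun M f s \<le> u})"

lemma distribution_fun_antimono:
  assumes "f \<in> borel_measurable M" "s \<le> s'"
  shows "distribution_fun M f s' \<le> distribution_fun M f s"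
  unfolding distribution_fun_def using assms by (intro emeasure_mono) auto

text \<open>Right continuity of the distribution function: the sets where
  \<open>\<bar>f\<bar>\<close> exceeds \<open>s + 1 / Suc n\<close> increase to the set where it
  exceeds s. Statements about rearrangements thereby become statements about level sets.\<close>

lemma less_decreasing_inverse_iff:
  assumes f[measurable]: "f \<in> borel_measurable M" and s: "0 \<le> s"
  shows "ennreal s < decreasing_inverse M f u \<longleftrightarrow> u < distribution_fun M f s"
proof
  assume "ennreal s < decreasing_inverse M f u"
  moreover have "decreasing_inverse M f u \<le> ennreal s" if "distribution_fun M f s \<le> u"
    unfolding decreasing_inverse_def using s that by (intro Inf_lower) auto
  ultimately show "u < distribution_fun M f s" by (meson leD leI)
next
  assume u: "u < distribution_fun M f s"
  have "(\<Union>n. {x \<in> space M. s + 1 / Suc n < \<bar>f x\<bar>}) = {x \<in> space M. s < \<bar>f x\<bar>}"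
  proof (intro equalityI subsetI)
    fix x assume x: "x \<in> {x \<in> space M. s < \<bar>f x\<bar>}"
    then obtain n where "inverse (real (Suc n)) < \<bar>f x\<bar> - s"
      using reals_Archimedean[of "\<bar>f x\<bar> - s"] by auto
    then show "x \<in> (\<Union>n. {x \<in> space M. s + 1 / Suc n < \<bar>f x\<bar>})"
      using x by (auto simp: inverse_eq_divide intro!: exI[of _ n])
  next
    fix x assume "x \<in> (\<Union>n. {x \<in> space M. s + 1 / Suc n < \<bar>f x\<bar>})"
    then obtain n where x: "x \<in> space M" "s + 1 / Suc n < \<bar>f x\<bar>" by blast
    have "0 < 1 / real (Suc n)" by simp
    then have "s < \<bar>f x\<bar>" using x(2) by linarith
    then show "x \<in> {x \<in> space M. s < \<bar>f x\<bar>}" using x(1) by simp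
  qed
  moreover have "(SUP n. emeasure M {x \<in> space M. s + 1 / Suc n < \<bar>f x\<bar>})
      = emeasure M (\<Union>n. {x \<in> space M. s + 1 / Suc n < \<bar>f x\<bar>})"
  proof (rule SUP_emeasure_incseq)
    show "incseq (\<lambda>n. {x \<in> space M. s + 1 / Suc n < \<bar>f x\<bar>})"
    proof (intro monoI subsetI)
      fix m n :: nat and x assume mn: "m \<le> n" and x: "x \<in> {x \<in> space M. s + 1 / Suc m < \<bar>f x\<bar>}"
      have "1 / real (Suc n) \<le> 1 / real (Suc m)" using mn by (simp add: frac_le)
      then show "x \<in> {x \<in> space M. s + 1 / Suc n < \<bar>f x\<bar>}" using x by auto
    qed
  qed auto
  ultimately have "u < (SUP n. distribution_fun M f (s + 1 / Suc n))"
    using u by (simp add: distribution_fun_def)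
  then obtain n where n: "u < distribution_fun M f (s + 1 / Suc n)" by (auto simp: less_SUP_iff)
  have "ennreal s < ennreal (s + 1 / Suc n)" using s by (intro ennreal_lessI) (auto intro: add_nonneg_pos)
  also have "\<dots> \<le> decreasing_inverse M f u"
    unfolding decreasing_inverse_def
  proof (rule Inf_greatest, clarify)
    fix s' :: real assume s': "0 \<le> s'" "distribution_fun M f s' \<le> u"
    have "\<not> s' \<le> s + 1 / Suc n"
      using distribution_fun_antimono[OF f, of s' "s + 1 / Suc n"] s' n by (meson leD order_trans)
    then show "ennreal (s + 1 / Suc n) \<le> ennreal s'" by (intro ennreal_leI) simp
  qed
  finally show "ennreal s < decreasing_inverse M f u" .
qed

text \<open>The position of a point: the rearrangement at \<open>x\<close> is the decreasing inverse of the distribution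
  function at \<open>\<tau> x\<close>. On \<open>(0,a)\<close> this is \<open>\<tau> t = t\<close>, and \<open>\<tau> i = i\<close> for sequences indexed from 0. The
  set \<open>T\<close> collects the upper limits of integration in the definition of submajorization.\<close>

locale rearrangement_space = sigma_finite_measure M
  for M :: "'a measure" +
  fixes \<tau> :: "'a \<Rightarrow> ennreal" and T :: "ennreal set"
  assumes tau_measurable [measurable]: "\<tau> \<in> borel_measurable M"
    and initial_segment: "A \<in> sets M \<Longrightarrow> emeasure M {x \<in> space M. \<tau> x < emeasure M A} = emeasure M A"
    and T_segment: "t \<in> T \<Longrightarrow> 0 < t \<and> t < \<infinity> \<and> emeasure M {x \<in> space M. \<tau> x < t} = t"
    and small_sets: "x \<in> space M \<Longrightarrow> \<exists>d>0. \<forall>A\<in>sets M. emeasure M A \<le> ennreal d \<longrightarrow> emeasure M A \<le> \<tau> x"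
begin

definition R :: "('a \<Rightarrow> real) \<Rightarrow> 'a \<Rightarrow> ennreal" where
  "R f x = decreasing_inverse M f (\<tau> x)"

lemma less_R_iff:
  "f \<in> borel_measurable M \<Longrightarrow> 0 \<le> s \<Longrightarrow> ennreal s < R f x \<longleftrightarrow> \<tau> x < distribution_fun M f s"
  unfolding R_def by (rule less_decreasing_inverse_iff)

lemma R_measurable [measurable (raw)]:
  assumes f: "f \<in> borel_measurable M"
  shows "R f \<in> borel_measurable M"
proof (rule borel_measurableI_greater)
  fix y :: ennreal
  show "{x \<in> space M. y < R f x} \<in> sets M"
  proof (cases y)
    case (real s)
    then show ?thesis using less_R_iff[OF f, of s] by simp
  qed simp
qed

text \<open>Equimeasurability: each level set of the rearrangement is the initial segment whose
  length is the measure of the level set of \<open>\<bar>f\<bar>\<close>.\<close>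

lemma emeasure_R_greater:
  assumes f[measurable]: "f \<in> borel_measurable M" and s: "0 \<le> s"
  shows "emeasure M {x \<in> space M. ennreal s < R f x} = distribution_fun M f s"
  using initial_segment[of "{x \<in> space M. s < \<bar>f x\<bar>}"] less_R_iff[OF f s]
  by (simp add: distribution_fun_def)

lemma nn_integral_R_minus:
  assumes f[measurable]: "f \<in> borel_measurable M" and l: "0 \<le> l"
  shows "(\<integral>\<^sup>+x. R f x - ennreal l \<partial>M) = (\<integral>\<^sup>+x. ennreal (\<bar>f x\<bar> - l) \<partial>M)"
proof -
  have eq: "emeasure M {x \<in> space M. l \<le> \<sigma> \<and> ennreal \<sigma> < R f x}
      = emeasure M {x \<in> space M. l \<le> \<sigma> \<and> ennreal \<sigma> < ennreal \<bar>f x\<bar>}" for \<sigma>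
    using emeasure_R_greater[OF f, of \<sigma>] l
    by (cases "l \<le> \<sigma>") (auto simp: distribution_fun_def ennreal_less_iff)
  have "(\<integral>\<^sup>+x. R f x - ennreal l \<partial>M) = (\<integral>\<^sup>+x. ennreal \<bar>f x\<bar> - ennreal l \<partial>M)"
    using nn_integral_diff_layers[of "R f" "\<lambda>_. l"] nn_integral_diff_layers[of "\<lambda>x. ennreal \<bar>f x\<bar>" "\<lambda>_. l"] eq l
    by simp
  then show ?thesis using l by (simp add: ennreal_minus)
qed

lemma nn_integral_R: "f \<in> borel_measurable M \<Longrightarrow> (\<integral>\<^sup>+x. R f x \<partial>M) = (\<integral>\<^sup>+x. ennreal \<bar>f x\<bar> \<partial>M)"
  using nn_integral_R_minus[of f 0] by simp

text \<open>On each level \<sigma> the rearranged set is a difference of two nested initial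
  segments. Its measure is the truncated difference of the two distribution functions, the least
  possible measure for a difference of sets of these sizes.\<close>

lemma nn_integral_hinge:
  assumes f[measurable]: "f \<in> borel_measurable M" and v[measurable]: "v \<in> borel_measurable M"
    and v0: "\<And>x. x \<in> space M \<Longrightarrow> 0 \<le> v x" and fin: "\<And>x. x \<in> space M \<Longrightarrow> R v x < \<infinity>" and s: "0 < s"
  shows "(\<integral>\<^sup>+x. R f x - ennreal (s * enn2real (R v x)) \<partial>M) \<le> (\<integral>\<^sup>+x. ennreal (\<bar>f x\<bar> - s * v x) \<partial>M)"
proof -
  have "(\<integral>\<^sup>+x. R f x - ennreal (s * enn2real (R v x)) \<partial>M)
      = (\<integral>\<^sup>+\<sigma>. emeasure M {x \<in> space M. s * enn2real (R v x) \<le> \<sigma> \<and> ennreal \<sigma> < R f x} \<partial>lborel)"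
    using s by (intro nn_integral_diff_layers) auto
  also have "\<dots> \<le> (\<integral>\<^sup>+\<sigma>. emeasure M {x \<in> space M. s * v x \<le> \<sigma> \<and> ennreal \<sigma> < ennreal \<bar>f x\<bar>} \<partial>lborel)"
  proof (rule nn_integral_mono)
    fix \<sigma> :: real
    let ?df = "distribution_fun M f \<sigma>" and ?dv = "distribution_fun M v (\<sigma> / s)"
    show "emeasure M {x \<in> space M. s * enn2real (R v x) \<le> \<sigma> \<and> ennreal \<sigma> < R f x}
        \<le> emeasure M {x \<in> space M. s * v x \<le> \<sigma> \<and> ennreal \<sigma> < ennreal \<bar>f x\<bar>}" (is "emeasure M ?A \<le> emeasure M ?B")
    proof (cases "0 \<le> \<sigma>")
      case False
      have "\<not> s * enn2real (R v x) \<le> \<sigma>" for x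
        using s mult_nonneg_nonneg[of s "enn2real (R v x)"] False
        by (meson enn2real_nonneg less_imp_le order_trans)
      then have "?A = {}" by blast
      then show ?thesis by (simp only: emeasure_empty zero_le)
    next
      case True
      have "s * enn2real (R v x) \<le> \<sigma> \<longleftrightarrow> \<not> \<tau> x < ?dv" if x: "x \<in> space M" for x
      proof -
        have "s * enn2real (R v x) \<le> \<sigma> \<longleftrightarrow> \<not> \<sigma> / s < enn2real (R v x)"
          using s by (simp add: not_less field_simps)
        also have "\<dots> \<longleftrightarrow> \<not> ennreal (\<sigma> / s) < ennreal (enn2real (R v x))"
          using True s by (simp add: ennreal_less_iff)
        also have "\<dots> \<longleftrightarrow> \<not> \<tau> x < ?dv"
          using less_R_iff[OF v, of "\<sigma> / s" x] fin[OF x] True s by simp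
        finally show ?thesis .
      qed
      then have A: "?A = {x \<in> space M. \<tau> x < ?df} - {x \<in> space M. \<tau> x < ?dv}"
        using less_R_iff[OF f True] by auto
      have B: "?B = {x \<in> space M. \<sigma> < \<bar>f x\<bar>} - {x \<in> space M. \<sigma> / s < \<bar>v x\<bar>}"
        using v0 s True by (auto simp: ennreal_less_iff field_simps)
      show ?thesis
      proof (cases "?dv < ?df")
        case False
        have "?A = {}" unfolding A using False by auto
        then show ?thesis by (simp only: emeasure_empty zero_le)
      next
        case lt: True
        have dv: "emeasure M {x \<in> space M. \<tau> x < ?dv} = ?dv" "emeasure M {x \<in> space M. \<tau> x < ?df} = ?df"
          unfolding distribution_fun_def by (intro initial_segment; simp)+
        have "emeasure M ?A = ?df - ?dv"
          unfolding A using lt dv by (subst emeasure_Diff) (auto intro: less_trans)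
        also have "\<dots> \<le> emeasure M ?B"
        proof -
          have "?df \<le> emeasure M (?B \<union> {x \<in> space M. \<sigma> / s < \<bar>v x\<bar>})"
            unfolding B distribution_fun_def by (intro emeasure_mono) auto
          also have "\<dots> \<le> emeasure M ?B + ?dv"
            unfolding distribution_fun_def by (intro emeasure_subadditive) auto
          finally show ?thesis using lt by (auto simp: ennreal_minus_le_iff add.commute)
        qed
        finally show ?thesis .
      qed
    qed
  qed
  also have "\<dots> = (\<integral>\<^sup>+x. ennreal \<bar>f x\<bar> - ennreal (s * v x) \<partial>M)"
    using s v0 by (intro nn_integral_diff_layers[symmetric]) auto
  also have "\<dots> = (\<integral>\<^sup>+x. ennreal (\<bar>f x\<bar> - s * v x) \<partial>M)"
    using s v0 by (intro nn_integral_cong) (simp add: ennreal_minus)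
  finally show ?thesis .
qed

section \<open>The variational formula for partial integrals of a rearrangement\<close>

definition W :: "('a \<Rightarrow> real) \<Rightarrow> ennreal \<Rightarrow> ennreal" where
  "W v t = (\<integral>\<^sup>+x. R v x * indicator {x \<in> space M. \<tau> x < t} x \<partial>M)"

text \<open>On the segment, \<open>R v\<close> is at most l plus its excess over l, and the excess
  has the same integral for \<open>R v\<close> and \<open>\<bar>v\<bar>\<close>.\<close>

lemma W_le:
  assumes v[measurable]: "v \<in> borel_measurable M" and t: "t \<in> T" and l: "0 \<le> l"
  shows "W v t \<le> ennreal l * t + (\<integral>\<^sup>+x. ennreal (\<bar>v x\<bar> - l) \<partial>M)"
proof -
  have "W v t \<le> (\<integral>\<^sup>+x. ennreal l * indicator {x \<in> space M. \<tau> x < t} x + (R v x - ennreal l) \<partial>M)"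
    unfolding W_def
  proof (intro nn_integral_mono)
    fix x show "R v x * indicator {x \<in> space M. \<tau> x < t} x
        \<le> ennreal l * indicator {x \<in> space M. \<tau> x < t} x + (R v x - ennreal l)"
      by (auto simp: indicator_def) (metis ennreal_minus_le_iff order_refl)
  qed
  also have "\<dots> = ennreal l * t + (\<integral>\<^sup>+x. ennreal (\<bar>v x\<bar> - l) \<partial>M)"
    using T_segment[OF t] nn_integral_R_minus[OF v l]
    by (simp add: nn_integral_add nn_integral_cmult_indicator)
  finally show ?thesis .
qed

text \<open>The minimizing \<open>l\<close> is the value of the rearrangement at position \<open>t\<close>.\<close>

lemma W_attained:
  assumes v[measurable]: "v \<in> borel_measurable M" and t: "t \<in> T" and fin: "W v t < \<infinity>"
  shows "\<exists>l\<ge>0. ennreal l * t + (\<integral>\<^sup>+x. ennreal (\<bar>v x\<bar> - l) \<partial>M) \<le> W v t"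
proof -
  let ?q = "decreasing_inverse M v t" and ?S = "{x \<in> space M. \<tau> x < t}"
  have anti: "decreasing_inverse M v u' \<le> decreasing_inverse M v u" if "u \<le> u'" for u u'
    unfolding decreasing_inverse_def using that by (intro Inf_superset_mono image_mono) auto
  \<comment> \<open>\<open>R v\<close> is at least \<open>?q\<close> on the segment, so finiteness
    of \<open>W v t\<close> excludes the value \<infinity> for \<open>?q\<close>.\<close>
  have "?q * t = (\<integral>\<^sup>+x. ?q * indicator ?S x \<partial>M)"
    using T_segment[OF t] by (simp add: nn_integral_cmult_indicator)
  also have "\<dots> \<le> W v t"
    unfolding W_def R_def by (intro nn_integral_mono) (auto simp: indicator_def intro: anti)
  finally have "?q * t < \<infinity>" using fin by (rule le_less_trans)
  then have "?q \<noteq> \<infinity>" using T_segment[OF t] by (auto simp: ennreal_top_mult split: if_splits)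
  then obtain l where l: "0 \<le> l" "?q = ennreal l" by (cases ?q) auto
  have "W v t = (\<integral>\<^sup>+x. ennreal l * indicator ?S x + (R v x - ennreal l) \<partial>M)"
    unfolding W_def
  proof (rule nn_integral_cong)
    fix x assume x: "x \<in> space M"
    show "R v x * indicator ?S x = ennreal l * indicator ?S x + (R v x - ennreal l)"
    proof (cases "\<tau> x < t")
      case True
      then have "ennreal l \<le> R v x" using anti[of "\<tau> x" t] l unfolding R_def by simp
      then show ?thesis using True x by (simp add: ennreal_minus_cancel_iff add_diff_inverse_ennreal)
    next
      case False
      then have "R v x \<le> ennreal l" using anti[of t "\<tau> x"] l unfolding R_def by simp
      then show ?thesis using False by (simp add: diff_eq_0_ennreal ennreal_less_top le_less_trans)
    qed
  qed
  also have "\<dots> = ennreal l * t + (\<integral>\<^sup>+x. ennreal (\<bar>v x\<bar> - l) \<partial>M)"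
    using T_segment[OF t] nn_integral_R_minus[OF v l(1)]
    by (simp add: nn_integral_add nn_integral_cmult_indicator)
  finally show ?thesis using l by auto
qed

lemma R_cmult:
  assumes f[measurable]: "f \<in> borel_measurable M" and c: "0 < c"
  shows "R (\<lambda>x. c * f x) x = ennreal c * R f x"
proof (rule ennreal_eqI_less)
  fix s :: real assume s: "0 \<le> s"
  have d: "distribution_fun M (\<lambda>x. c * f x) s = distribution_fun M f (s / c)"
    unfolding distribution_fun_def using c by (simp add: abs_mult divide_less_eq mult.commute)
  have "ennreal s < R (\<lambda>x. c * f x) x \<longleftrightarrow> ennreal (s / c) < R f x"
    using less_R_iff[of "\<lambda>x. c * f x" s x] less_R_iff[of f "s / c" x] s c d by simp
  also have "\<dots> \<longleftrightarrow> ennreal c * ennreal (s / c) < ennreal c * R f x"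
    using ennreal_mult_le_mult_iff[of "ennreal c" "R f x" "ennreal (s / c)"] c
    by (simp add: not_le[symmetric])
  also have "ennreal c * ennreal (s / c) = ennreal s" using c s by (simp add: ennreal_mult[symmetric])
  finally show "ennreal s < R (\<lambda>x. c * f x) x \<longleftrightarrow> ennreal s < ennreal c * R f x" .
qed

text \<open>A level with a small enough level set bounds the rearrangement at x. By
  \<open>small_sets\<close> this works even at a position \<open>\<tau> x = 0\<close>, as occurs for
  sequences.\<close>

lemma R_finite:
  assumes f[measurable]: "f \<in> borel_measurable M" and x: "x \<in> space M"
    and small: "\<And>d. 0 < d \<Longrightarrow> \<exists>s\<ge>0. distribution_fun M f s \<le> ennreal d"
  shows "R f x < \<infinity>"
proof -
  obtain d where d: "0 < d" "\<And>A. A \<in> sets M \<Longrightarrow> emeasure M A \<le> ennreal d \<Longrightarrow> emeasure M A \<le> \<tau> x"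
    using small_sets[OF x] by blast
  obtain s where s: "0 \<le> s" "distribution_fun M f s \<le> ennreal d" using small[OF d(1)] by blast
  then have "distribution_fun M f s \<le> \<tau> x" using d(2) unfolding distribution_fun_def by simp
  then have "R f x \<le> ennreal s" using less_R_iff[OF f s(1), of x] by (simp add: not_less[symmetric])
  then show ?thesis by (rule le_less_trans) simp
qed

end

section \<open>Approximation by hinge functions\<close>

context orlicz
begin

text \<open>The change of slope at \<open>k * h\<close> of the piecewise linear interpolation of
  \<phi>; for k = 0 it is the first slope, as \<open>\<phi> 0 = 0\<close>. It is nonnegative by
  convexity.\<close>

definition hinge_coeff :: "real \<Rightarrow> nat \<Rightarrow> real" where
  "hinge_coeff h k = (if k = 0 then \<phi> h
     else \<phi> (real (Suc k) * h) - 2 * \<phi> (real k * h) + \<phi> (real (k - 1) * h)) / h"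

text \<open>A combination of hinge functions: it is the piecewise linear interpolation of \<open>\<phi>\<close> with step
  \<open>h\<close>, shifted to the right by one step so as to stay below \<open>\<phi>\<close>.\<close>

definition hinge_sum :: "real \<Rightarrow> nat \<Rightarrow> real \<Rightarrow> real" where
  "hinge_sum h N u = (\<Sum>k<N. hinge_coeff h k * max 0 (u - real (Suc k) * h))"

lemma hinge_coeff_nonneg:
  assumes h: "0 < h" shows "0 \<le> hinge_coeff h k"
proof (cases k)
  case 0
  then show ?thesis using h by (simp add: hinge_coeff_def)
next
  case (Suc j)
  have "\<phi> ((1/2) * (real j * h) + (1/2) * (real (Suc (Suc j)) * h))
      \<le> (1/2) * \<phi> (real j * h) + (1/2) * \<phi> (real (Suc (Suc j)) * h)"
    using h by (intro phi_convex) auto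
  also have "(1/2) * (real j * h) + (1/2) * (real (Suc (Suc j)) * h) = real (Suc j) * h"
    by (simp add: field_simps)
  finally show ?thesis using h Suc by (simp add: hinge_coeff_def)
qed

text \<open>The right side is the interpolation evaluated at \<open>u - h\<close> on its piece from
  \<open>m * h\<close> to \<open>Suc m * h\<close>. The fraction \<open>u / h - real (Suc m)\<close>
  is the position within that piece.\<close>

lemma sum_hinge_coeff:
  assumes h: "0 < h"
  shows "(\<Sum>k\<le>m. hinge_coeff h k * (u - real (Suc k) * h))
    = \<phi> (real m * h) + (u / h - real (Suc m)) * (\<phi> (real (Suc m) * h) - \<phi> (real m * h))"
proof (induction m)
  case 0
  then show ?case using h by (simp add: hinge_coeff_def field_simps)
next
  case (Suc m)
  define z where "z = u / h - real (Suc m)"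
  let ?p = "\<lambda>k. \<phi> (real k * h)"
  have "hinge_coeff h (Suc m) * (u - real (Suc (Suc m)) * h)
      = (?p (Suc (Suc m)) - 2 * ?p (Suc m) + ?p m) * (z - 1)"
    using h by (simp add: hinge_coeff_def z_def field_simps)
  then have "(\<Sum>k\<le>Suc m. hinge_coeff h k * (u - real (Suc k) * h))
      = ?p m + z * (?p (Suc m) - ?p m) + (?p (Suc (Suc m)) - 2 * ?p (Suc m) + ?p m) * (z - 1)"
    using Suc.IH by (simp only: sum.atMost_Suc z_def)
  also have "\<dots> = ?p (Suc m) + (z - 1) * (?p (Suc (Suc m)) - ?p (Suc m))" by algebra
  also have "z - 1 = u / h - real (Suc (Suc m))" by (simp add: z_def)
  finally show ?case .
qed

text \<open>The shifted interpolation lies between the values of \<phi> at two neighbouring nodes,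
  of which the upper is at most u and the lower more than \<open>u - 2 * h\<close>, unless u lies
  below h, where every hinge vanishes.\<close>

lemma hinge_sum_bounds:
  assumes h: "0 < h" and u: "0 \<le> u"
  shows "hinge_sum h N u \<le> \<phi> u"
    and "u \<le> real N * h \<Longrightarrow> \<phi> (max 0 (u - 2 * h)) \<le> hinge_sum h N u"
proof -
  have *: "hinge_sum h N u \<le> \<phi> u \<and> (u \<le> real N * h \<longrightarrow> \<phi> (max 0 (u - 2 * h)) \<le> hinge_sum h N u)"
  proof (cases "u < h")
    case True
    have "u - real (Suc k) * h \<le> 0" for k
    proof -
      have "1 * h \<le> real (Suc k) * h" using h by (intro mult_right_mono) auto
      then show ?thesis using True by simp
    qed
    then have "max 0 (u - real (Suc k) * h) = 0" for k by (rule max_absorb1)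
    then have "hinge_sum h N u = 0"
      by (simp only: hinge_sum_def mult_zero_right sum.neutral_const)
    moreover have "max 0 (u - 2 * h) = 0" using True h by simp
    ultimately show ?thesis using u by simp
  next
    case False
    \<comment> \<open>The last active hinge: \<open>Suc m * h \<le> u < Suc (Suc m) * h\<close>,
      since hinge k starts at \<open>Suc k * h\<close>.\<close>
    define m where "m = nat \<lfloor>u / h\<rfloor> - 1"
    have fl: "1 \<le> \<lfloor>u / h\<rfloor>" using False h by (simp add: le_floor_iff)
    then have Suc_m: "real (Suc m) = of_int \<lfloor>u / h\<rfloor>" unfolding m_def by (simp add: nat_diff_distrib' of_nat_diff)
    have z: "0 \<le> u / h - real (Suc m)" "u / h - real (Suc m) < 1"
      unfolding Suc_m by linarith+
    then have um: "real (Suc m) * h \<le> u" "u < real (Suc (Suc m)) * h"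
      using h by (auto simp: field_simps)
    have terms: "hinge_coeff h k * max 0 (u - real (Suc k) * h)
        = (if k \<le> m then hinge_coeff h k * (u - real (Suc k) * h) else 0)" for k
    proof (cases "k \<le> m")
      case True
      then have "real (Suc k) * h \<le> real (Suc m) * h" using h by (intro mult_right_mono) auto
      then show ?thesis using True um by (simp add: max_def)
    next
      case False
      then have "real (Suc (Suc m)) * h \<le> real (Suc k) * h" using h by (intro mult_right_mono) auto
      then show ?thesis using False um by (simp add: max_def)
    qed
    let ?S = "\<phi> (real m * h) + (u / h - real (Suc m)) * (\<phi> (real (Suc m) * h) - \<phi> (real m * h))"
    have full: "hinge_sum h N u = ?S" if "m < N" for N
    proof -
      have "hinge_sum h N u = (\<Sum>k\<in>{..<N} \<inter> {..m}. hinge_coeff h k * (u - real (Suc k) * h))"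
        unfolding hinge_sum_def terms by (subst sum.inter_restrict) auto
      also have "{..<N} \<inter> {..m} = {..m}" using that by auto
      finally show ?thesis using sum_hinge_coeff[OF h] by simp
    qed
    have inc: "\<phi> (real m * h) \<le> \<phi> (real (Suc m) * h)" using h by (intro phi_mono mult_right_mono) auto
    have "hinge_sum h N u \<le> hinge_sum h (max N (Suc m)) u"
      unfolding hinge_sum_def using h
      by (intro sum_mono2) (auto intro!: mult_nonneg_nonneg hinge_coeff_nonneg)
    also have "\<dots> = ?S" by (rule full) simp
    also have "\<dots> \<le> \<phi> (real m * h) + 1 * (\<phi> (real (Suc m) * h) - \<phi> (real m * h))"
      using z inc by (intro add_left_mono mult_right_mono) auto
    also have "\<dots> \<le> \<phi> u" using um h phi_mono[of "real (Suc m) * h" u] by simp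
    finally have up: "hinge_sum h N u \<le> \<phi> u" .
    have "\<phi> (max 0 (u - 2 * h)) \<le> hinge_sum h N u" if N: "u \<le> real N * h"
    proof -
      have "real (Suc m) * h \<le> real N * h" using um N by simp
      then have "m < N" using h by simp
      have "max 0 (u - 2 * h) \<le> real m * h" using um h by (auto simp: algebra_simps)
      then have "\<phi> (max 0 (u - 2 * h)) \<le> \<phi> (real m * h)" by (intro phi_mono) auto
      also have "\<dots> \<le> ?S" using z inc by (simp add: mult_nonneg_nonneg)
      also have "\<dots> = hinge_sum h N u" using full[OF \<open>m < N\<close>] by simp
      finally show ?thesis .
    qed
    with up show ?thesis by blast
  qed
  show "hinge_sum h N u \<le> \<phi> u"
    and "u \<le> real N * h \<Longrightarrow> \<phi> (max 0 (u - 2 * h)) \<le> hinge_sum h N u"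
    using * by auto
qed

text \<open>The mesh tends to 0 while \<open>knots n * step n = Suc n\<close> tends to \<infinity>,
  so every fixed u is eventually within the range of the lower bound.\<close>

definition step :: "nat \<Rightarrow> real" where "step n = 1 / real (Suc n)"
definition knots :: "nat \<Rightarrow> nat" where "knots n = Suc n * Suc n"

lemma step_pos: "0 < step n" by (simp add: step_def)

lemma hinge_sum_tendsto:
  assumes u: "0 \<le> u" shows "(\<lambda>n. hinge_sum (step n) (knots n) u) \<longlonglongrightarrow> \<phi> u"
proof (rule tendsto_sandwich)
  have "(\<lambda>n. u - 2 * step n) \<longlonglongrightarrow> u - 2 * 0"
    unfolding step_def by (intro tendsto_intros LIMSEQ_Suc[OF lim_1_over_n])
  then have "(\<lambda>n. max 0 (u - 2 * step n)) \<longlonglongrightarrow> max 0 u" by (intro tendsto_max tendsto_const) simp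
  moreover have "isCont (\<lambda>u. \<phi> \<bar>u\<bar>) (max 0 u)"
    using continuous_phi_abs by (simp add: continuous_on_eq_continuous_at)
  ultimately have "(\<lambda>n. \<phi> \<bar>max 0 (u - 2 * step n)\<bar>) \<longlonglongrightarrow> \<phi> \<bar>max 0 u\<bar>"
    by (intro isCont_tendsto_compose[where g = "\<lambda>u. \<phi> \<bar>u\<bar>"])
  then show "(\<lambda>n. \<phi> (max 0 (u - 2 * step n))) \<longlonglongrightarrow> \<phi> u" using u by simp
  have kn: "real (knots n) * step n = real (Suc n)" for n
    unfolding knots_def step_def of_nat_mult by (simp del: of_nat_Suc)
  have "\<forall>\<^sub>F n in sequentially. nat \<lceil>u\<rceil> \<le> n" by (rule eventually_ge_at_top)
  then show "\<forall>\<^sub>F n in sequentially. \<phi> (max 0 (u - 2 * step n)) \<le> hinge_sum (step n) (knots n) u"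
  proof eventually_elim
    case (elim n)
    then have "u \<le> real (Suc n)" by linarith
    then show ?case using kn[of n] by (intro hinge_sum_bounds(2) step_pos u) simp
  qed
qed (use u hinge_sum_bounds(1)[OF step_pos u] in auto)

text \<open>The perspective of \<open>hinge_sum\<close>, written without division: it makes sense at
  v = 0, and its integral splits into the integrals compared by \<open>nn_integral_hinge\<close>.
  Negative parts are cut off by \<open>ennreal\<close>.\<close>

definition hinge_term :: "nat \<Rightarrow> real \<Rightarrow> real \<Rightarrow> ennreal" where
  "hinge_term n y v =
     (\<Sum>k<knots n. ennreal (hinge_coeff (step n) k) * ennreal (y - real (Suc k) * step n * v))"

lemma hinge_term_eq:
  assumes "0 < v" "0 \<le> y"
  shows "hinge_term n y v = ennreal (hinge_sum (step n) (knots n) (y / v) * v)"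
proof -
  have "ennreal (y - real (Suc k) * step n * v) = ennreal (max 0 (y / v - real (Suc k) * step n) * v)" for k
  proof -
    have "max 0 (y / v - real (Suc k) * step n) * v = max 0 (y - real (Suc k) * step n * v)"
      using assms by (simp add: max_mult_distrib_right left_diff_distrib)
    then show ?thesis by (simp add: ennreal_max_0)
  qed
  then have "hinge_term n y v = (\<Sum>k<knots n. ennreal (hinge_coeff (step n) k * max 0 (y / v - real (Suc k) * step n) * v))"
    unfolding hinge_term_def using assms hinge_coeff_nonneg[OF step_pos]
    by (simp add: ennreal_mult mult.assoc)
  also have "\<dots> = ennreal (\<Sum>k<knots n. hinge_coeff (step n) k * max 0 (y / v - real (Suc k) * step n) * v)"
    using assms hinge_coeff_nonneg[OF step_pos] by (intro sum_ennreal) auto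
  finally show ?thesis by (simp add: hinge_sum_def sum_distrib_right)
qed

lemma hinge_term_le_Phi:
  assumes "0 \<le> v" "0 \<le> y" shows "hinge_term n y v \<le> \<Phi> y v"
proof (cases "v = 0")
  case True
  then show ?thesis using assms by (auto simp: orlicz_term_def hinge_term_def)
next
  case False
  then show ?thesis using assms hinge_sum_bounds(1)[OF step_pos, of "y / v"]
    by (auto simp: hinge_term_eq Phi_pos intro!: ennreal_leI mult_right_mono)
qed

lemma hinge_term_tendsto:
  assumes "0 < v" "0 \<le> y" shows "(\<lambda>n. hinge_term n y v) \<longlonglongrightarrow> \<Phi> y v"
  using assms hinge_sum_tendsto[of "y / v"]
  by (auto simp: hinge_term_eq Phi_pos intro!: tendsto_intros)

lemma hinge_term_mono:
  assumes "\<And>b. 0 < b \<Longrightarrow> y - b * v \<le> max 0 (z - b * u)"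
  shows "hinge_term n y v \<le> hinge_term n z u"
  unfolding hinge_term_def
proof (intro sum_mono mult_left_mono)
  fix k
  have "ennreal (y - real (Suc k) * step n * v) \<le> ennreal (max 0 (z - real (Suc k) * step n * u))"
    using step_pos[of n] by (intro ennreal_leI assms mult_pos_pos) auto
  then show "ennreal (y - real (Suc k) * step n * v) \<le> ennreal (z - real (Suc k) * step n * u)"
    by (simp add: ennreal_max_0)
qed simp

lemma hinge_term_measurable [measurable (raw)]:
  assumes [measurable]: "f \<in> borel_measurable M" "v \<in> borel_measurable M"
  shows "(\<lambda>x. hinge_term n (f x) (v x)) \<in> borel_measurable M"
  unfolding hinge_term_def by measurable

lemma nn_integral_hinge_term:
  assumes [measurable]: "f \<in> borel_measurable M" "v \<in> borel_measurable M"
  shows "(\<integral>\<^sup>+x. hinge_term n (f x) (v x) \<partial>M) =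
    (\<Sum>k<knots n. ennreal (hinge_coeff (step n) k) * (\<integral>\<^sup>+x. ennreal (f x - real (Suc k) * step n * v x) \<partial>M))"
  unfolding hinge_term_def by (simp add: nn_integral_sum nn_integral_cmult)

text \<open>Jensen's inequality for \<open>\<Phi> c\<close>; it is evident for the hinge functions.\<close>

lemma Phi_average_le:
  assumes v[measurable]: "v \<in> borel_measurable M" and v0: "\<And>x. x \<in> space M \<Longrightarrow> 0 \<le> v x"
    and A[measurable]: "A \<in> sets M" and fin: "emeasure M A < \<infinity>" and c: "0 < c" and m: "0 \<le> m"
    and avg: "(\<integral>\<^sup>+x\<in>A. ennreal (v x) \<partial>M) = ennreal m * emeasure M A"
  shows "\<Phi> c m * emeasure M A \<le> (\<integral>\<^sup>+x\<in>A. \<Phi> c (v x) \<partial>M)"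
proof (cases "m = 0")
  case True
  \<comment> \<open>With mean 0, v vanishes almost everywhere on A, and both integrands agree
    there.\<close>
  then have "AE x in M. ennreal (v x) * indicator A x = 0"
    using avg by (subst nn_integral_0_iff_AE[symmetric]) auto
  then have "AE x in M. \<Phi> c m * indicator A x \<le> \<Phi> c (v x) * indicator A x"
    using AE_space
  proof eventually_elim
    case (elim x)
    then show ?case using True v0[of x] by (auto simp: indicator_def split: if_splits)
  qed
  from nn_integral_mono_AE[OF this] show ?thesis by (simp add: nn_integral_cmult_indicator)
next
  case False
  then have m: "0 < m" using m by simp
  have step: "hinge_term n c m * emeasure M A \<le> (\<integral>\<^sup>+x\<in>A. \<Phi> c (v x) \<partial>M)" for n
  proof -
    have one: "ennreal (c - b * m) * emeasure M A \<le> (\<integral>\<^sup>+x\<in>A. ennreal (c - b * v x) \<partial>M)" if b: "0 < b" for b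
    proof -
      have "ennreal c * emeasure M A = (\<integral>\<^sup>+x\<in>A. ennreal c \<partial>M)" by (simp add: nn_integral_cmult_indicator)
      also have "\<dots> \<le> (\<integral>\<^sup>+x. ennreal (c - b * v x) * indicator A x + ennreal b * (ennreal (v x) * indicator A x) \<partial>M)"
      proof (rule nn_integral_mono)
        fix x assume x: "x \<in> space M"
        have "ennreal c \<le> ennreal (max 0 (c - b * v x) + b * v x)" by (intro ennreal_leI) auto
        also have "\<dots> = ennreal (c - b * v x) + ennreal b * ennreal (v x)"
          using b v0[OF x] by (simp add: ennreal_mult ennreal_max_0)
        finally show "ennreal c * indicator A x
            \<le> ennreal (c - b * v x) * indicator A x + ennreal b * (ennreal (v x) * indicator A x)"
          by (simp add: indicator_def)
      qed
      also have "\<dots> = (\<integral>\<^sup>+x\<in>A. ennreal (c - b * v x) \<partial>M) + ennreal b * (ennreal m * emeasure M A)"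
        by (simp add: nn_integral_add nn_integral_cmult avg)
      also have "ennreal b * (ennreal m * emeasure M A) = ennreal (b * m) * emeasure M A"
        using b m by (simp add: ennreal_mult mult.assoc)
      finally have le: "ennreal c * emeasure M A \<le> (\<integral>\<^sup>+x\<in>A. ennreal (c - b * v x) \<partial>M) + ennreal (b * m) * emeasure M A" .
      show ?thesis
      proof (cases "b * m \<le> c")
        case True
        have "ennreal (c - b * m) * emeasure M A + ennreal (b * m) * emeasure M A = ennreal c * emeasure M A"
          using True b m by (simp add: distrib_right[symmetric] ennreal_plus[symmetric] del: ennreal_plus)
        with le have "ennreal (b * m) * emeasure M A + ennreal (c - b * m) * emeasure M A
            \<le> ennreal (b * m) * emeasure M A + (\<integral>\<^sup>+x\<in>A. ennreal (c - b * v x) \<partial>M)"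
          by (simp add: add.commute)
        then show ?thesis
          using fin by (auto simp: ennreal_add_left_cancel_le ennreal_mult_eq_top_iff)
      next
        case False
        then show ?thesis by (simp add: ennreal_neg)
      qed
    qed
    have "hinge_term n c m * emeasure M A
        = (\<Sum>k<knots n. ennreal (hinge_coeff (step n) k) * (ennreal (c - real (Suc k) * step n * m) * emeasure M A))"
      unfolding hinge_term_def by (simp add: sum_distrib_right mult.assoc)
    also have "\<dots> \<le> (\<Sum>k<knots n. ennreal (hinge_coeff (step n) k) * (\<integral>\<^sup>+x\<in>A. ennreal (c - real (Suc k) * step n * v x) \<partial>M))"
      using step_pos[of n] by (intro sum_mono mult_left_mono one mult_pos_pos) auto
    also have "\<dots> = (\<integral>\<^sup>+x\<in>A. hinge_term n c (v x) \<partial>M)"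
      unfolding hinge_term_def
      by (simp add: nn_integral_sum[symmetric] nn_integral_cmult[symmetric] sum_distrib_right mult.assoc)
    also have "\<dots> \<le> (\<integral>\<^sup>+x\<in>A. \<Phi> c (v x) \<partial>M)"
      using c v0 by (intro nn_integral_mono mult_right_mono hinge_term_le_Phi) auto
    finally show ?thesis .
  qed
  have "(\<lambda>n. hinge_term n c m * emeasure M A) \<longlonglongrightarrow> \<Phi> c m * emeasure M A"
  proof -
    have "(\<lambda>n. emeasure M A * hinge_term n c m) \<longlonglongrightarrow> emeasure M A * \<Phi> c m"
      using fin m c by (intro ennreal_tendsto_cmult hinge_term_tendsto) auto
    then show ?thesis by (simp add: mult.commute)
  qed
  then show ?thesis by (rule LIMSEQ_le_const2) (use step in blast)
qed

end

section \<open>Weights submajorized by a fixed weight\<close>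

text \<open>Removes the factor \<open>c < 1\<close> lost in \<open>P_R_le\<close> and
  \<open>P_le_P_R\<close>.\<close>

lemma ennreal_le_mult_one_interval:
  fixes x y :: ennreal
  assumes "\<And>c. 0 < c \<Longrightarrow> c < 1 \<Longrightarrow> ennreal c * x \<le> y"
  shows "x \<le> y"
proof (cases y)
  case y: (real b)
  show ?thesis
  proof (cases x)
    case x: (real a)
    have "c * a \<le> b" if "0 < c" "c < 1" for c
      using assms[OF that] x y that by (simp add: ennreal_mult[symmetric])
    then have "a \<le> b" by (rule field_le_mult_one_interval)
    then show ?thesis using x y by (simp add: ennreal_leI)
  next
    case top
    then show ?thesis using assms[of "1/2"] y by (simp add: ennreal_mult_top top_unique)
  qed
qed simp

text \<open>\<open>W_finite\<close> expresses integrability of w near 0, through the rearrangement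
  of w.\<close>

locale weighted_space = rearrangement_space M \<tau> T + orlicz \<phi>
  for M :: "'a measure" and \<tau> :: "'a \<Rightarrow> ennreal" and T :: "ennreal set" and \<phi> :: "real \<Rightarrow> real" +
  fixes w :: "'a \<Rightarrow> real"
  assumes w_measurable [measurable]: "w \<in> borel_measurable M"
    and w_positive: "x \<in> space M \<Longrightarrow> 0 < w x"
    and W_finite: "\<exists>t\<in>T. W w t < \<infinity>"
begin

definition V :: "('a \<Rightarrow> real) set" where
  "V = {v \<in> borel_measurable M. (\<forall>x\<in>space M. 0 \<le> v x) \<and> (\<forall>t\<in>T. W v t \<le> W w t)}"

text \<open>This form of the condition no longer mentions the rearrangement of \<open>v\<close>.\<close>

lemma mem_V_iff:
  "v \<in> V \<longleftrightarrow> v \<in> borel_measurable M \<and> (\<forall>x\<in>space M. 0 \<le> v x) \<and>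
    (\<forall>t\<in>T. W w t < \<infinity> \<longrightarrow> (\<exists>l\<ge>0. ennreal l * t + (\<integral>\<^sup>+x. ennreal (v x - l) \<partial>M) \<le> W w t))"
  (is "_ \<longleftrightarrow> _ \<and> _ \<and> ?K")
proof (cases "v \<in> borel_measurable M \<and> (\<forall>x\<in>space M. 0 \<le> v x)")
  case True
  then have v: "v \<in> borel_measurable M" by simp
  have abs: "(\<integral>\<^sup>+x. ennreal (\<bar>v x\<bar> - l) \<partial>M) = (\<integral>\<^sup>+x. ennreal (v x - l) \<partial>M)" for l
    using True by (intro nn_integral_cong) simp
  have "(\<forall>t\<in>T. W v t \<le> W w t) \<longleftrightarrow> ?K"
  proof (intro iffI ballI impI)
    fix t assume t: "t \<in> T" and le: "\<forall>t\<in>T. W v t \<le> W w t" and "W w t < \<infinity>"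
    then have "W v t < \<infinity>" by (meson le_less_trans)
    from W_attained[OF v t this] le t
    show "\<exists>l\<ge>0. ennreal l * t + (\<integral>\<^sup>+x. ennreal (v x - l) \<partial>M) \<le> W w t"
      unfolding abs by (meson order_trans)
  next
    fix t assume t: "t \<in> T" and K: ?K
    show "W v t \<le> W w t"
    proof (cases "W w t < \<infinity>")
      case True
      then obtain l where "0 \<le> l" "ennreal l * t + (\<integral>\<^sup>+x. ennreal (v x - l) \<partial>M) \<le> W w t"
        using K t by blast
      then show ?thesis using W_le[OF v t, of l] unfolding abs by (meson order_trans)
    qed (simp add: not_less top_unique)
  qed
  then show ?thesis using True by (simp add: V_def)
qed (auto simp: V_def)

lemma V_D:
  assumes "v \<in> V" "t \<in> T" "W w t < \<infinity>"
  obtains l where "0 \<le> l" "ennreal l * t + (\<integral>\<^sup>+x. ennreal (v x - l) \<partial>M) \<le> W w t"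
  using assms unfolding mem_V_iff by blast

text \<open>The levels l and k belonging to u and v are combined with the same coefficients, because
  the positive part of a difference is jointly sublinear in its two terms.\<close>

lemma convex_V:
  assumes u: "u \<in> V" and v: "v \<in> V" and c: "0 < c" "c < 1"
  shows "(\<lambda>x. c * u x + (1 - c) * v x) \<in> V"
  unfolding mem_V_iff
proof (intro conjI ballI impI)
  have [measurable]: "u \<in> borel_measurable M" "v \<in> borel_measurable M" using u v by (auto simp: V_def)
  show "(\<lambda>x. c * u x + (1 - c) * v x) \<in> borel_measurable M" by measurable
  show "0 \<le> c * u x + (1 - c) * v x" if "x \<in> space M" for x using u v c that by (auto simp: V_def)
  fix t assume t: "t \<in> T" "W w t < \<infinity>"
  obtain l where l: "0 \<le> l" "ennreal l * t + (\<integral>\<^sup>+x. ennreal (u x - l) \<partial>M) \<le> W w t" by (rule V_D[OF u t])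
  obtain k where k: "0 \<le> k" "ennreal k * t + (\<integral>\<^sup>+x. ennreal (v x - k) \<partial>M) \<le> W w t" by (rule V_D[OF v t])
  let ?l = "c * l + (1 - c) * k"
  let ?I = "\<integral>\<^sup>+x. ennreal (u x - l) \<partial>M" and ?J = "\<integral>\<^sup>+x. ennreal (v x - k) \<partial>M"
  have "(\<integral>\<^sup>+x. ennreal (c * u x + (1 - c) * v x - ?l) \<partial>M)
      \<le> (\<integral>\<^sup>+x. ennreal c * ennreal (u x - l) + ennreal (1 - c) * ennreal (v x - k) \<partial>M)"
  proof (rule nn_integral_mono)
    fix x
    have "ennreal (c * u x + (1 - c) * v x - ?l) \<le> ennreal (c * max 0 (u x - l) + (1 - c) * max 0 (v x - k))"
    proof (rule ennreal_leI)
      have "c * (u x - l) \<le> c * max 0 (u x - l)" "(1 - c) * (v x - k) \<le> (1 - c) * max 0 (v x - k)"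
        using c by (auto intro!: mult_left_mono)
      then show "c * u x + (1 - c) * v x - ?l \<le> c * max 0 (u x - l) + (1 - c) * max 0 (v x - k)"
        by (simp add: algebra_simps)
    qed
    also have "\<dots> = ennreal c * ennreal (u x - l) + ennreal (1 - c) * ennreal (v x - k)"
      using c by (simp add: ennreal_mult ennreal_max_0)
    finally show "ennreal (c * u x + (1 - c) * v x - ?l) \<le> ennreal c * ennreal (u x - l) + ennreal (1 - c) * ennreal (v x - k)" .
  qed
  also have "\<dots> = ennreal c * ?I + ennreal (1 - c) * ?J"
    by (simp add: nn_integral_add nn_integral_cmult)
  finally have "ennreal ?l * t + (\<integral>\<^sup>+x. ennreal (c * u x + (1 - c) * v x - ?l) \<partial>M)
      \<le> (ennreal c * ennreal l + ennreal (1 - c) * ennreal k) * t + (ennreal c * ?I + ennreal (1 - c) * ?J)"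
    using c l k by (simp add: ennreal_mult add_left_mono)
  also have "\<dots> = ennreal c * (ennreal l * t + ?I) + ennreal (1 - c) * (ennreal k * t + ?J)"
    by (simp add: algebra_simps)
  also have "\<dots> \<le> ennreal c * W w t + ennreal (1 - c) * W w t"
    using l k by (intro add_mono mult_left_mono) auto
  also have "\<dots> = W w t"
    using c by (simp add: distrib_right[symmetric] ennreal_plus[symmetric] del: ennreal_plus)
  finally show "\<exists>l\<ge>0. ennreal l * t + (\<integral>\<^sup>+x. ennreal (c * u x + (1 - c) * v x - l) \<partial>M) \<le> W w t"
    using c l k by (intro exI[of _ ?l]) auto
qed

lemma tight_V:
  assumes d: "0 < d"
  shows "\<exists>\<mu>>0. \<forall>v\<in>V. emeasure M {x \<in> space M. \<mu> < v x} \<le> ennreal d"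
proof -
  obtain t where t: "t \<in> T" "W w t < \<infinity>" using W_finite by blast
  obtain b where b: "t = ennreal b" "0 < b" using T_segment[OF t(1)] by (cases t) auto
  obtain K where K: "W w t = ennreal K" "0 \<le> K" using t(2) by (cases "W w t") auto
  \<comment> \<open>From \<open>l * b \<le> K\<close> the level l is at most \<open>K / b\<close>,
    so \<open>v - l\<close> exceeds \<open>(K + 1) / d\<close> wherever v exceeds \<mu>. Markov's
    inequality then gives \<open>K * d / (K + 1) \<le> d\<close>.\<close>
  define \<mu> where "\<mu> = K / b + (K + 1) / d"
  have "emeasure M {x \<in> space M. \<mu> < v x} \<le> ennreal d" if v: "v \<in> V" for v
  proof -
    have [measurable]: "v \<in> borel_measurable M" using v by (simp add: V_def)
    let ?A = "{x \<in> space M. \<mu> < v x}" and ?q = "(K + 1) / d"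
    obtain l where l: "0 \<le> l" "ennreal l * t + (\<integral>\<^sup>+x. ennreal (v x - l) \<partial>M) \<le> W w t" by (rule V_D[OF v t])
    have "ennreal l * t \<le> W w t" "(\<integral>\<^sup>+x. ennreal (v x - l) \<partial>M) \<le> W w t"
      using l(2) by (auto intro: order_trans[rotated] add_increasing add_increasing2)
    then have K2: "ennreal (l * b) \<le> ennreal K" "(\<integral>\<^sup>+x. ennreal (v x - l) \<partial>M) \<le> ennreal K"
      using l b K by (auto simp: ennreal_mult)
    then have "l \<le> K / b" using K b by (simp add: field_simps)
    have "ennreal ?q * emeasure M ?A = (\<integral>\<^sup>+x. ennreal ?q * indicator ?A x \<partial>M)"
      by (simp add: nn_integral_cmult_indicator)
    also have "\<dots> \<le> (\<integral>\<^sup>+x. ennreal (v x - l) \<partial>M)"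
      using \<open>l \<le> K / b\<close> by (intro nn_integral_mono) (auto simp: indicator_def \<mu>_def intro!: ennreal_leI)
    also note K2(2)
    finally have "ennreal (1 / ?q) * (ennreal ?q * emeasure M ?A) \<le> ennreal (1 / ?q) * ennreal K"
      by (rule mult_left_mono) simp
    moreover have "ennreal (1 / ?q) * ennreal ?q = 1" using d K by (simp add: ennreal_mult[symmetric])
    ultimately have "emeasure M ?A \<le> ennreal (1 / ?q) * ennreal K" by (simp add: mult.assoc[symmetric])
    also have "\<dots> = ennreal (1 / ?q * K)" using d K by (intro ennreal_mult[symmetric]) auto
    also have "\<dots> \<le> ennreal d" using d K by (intro ennreal_leI) (simp add: field_simps)
    finally show ?thesis .
  qed
  moreover have "0 < \<mu>" using b K d by (auto simp: \<mu>_def intro!: add_nonneg_pos)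
  ultimately show ?thesis by blast
qed

lemma closed_V:
  assumes g: "\<And>n. g n \<in> V" and v[measurable]: "v \<in> borel_measurable M"
    and v0: "\<And>x. x \<in> space M \<Longrightarrow> 0 \<le> v x" and lim: "AE x in M. (\<lambda>n. g n x) \<longlonglongrightarrow> v x"
  shows "v \<in> V"
  unfolding mem_V_iff
proof (intro conjI ballI impI v v0)
  have gm[measurable]: "g n \<in> borel_measurable M" for n using g[of n] by (simp add: V_def)
  fix t assume t: "t \<in> T" "W w t < \<infinity>"
  obtain b where b: "t = ennreal b" "0 < b" using T_segment[OF t(1)] by (cases t) auto
  obtain K where K: "W w t = ennreal K" "0 \<le> K" using t(2) by (cases "W w t") auto
  \<comment> \<open>The levels lie in a compact interval and converge along a subsequence. Solving
    for the integral leaves a convergent right side, as Fatou's lemma requires.\<close>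
  have "\<exists>l. 0 \<le> l \<and> l * b \<le> K \<and> (\<integral>\<^sup>+x. ennreal (g n x - l) \<partial>M) \<le> ennreal (K - l * b)" for n
  proof -
    obtain l where l: "0 \<le> l" "ennreal l * t + (\<integral>\<^sup>+x. ennreal (g n x - l) \<partial>M) \<le> W w t"
      by (rule V_D[OF g t])
    then have le: "ennreal (l * b) + (\<integral>\<^sup>+x. ennreal (g n x - l) \<partial>M) \<le> ennreal K"
      using b K by (simp add: ennreal_mult)
    then have "ennreal (l * b) \<le> ennreal K" by (auto intro: order_trans[rotated] add_increasing2)
    then have lb: "l * b \<le> K" using K by simp
    have "(\<integral>\<^sup>+x. ennreal (g n x - l) \<partial>M) \<le> ennreal (K - l * b)"
    proof (cases "\<integral>\<^sup>+x. ennreal (g n x - l) \<partial>M")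
      case (real i)
      then have "l * b + i \<le> K"
        using le l b K by (simp add: ennreal_plus[symmetric] del: ennreal_plus)
      then show ?thesis using real by (simp add: ennreal_leI)
    next
      case top
      then show ?thesis using le by (simp add: top_unique)
    qed
    then show ?thesis using l lb by blast
  qed
  then obtain l where l: "\<And>n. 0 \<le> l n" "\<And>n. l n * b \<le> K"
      "\<And>n. (\<integral>\<^sup>+x. ennreal (g n x - l n) \<partial>M) \<le> ennreal (K - l n * b)" by metis
  have "l n \<in> {0..K / b}" for n using l(1)[of n] l(2)[of n] b by (simp add: field_simps)
  then obtain L r where L: "L \<in> {0..K / b}" and r: "strict_mono (r :: nat \<Rightarrow> nat)" and lr: "(l \<circ> r) \<longlonglongrightarrow> L"
    using compact_Icc[of 0 "K / b"] unfolding compact_def by metis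
  have lr: "(\<lambda>n. l (r n)) \<longlonglongrightarrow> L" using lr by (simp add: o_def)
  have L: "0 \<le> L" "L * b \<le> K" using L b by (auto simp: field_simps)
  have "(\<integral>\<^sup>+x. ennreal (v x - L) \<partial>M) \<le> (\<integral>\<^sup>+x. liminf (\<lambda>n. ennreal (g (r n) x - l (r n))) \<partial>M)"
  proof (rule nn_integral_mono_AE)
    show "AE x in M. ennreal (v x - L) \<le> liminf (\<lambda>n. ennreal (g (r n) x - l (r n)))"
      using lim
    proof eventually_elim
      case (elim x)
      have "(\<lambda>n. ennreal (g (r n) x - l (r n))) \<longlonglongrightarrow> ennreal (v x - L)"
        using LIMSEQ_subseq_LIMSEQ[OF elim r] by (intro tendsto_intros lr) (simp add: o_def)
      then have "liminf (\<lambda>n. ennreal (g (r n) x - l (r n))) = ennreal (v x - L)"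
        by (intro lim_imp_Liminf) auto
      then show ?case by simp
    qed
  qed
  also have "\<dots> \<le> liminf (\<lambda>n. \<integral>\<^sup>+x. ennreal (g (r n) x - l (r n)) \<partial>M)"
    by (rule nn_integral_liminf) measurable
  also have "\<dots> \<le> liminf (\<lambda>n. ennreal (K - l (r n) * b))"
    using l(3) by (intro Liminf_mono always_eventually allI) auto
  also have "\<dots> = ennreal (K - L * b)"
    by (intro lim_imp_Liminf tendsto_intros lr) auto
  finally have "ennreal L * t + (\<integral>\<^sup>+x. ennreal (v x - L) \<partial>M) \<le> ennreal (L * b) + ennreal (K - L * b)"
    using b L by (simp add: ennreal_mult add_left_mono)
  also have "\<dots> = W w t" using L b K by (subst ennreal_plus[symmetric]) auto
  finally show "\<exists>l\<ge>0. ennreal l * t + (\<integral>\<^sup>+x. ennreal (v x - l) \<partial>M) \<le> W w t" using L by blast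
qed

sublocale orlicz_modular M \<phi> V w
proof
  show "w \<in> V" using w_positive by (auto simp: V_def intro: less_imp_le)
  show "\<exists>\<mu>>0. \<forall>v\<in>V. emeasure M {x \<in> space M. \<mu> < v x} \<le> ennreal d" if "0 < d" for d
    using tight_V[OF that] .
  show "v \<in> V" if "\<And>n. g n \<in> V" "v \<in> borel_measurable M" "\<And>x. x \<in> space M \<Longrightarrow> 0 \<le> v x"
      "AE x in M. (\<lambda>n. g n x) \<longlonglongrightarrow> v x" for g v
    using closed_V[OF that] .
next
  show "v \<in> borel_measurable M" if "v \<in> V" for v using that by (simp add: V_def)
  show "0 \<le> v x" if "v \<in> V" "x \<in> space M" for v x using that by (simp add: V_def)
  show "(\<lambda>x. c * u x + (1 - c) * v x) \<in> V" if "u \<in> V" "v \<in> V" "0 < c" "c < 1" for u v c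
    using convex_V[OF that] .
qed (rule w_positive)

lemma R_finite_V:
  assumes v: "v \<in> V" and x: "x \<in> space M" shows "R v x < \<infinity>"
proof (rule R_finite[OF V_measurable[OF v] x])
  fix d :: real assume "0 < d"
  then obtain \<mu> where mu: "0 < \<mu>" "emeasure M {x \<in> space M. \<mu> < v x} \<le> ennreal d"
    using V_tight v by blast
  have "distribution_fun M v \<mu> = emeasure M {x \<in> space M. \<mu> < v x}"
    unfolding distribution_fun_def using V_nonneg[OF v] by (intro arg_cong[where f = "emeasure M"]) auto
  then show "\<exists>s\<ge>0. distribution_fun M v s \<le> ennreal d" using mu by (intro exI[of _ \<mu>]) auto
qed

text \<open>The criterion \<open>mem_V_iff\<close> involves v only through integrals of its excess
  over constants, which rearrangement preserves.\<close>

lemma R_mem_V: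
  assumes v: "v \<in> V" shows "(\<lambda>x. enn2real (R v x)) \<in> V"
  unfolding mem_V_iff
proof (intro conjI ballI impI)
  note vm[measurable] = V_measurable[OF v]
  show "(\<lambda>x. enn2real (R v x)) \<in> borel_measurable M" by measurable
  fix t assume t: "t \<in> T" "W w t < \<infinity>"
  obtain l where l: "0 \<le> l" "ennreal l * t + (\<integral>\<^sup>+x. ennreal (v x - l) \<partial>M) \<le> W w t" by (rule V_D[OF v t])
  have "(\<integral>\<^sup>+x. ennreal (enn2real (R v x) - l) \<partial>M) = (\<integral>\<^sup>+x. R v x - ennreal l \<partial>M)"
    using R_finite_V[OF v] l by (intro nn_integral_cong) (simp add: ennreal_minus[symmetric])
  also have "\<dots> = (\<integral>\<^sup>+x. ennreal (v x - l) \<partial>M)"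
    unfolding nn_integral_R_minus[OF vm l(1)] using V_nonneg[OF v] by (intro nn_integral_cong) simp
  finally show "\<exists>l\<ge>0. ennreal l * t + (\<integral>\<^sup>+x. ennreal (enn2real (R v x) - l) \<partial>M) \<le> W w t" using l by auto
qed simp

end

section \<open>Rearrangement invariance\<close>

lemma powr_interval_iff:
  fixes r y :: real and k :: int
  assumes r: "1 < r" and y: "0 < y"
  shows "r powr k < y \<and> y \<le> r powr (k + 1) \<longleftrightarrow> k = \<lceil>log r y\<rceil> - 1"
proof -
  have "r powr k < y \<longleftrightarrow> real_of_int k < log r y" using r y by (simp add: less_log_iff)
  moreover have "y \<le> r powr (k + 1) \<longleftrightarrow> log r y \<le> real_of_int k + 1" using r y by (simp add: log_le_iff)
  ultimately show ?thesis by linarith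
qed

context weighted_space
begin

text \<open>After scaling by a small c the norm is below the threshold of \<open>rho_small\<close>
  for level 1, and level 1 of \<open>c * f\<close> is level \<open>1 / c\<close> of f.\<close>

lemma distribution_small:
  assumes f: "f \<in> E" and d: "0 < d"
  shows "\<exists>s\<ge>0. distribution_fun M f s \<le> ennreal d"
proof -
  have fm: "f \<in> borel_measurable M" using f by simp
  obtain e where e: "0 < e" "\<And>f. f \<in> borel_measurable M \<Longrightarrow> luxemburg P f < ennreal e \<Longrightarrow>
      distribution_fun M f 1 \<le> ennreal d"
    using rho_small[of 1 d] d by auto
  define b where "b = enn2real (luxemburg P f)"
  define c where "c = e / (b + 1) / 2"
  have b: "0 \<le> b" "luxemburg P f = ennreal b" using f by (auto simp: b_def)
  have c: "0 < c" using e b by (simp add: c_def)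
  have "luxemburg P (\<lambda>x. c * f x) = ennreal (c * b)"
    using rho_scale[OF fm, of c] c b by (simp add: ennreal_mult)
  also have "\<dots> < ennreal e"
  proof (rule ennreal_lessI[OF e(1)])
    have "c * b \<le> c * (b + 1)" using c by simp
    also have "c * (b + 1) = e / 2" using b by (simp add: c_def field_simps)
    also have "\<dots> < e" using e by simp
    finally show "c * b < e" .
  qed
  finally have "distribution_fun M (\<lambda>x. c * f x) 1 \<le> ennreal d" using e(2) fm by simp
  moreover have "distribution_fun M (\<lambda>x. c * f x) 1 = distribution_fun M f (1 / c)"
    unfolding distribution_fun_def using c by (simp add: abs_mult divide_less_eq mult.commute)
  ultimately show ?thesis using c by (intro exI[of _ "1 / c"]) auto
qed

lemma R_finite_E: "f \<in> E \<Longrightarrow> x \<in> space M \<Longrightarrow> R f x < \<infinity>"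
  using distribution_small by (intro R_finite) auto

lemma P_R_le:
  assumes f: "f \<in> E" and P: "P f \<le> 1" and c: "0 < c" "c < 1"
  shows "P (\<lambda>x. c * enn2real (R f x)) \<le> 1"
proof (rule ennreal_le_epsilon)
  fix e :: real assume e: "0 < e"
  have fm[measurable]: "f \<in> borel_measurable M" using f by simp
  have "1 < 1 + ennreal e" using e by (metis ennreal_1 ennreal_less_iff ennreal_plus less_add_same_cancel1 less_imp_le zero_le_one)
  then obtain v where v: "v \<in> V" "J f v < 1 + ennreal e"
    using P_less[of f "1 + ennreal e"] P le_less_trans by blast
  note vm[measurable] = V_measurable[OF v(1)]
  define f' where "f' x = enn2real (R f x)" for x
  define v' where "v' x = enn2real (R v x)" for x
  have [measurable]: "f' \<in> borel_measurable M" "v' \<in> borel_measurable M"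
    unfolding f'_def v'_def by measurable
  have f'0: "0 \<le> f' x" and v'0: "0 \<le> v' x" for x by (auto simp: f'_def v'_def)
  \<comment> \<open>The rearranged competitor, mixed with w so that it is positive and the hinge
    terms converge to \<open>\<Phi>\<close>.\<close>
  define u where "u x = c * v' x + (1 - c) * w x" for x
  have uV: "u \<in> V" unfolding u_def v'_def by (intro V_convex R_mem_V v w_mem c)
  note [measurable] = V_measurable[OF uV]
  have upos: "0 < u x" if "x \<in> space M" for x
    unfolding u_def using c v'0[of x] w_pos[OF that] by (intro add_nonneg_pos) auto
  have bound: "(\<integral>\<^sup>+x. hinge_term n (c * f' x) (u x) \<partial>M) \<le> J f v" for n
  proof -
    have "(\<integral>\<^sup>+x. hinge_term n (c * f' x) (u x) \<partial>M) \<le> (\<integral>\<^sup>+x. hinge_term n (f' x) (v' x) \<partial>M)"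
    proof (intro nn_integral_mono hinge_term_mono)
      fix x and b :: real assume x: "x \<in> space M" and b: "0 < b"
      have "c * f' x - b * u x \<le> c * (f' x - b * v' x)"
        using c b w_pos[OF x] by (simp add: u_def algebra_simps)
      also have "\<dots> \<le> c * max 0 (f' x - b * v' x)" using c by (intro mult_left_mono) auto
      also have "\<dots> \<le> 1 * max 0 (f' x - b * v' x)" using c by (intro mult_right_mono) auto
      finally show "c * f' x - b * u x \<le> max 0 (f' x - b * v' x)" by simp
    qed
    also have "\<dots> = (\<Sum>k<knots n. ennreal (hinge_coeff (step n) k) *
        (\<integral>\<^sup>+x. ennreal (f' x - real (Suc k) * step n * v' x) \<partial>M))"
      by (rule nn_integral_hinge_term) auto
    also have "\<dots> \<le> (\<Sum>k<knots n. ennreal (hinge_coeff (step n) k) *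
        (\<integral>\<^sup>+x. ennreal (\<bar>f x\<bar> - real (Suc k) * step n * v x) \<partial>M))"
    proof (intro sum_mono mult_left_mono)
      fix k
      let ?s = "real (Suc k) * step n"
      have s: "0 < ?s" using step_pos[of n] by simp
      have "(\<integral>\<^sup>+x. ennreal (f' x - ?s * v' x) \<partial>M) = (\<integral>\<^sup>+x. R f x - ennreal (?s * enn2real (R v x)) \<partial>M)"
      proof (rule nn_integral_cong)
        fix x assume x: "x \<in> space M"
        have "R f x = ennreal (f' x)" using R_finite_E[OF f x] by (simp add: f'_def)
        then show "ennreal (f' x - ?s * v' x) = R f x - ennreal (?s * enn2real (R v x))"
          using s by (simp add: v'_def ennreal_minus)
      qed
      also have "\<dots> \<le> (\<integral>\<^sup>+x. ennreal (\<bar>f x\<bar> - ?s * v x) \<partial>M)"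
        using V_nonneg[OF v(1)] R_finite_V[OF v(1)] s by (intro nn_integral_hinge) auto
      finally show "(\<integral>\<^sup>+x. ennreal (f' x - ?s * v' x) \<partial>M) \<le> (\<integral>\<^sup>+x. ennreal (\<bar>f x\<bar> - ?s * v x) \<partial>M)" .
    qed simp
    also have "\<dots> = (\<integral>\<^sup>+x. hinge_term n \<bar>f x\<bar> (v x) \<partial>M)"
      by (rule nn_integral_hinge_term[symmetric]) auto
    also have "\<dots> \<le> J f v"
      unfolding J_def
    proof (rule nn_integral_mono)
      fix x assume "x \<in> space M"
      then show "hinge_term n \<bar>f x\<bar> (v x) \<le> \<Phi> (f x) (v x)"
        using hinge_term_le_Phi[of "v x" "\<bar>f x\<bar>" n] V_nonneg[OF v(1)] by simp
    qed
    finally show ?thesis .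
  qed
  \<comment> \<open>The bound is uniform in n, so Fatou's lemma carries it to the pointwise limit of
    the hinge terms.\<close>
  have "P (\<lambda>x. c * f' x) \<le> J (\<lambda>x. c * f' x) u" by (rule P_le[OF uV])
  also have "\<dots> = (\<integral>\<^sup>+x. liminf (\<lambda>n. hinge_term n (c * f' x) (u x)) \<partial>M)"
    unfolding J_def
  proof (rule nn_integral_cong)
    fix x assume x: "x \<in> space M"
    have "(\<lambda>n. hinge_term n (c * f' x) (u x)) \<longlonglongrightarrow> \<Phi> (c * f' x) (u x)"
      using upos[OF x] c f'0[of x] by (intro hinge_term_tendsto) auto
    then show "\<Phi> (c * f' x) (u x) = liminf (\<lambda>n. hinge_term n (c * f' x) (u x))"
      by (intro lim_imp_Liminf[symmetric]) auto
  qed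
  also have "\<dots> \<le> liminf (\<lambda>n. \<integral>\<^sup>+x. hinge_term n (c * f' x) (u x) \<partial>M)"
    by (rule nn_integral_liminf) measurable
  also have "\<dots> \<le> limsup (\<lambda>n. \<integral>\<^sup>+x. hinge_term n (c * f' x) (u x) \<partial>M)"
    by (intro Liminf_le_Limsup) simp
  also have "\<dots> \<le> J f v" using bound by (intro Limsup_bounded) auto
  also have "\<dots> \<le> 1 + ennreal e" using v by simp
  finally show "P (\<lambda>x. c * enn2real (R f x)) \<le> 1 + ennreal e" by (simp add: f'_def)
qed

lemma luxemburg_R_le:
  assumes f: "f \<in> E" shows "luxemburg P (\<lambda>x. enn2real (R f x)) \<le> luxemburg P f"
proof (rule ennreal_le_mult_one_interval)
  fix c :: real assume c: "0 < c" "c < 1"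
  have [measurable]: "f \<in> borel_measurable M" using f by simp
  have "luxemburg P (\<lambda>x. c * enn2real (R f x)) \<le> luxemburg P f"
    unfolding luxemburg_def[of P f]
  proof (rule Inf_greatest, clarify)
    fix k :: real assume k: "0 < k" "P (\<lambda>x. f x / k) \<le> 1"
    have "(\<lambda>x. (1 / k) * f x) \<in> E" by (rule scale_mem[OF f])
    then have "P (\<lambda>x. c * enn2real (R (\<lambda>x. (1 / k) * f x) x)) \<le> 1"
      using k c by (intro P_R_le) auto
    then have "P (\<lambda>x. c * enn2real (R f x) / k) \<le> 1"
      using k R_cmult[of f "1 / k"] by (simp add: enn2real_mult)
    then show "luxemburg P (\<lambda>x. c * enn2real (R f x)) \<le> ennreal k" using k by (intro luxemburg_le) auto
  qed
  then show "ennreal c * luxemburg P (\<lambda>x. enn2real (R f x)) \<le> luxemburg P f"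
    using rho_scale[of "\<lambda>x. enn2real (R f x)" c] c by simp
qed

text \<open>v is at most l plus its excess over l, both integrable on A. This makes the band
  averages in \<open>P_le_P_R\<close> finite.\<close>

lemma nn_integral_V_finite:
  assumes v: "v \<in> V" and A[measurable]: "A \<in> sets M" and fin: "emeasure M A < \<infinity>"
  shows "(\<integral>\<^sup>+x\<in>A. ennreal (v x) \<partial>M) < \<infinity>"
proof -
  note [measurable] = V_measurable[OF v]
  obtain t where t: "t \<in> T" "W w t < \<infinity>" using W_finite by blast
  obtain l where l: "0 \<le> l" "ennreal l * t + (\<integral>\<^sup>+x. ennreal (v x - l) \<partial>M) \<le> W w t" by (rule V_D[OF v t])
  have "(\<integral>\<^sup>+x\<in>A. ennreal (v x) \<partial>M) \<le> (\<integral>\<^sup>+x. ennreal l * indicator A x + ennreal (v x - l) \<partial>M)"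
  proof (rule nn_integral_mono)
    fix x
    have "ennreal (v x) \<le> ennreal (l + max 0 (v x - l))" by (intro ennreal_leI) simp
    then show "ennreal (v x) * indicator A x \<le> ennreal l * indicator A x + ennreal (v x - l)"
      using l by (simp add: ennreal_max_0 indicator_def)
  qed
  also have "\<dots> = ennreal l * emeasure M A + (\<integral>\<^sup>+x. ennreal (v x - l) \<partial>M)"
    by (simp add: nn_integral_add nn_integral_cmult_indicator)
  also have "\<dots> < \<infinity>"
  proof -
    have "(\<integral>\<^sup>+x. ennreal (v x - l) \<partial>M) \<le> W w t"
      using l(2) by (auto intro: order_trans[rotated] add_increasing)
    then show ?thesis using t(2) fin by (auto simp: ennreal_mult_less_top intro: le_less_trans)
  qed
  finally show ?thesis .
qed

text \<open>On the set where \<open>\<bar>f\<bar>\<close> lies in a band between consecutive powers of \<open>r\<close> the competitor for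
  \<open>f\<close> is the average of the competitor \<open>v\<close> for the rearrangement over the corresponding band.\<close>

lemma P_le_P_R:
  assumes f: "f \<in> E" and c: "0 < c" "c < 1"
  shows "P (\<lambda>x. c * f x) \<le> P (\<lambda>x. enn2real (R f x))"
  unfolding P_def[of "\<lambda>x. enn2real (R f x)"]
proof (rule INF_greatest)
  fix v assume v: "v \<in> V"
  note vm[measurable] = V_measurable[OF v]
  have fm[measurable]: "f \<in> borel_measurable M" using f by simp
  \<comment> \<open>With this ratio \<open>c * q (k + 1) = q k\<close>, so multiplication by c
    brings every value in a band below its lower edge.\<close>
  define r where "r = 1 / c"
  have r: "1 < r" using c by (simp add: r_def)
  define q where "q k = r powr real_of_int k" for k :: int
  have q: "0 < q k" for k using r by (simp add: q_def)
  have cq: "c * q (k + 1) = q k" for k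
  proof -
    have "q (k + 1) = q k * r" using r by (simp add: q_def powr_add)
    then show ?thesis using c by (simp add: r_def)
  qed
  have qmono: "q k \<le> q (k + 1)" for k using r by (simp add: q_def)
  define \<kappa> where "\<kappa> y = \<lceil>log r y\<rceil> - 1" for y
  have kappa: "q k < y \<and> y \<le> q (k + 1) \<longleftrightarrow> 0 < y \<and> k = \<kappa> y" for k y
  proof (cases "0 < y")
    case True
    then show ?thesis using powr_interval_iff[OF r, of y k] by (simp add: q_def \<kappa>_def)
  next
    case False
    then show ?thesis using q[of k] by linarith
  qed
  have band: "q (\<kappa> y) < y \<and> y \<le> q (\<kappa> y + 1)" if "0 < y" for y using kappa[of "\<kappa> y" y] that by simp
  define f' where "f' x = enn2real (R f x)" for x
  have f'[measurable]: "f' \<in> borel_measurable M" unfolding f'_def by measurable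
  define A where "A k = {x \<in> space M. q k < \<bar>f x\<bar> \<and> \<bar>f x\<bar> \<le> q (k + 1)}" for k
  define B where "B k = {x \<in> space M. q k < f' x \<and> f' x \<le> q (k + 1)}" for k
  have [measurable]: "A k \<in> sets M" "B k \<in> sets M" for k unfolding A_def B_def by measurable
  \<comment> \<open>Each band is a difference of nested level sets, and f and its rearrangement are
    equimeasurable; finiteness of the smaller set permits the subtraction.\<close>
  have A: "emeasure M (A k) = distribution_fun M f (q k) - distribution_fun M f (q (k + 1))"
    and B: "emeasure M (B k) = distribution_fun M f (q k) - distribution_fun M f (q (k + 1))" for k
  proof -
    have fin: "distribution_fun M f (q (k + 1)) \<noteq> \<infinity>" using distribution_finite[OF f q] by (metis less_irrefl)
    have diff: "emeasure M ({x \<in> space M. q k < g x} - {x \<in> space M. q (k + 1) < g x})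
        = emeasure M {x \<in> space M. q k < g x} - emeasure M {x \<in> space M. q (k + 1) < g x}"
      if [measurable]: "g \<in> borel_measurable M" and "emeasure M {x \<in> space M. q (k + 1) < g x} \<noteq> \<infinity>"
      for g :: "'a \<Rightarrow> real"
    proof (rule emeasure_Diff)
      show "{x \<in> space M. q (k + 1) < g x} \<subseteq> {x \<in> space M. q k < g x}"
        using qmono[of k] by (auto intro: le_less_trans)
    qed (use that in auto)
    have "A k = {x \<in> space M. q k < \<bar>f x\<bar>} - {x \<in> space M. q (k + 1) < \<bar>f x\<bar>}"
      unfolding A_def by auto
    then show "emeasure M (A k) = distribution_fun M f (q k) - distribution_fun M f (q (k + 1))"
      using diff[of "\<lambda>x. \<bar>f x\<bar>"] fin unfolding distribution_fun_def by simp
    have R: "ennreal (q j) < R f x \<longleftrightarrow> q j < f' x" if "x \<in> space M" for x j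
    proof -
      have "R f x = ennreal (f' x)" using R_finite_E[OF f that] by (simp add: f'_def)
      then show ?thesis using q[of j] by (simp add: ennreal_less_iff)
    qed
    have D: "emeasure M {x \<in> space M. q j < f' x} = distribution_fun M f (q j)" for j
    proof -
      have "{x \<in> space M. q j < f' x} = {x \<in> space M. ennreal (q j) < R f x}" using R by auto
      then show ?thesis using emeasure_R_greater[OF fm, of "q j"] q[of j] by simp
    qed
    have "B k = {x \<in> space M. q k < f' x} - {x \<in> space M. q (k + 1) < f' x}"
      unfolding B_def by auto
    then show "emeasure M (B k) = distribution_fun M f (q k) - distribution_fun M f (q (k + 1))"
      using diff[OF f'] fin by (simp add: D)
  qed
  have AB: "emeasure M (A k) = emeasure M (B k)" for k by (simp only: A B)
  have finB: "emeasure M (B k) < \<infinity>" for k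
    unfolding B using distribution_finite[OF f q, of k] by (rule le_less_trans[OF diff_le_self_ennreal])
  \<comment> \<open>For a null band the quotient is 0 by convention, which still satisfies
    \<open>avg\<close>.\<close>
  define m where "m k = enn2real (\<integral>\<^sup>+x\<in>B k. ennreal (v x) \<partial>M) / measure M (B k)" for k
  have m0: "0 \<le> m k" for k by (simp add: m_def)
  have avg: "(\<integral>\<^sup>+x\<in>B k. ennreal (v x) \<partial>M) = ennreal (m k) * emeasure M (B k)" for k
  proof (cases "emeasure M (B k) = 0")
    case True
    then have "B k \<in> null_sets M" by auto
    then show ?thesis using True by (simp add: nn_integral_null_set)
  next
    case False
    have e: "emeasure M (B k) = ennreal (measure M (B k))"
      using finB[of k] by (intro emeasure_eq_ennreal_measure) auto
    with False have pos: "0 < measure M (B k)" by (simp add: zero_less_measure_iff)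
    show ?thesis
      unfolding e m_def using pos nn_integral_V_finite[OF v _ finB[of k]]
      by (simp add: ennreal_mult[symmetric])
  qed
  define u where "u x = (if f x = 0 then 0 else m (\<kappa> \<bar>f x\<bar>))" for x
  have [measurable]: "(\<lambda>x. \<kappa> \<bar>f x\<bar>) \<in> measurable M (count_space UNIV)" unfolding \<kappa>_def by measurable
  have um[measurable]: "u \<in> borel_measurable M" unfolding u_def by measurable
  have sumA: "(\<integral>\<^sup>+x. (if f x = 0 then 0 else h (\<kappa> \<bar>f x\<bar>)) \<partial>M) = (\<integral>\<^sup>+k. h k * emeasure M (A k) \<partial>count_space UNIV)"
    for h :: "int \<Rightarrow> ennreal"
  proof -
    have "(\<integral>\<^sup>+x. (if f x = 0 then 0 else h (\<kappa> \<bar>f x\<bar>)) \<partial>M)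
        = (\<integral>\<^sup>+x. (\<integral>\<^sup>+k. h k * indicator (A k) x \<partial>count_space UNIV) \<partial>M)"
    proof (rule nn_integral_cong)
      fix x assume x: "x \<in> space M"
      have "indicator (A k) x = (if f x = 0 then 0 else indicator {\<kappa> \<bar>f x\<bar>} k :: ennreal)" for k
        using kappa[of k "\<bar>f x\<bar>"] x unfolding A_def by (auto simp: indicator_def)
      then show "(if f x = 0 then 0 else h (\<kappa> \<bar>f x\<bar>)) = (\<integral>\<^sup>+k. h k * indicator (A k) x \<partial>count_space UNIV)"
        by simp
    qed
    also have "\<dots> = (\<integral>\<^sup>+k. (\<integral>\<^sup>+x. h k * indicator (A k) x \<partial>M) \<partial>count_space UNIV)"
      by (rule nn_integral_count_space_nn_integral) auto
    finally show ?thesis by (simp add: nn_integral_cmult_indicator)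
  qed
  \<comment> \<open>The bands are disjoint; only an inequality holds, as points with
    \<open>f' x = 0\<close> lie in no band.\<close>
  have sumB: "(\<integral>\<^sup>+k. (\<integral>\<^sup>+x\<in>B k. h x \<partial>M) \<partial>count_space UNIV) \<le> (\<integral>\<^sup>+x. h x \<partial>M)"
    if [measurable]: "h \<in> borel_measurable M" for h :: "'a \<Rightarrow> ennreal"
  proof -
    have "(\<integral>\<^sup>+k. (\<integral>\<^sup>+x\<in>B k. h x \<partial>M) \<partial>count_space UNIV)
        = (\<integral>\<^sup>+x. (\<integral>\<^sup>+k. h x * indicator (B k) x \<partial>count_space UNIV) \<partial>M)"
      by (rule nn_integral_count_space_nn_integral[symmetric]) auto
    also have "\<dots> \<le> (\<integral>\<^sup>+x. h x \<partial>M)"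
    proof (rule nn_integral_mono)
      fix x assume x: "x \<in> space M"
      have "(\<integral>\<^sup>+k. h x * indicator (B k) x \<partial>count_space UNIV)
          \<le> (\<integral>\<^sup>+k. h x * indicator {\<kappa> (f' x)} k \<partial>count_space UNIV)"
        using kappa[of _ "f' x"] unfolding B_def by (intro nn_integral_mono) (auto simp: indicator_def)
      then show "(\<integral>\<^sup>+k. h x * indicator (B k) x \<partial>count_space UNIV) \<le> h x" by simp
    qed
    finally show ?thesis .
  qed
  have uV: "u \<in> V"
    unfolding mem_V_iff
  proof (intro conjI ballI impI um)
    show "0 \<le> u x" for x by (simp add: u_def m0)
    fix t assume t: "t \<in> T" "W w t < \<infinity>"
    obtain l where l: "0 \<le> l" "ennreal l * t + (\<integral>\<^sup>+x. ennreal (v x - l) \<partial>M) \<le> W w t" by (rule V_D[OF v t])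
    \<comment> \<open>Jensen's inequality for the excess over l: averaging on bands does not
      increase the integral in \<open>mem_V_iff\<close>, so the level l of v serves for u
      too.\<close>
    have "ennreal (m k - l) * emeasure M (B k) \<le> (\<integral>\<^sup>+x\<in>B k. ennreal (v x - l) \<partial>M)" for k
    proof (cases "l \<le> m k")
      case True
      have "ennreal (m k - l) * emeasure M (B k) + ennreal l * emeasure M (B k) = ennreal (m k) * emeasure M (B k)"
        using True l by (simp add: distrib_right[symmetric] ennreal_plus[symmetric] del: ennreal_plus)
      also have "\<dots> = (\<integral>\<^sup>+x\<in>B k. ennreal (v x) \<partial>M)" by (simp add: avg)
      also have "\<dots> \<le> (\<integral>\<^sup>+x. ennreal l * indicator (B k) x + ennreal (v x - l) * indicator (B k) x \<partial>M)"
      proof (rule nn_integral_mono)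
        fix x
        have "ennreal (v x) \<le> ennreal (l + max 0 (v x - l))" by (intro ennreal_leI) simp
        then show "ennreal (v x) * indicator (B k) x
            \<le> ennreal l * indicator (B k) x + ennreal (v x - l) * indicator (B k) x"
          using l by (simp add: ennreal_max_0 indicator_def)
      qed
      also have "\<dots> = ennreal l * emeasure M (B k) + (\<integral>\<^sup>+x\<in>B k. ennreal (v x - l) \<partial>M)"
        by (simp add: nn_integral_add nn_integral_cmult_indicator)
      finally have "ennreal l * emeasure M (B k) + ennreal (m k - l) * emeasure M (B k)
          \<le> ennreal l * emeasure M (B k) + (\<integral>\<^sup>+x\<in>B k. ennreal (v x - l) \<partial>M)"
        by (simp add: add.commute)
      then show ?thesis using finB[of k] by (auto simp: ennreal_add_left_cancel_le ennreal_mult_eq_top_iff)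
    qed (simp add: ennreal_neg)
    then have "(\<integral>\<^sup>+k. ennreal (m k - l) * emeasure M (A k) \<partial>count_space UNIV)
        \<le> (\<integral>\<^sup>+k. (\<integral>\<^sup>+x\<in>B k. ennreal (v x - l) \<partial>M) \<partial>count_space UNIV)"
      unfolding AB by (intro nn_integral_mono)
    also have "\<dots> \<le> (\<integral>\<^sup>+x. ennreal (v x - l) \<partial>M)" by (rule sumB) measurable
    finally have "(\<integral>\<^sup>+x. (if f x = 0 then 0 else ennreal (m (\<kappa> \<bar>f x\<bar>) - l)) \<partial>M) \<le> (\<integral>\<^sup>+x. ennreal (v x - l) \<partial>M)"
      by (simp only: sumA[of "\<lambda>k. ennreal (m k - l)"])
    moreover have "(\<integral>\<^sup>+x. ennreal (u x - l) \<partial>M) = (\<integral>\<^sup>+x. (if f x = 0 then 0 else ennreal (m (\<kappa> \<bar>f x\<bar>) - l)) \<partial>M)"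
      using l by (intro nn_integral_cong) (simp add: u_def ennreal_neg)
    ultimately have "ennreal l * t + (\<integral>\<^sup>+x. ennreal (u x - l) \<partial>M) \<le> W w t"
      using l(2) by (metis add_left_mono order_trans)
    then show "\<exists>l\<ge>0. ennreal l * t + (\<integral>\<^sup>+x. ennreal (u x - l) \<partial>M) \<le> W w t" using l by blast
  qed
  have "P (\<lambda>x. c * f x) \<le> J (\<lambda>x. c * f x) u" by (rule P_le[OF uV])
  also have "\<dots> \<le> (\<integral>\<^sup>+x. (if f x = 0 then 0 else \<Phi> (q (\<kappa> \<bar>f x\<bar>)) (m (\<kappa> \<bar>f x\<bar>))) \<partial>M)"
    unfolding J_def
  proof (rule nn_integral_mono)
    fix x
    show "\<Phi> (c * f x) (u x) \<le> (if f x = 0 then 0 else \<Phi> (q (\<kappa> \<bar>f x\<bar>)) (m (\<kappa> \<bar>f x\<bar>)))"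
    proof (cases "f x = 0")
      case False
      have "\<bar>c * f x\<bar> = c * \<bar>f x\<bar>" using c by (simp add: abs_mult)
      also have "\<dots> \<le> c * q (\<kappa> \<bar>f x\<bar> + 1)" using c band[of "\<bar>f x\<bar>"] False by (intro mult_left_mono) auto
      also have "\<dots> = \<bar>q (\<kappa> \<bar>f x\<bar>)\<bar>" using cq q[of "\<kappa> \<bar>f x\<bar>"] by simp
      finally show ?thesis using False m0 by (simp add: u_def Phi_mono)
    qed simp
  qed
  also have "\<dots> = (\<integral>\<^sup>+k. \<Phi> (q k) (m k) * emeasure M (B k) \<partial>count_space UNIV)"
    by (simp only: sumA[of "\<lambda>k. \<Phi> (q k) (m k)"] AB)
  also have "\<dots> \<le> (\<integral>\<^sup>+k. (\<integral>\<^sup>+x\<in>B k. \<Phi> (q k) (v x) \<partial>M) \<partial>count_space UNIV)"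
    by (intro nn_integral_mono Phi_average_le) (use V_nonneg[OF v] finB q m0 avg in auto)
  also have "\<dots> \<le> (\<integral>\<^sup>+k. (\<integral>\<^sup>+x\<in>B k. \<Phi> (f' x) (v x) \<partial>M) \<partial>count_space UNIV)"
  proof (intro nn_integral_mono)
    fix k x assume x: "x \<in> space M"
    show "\<Phi> (q k) (v x) * indicator (B k) x \<le> \<Phi> (f' x) (v x) * indicator (B k) x"
      using q[of k] V_nonneg[OF v x] by (auto simp: indicator_def B_def intro!: Phi_mono)
  qed
  also have "\<dots> \<le> J f' v"
    unfolding J_def by (intro sumB J_measurable f' v)
  finally show "P (\<lambda>x. c * f x) \<le> J (\<lambda>x. enn2real (R f x)) v" by (simp add: f'_def[abs_def])
qed

lemma luxemburg_le_R:
  assumes f: "f \<in> E" shows "luxemburg P f \<le> luxemburg P (\<lambda>x. enn2real (R f x))"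
proof (rule ennreal_le_mult_one_interval)
  fix c :: real assume c: "0 < c" "c < 1"
  have fm[measurable]: "f \<in> borel_measurable M" using f by simp
  have "luxemburg P (\<lambda>x. c * f x) \<le> luxemburg P (\<lambda>x. enn2real (R f x))"
    unfolding luxemburg_def[of P "\<lambda>x. enn2real (R f x)"]
  proof (rule Inf_greatest, clarify)
    fix k :: real assume k: "0 < k" "P (\<lambda>x. enn2real (R f x) / k) \<le> 1"
    have "(\<lambda>x. (1 / k) * f x) \<in> E" by (rule scale_mem[OF f])
    then have "P (\<lambda>x. c * ((1 / k) * f x)) \<le> P (\<lambda>x. enn2real (R (\<lambda>x. (1 / k) * f x) x))"
      using c by (intro P_le_P_R)
    also have "\<dots> \<le> 1" using k R_cmult[of f "1 / k"] by (simp add: enn2real_mult)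
    finally show "luxemburg P (\<lambda>x. c * f x) \<le> ennreal k" using k by (intro luxemburg_le) auto
  qed
  then show "ennreal c * luxemburg P f \<le> luxemburg P (\<lambda>x. enn2real (R f x))"
    using rho_scale[OF fm, of c] c by simp
qed

theorem rearrangement_invariant: "rearrangement_invariant M R E (\<lambda>f. enn2real (luxemburg P f))"
  unfolding rearrangement_invariant_def
proof (intro ballI conjI)
  fix f assume f: "f \<in> E"
  have [measurable]: "f \<in> borel_measurable M" using f by simp
  have eq: "luxemburg P (\<lambda>x. enn2real (R f x)) = luxemburg P f"
    using luxemburg_R_le[OF f] luxemburg_le_R[OF f] by (rule antisym)
  show "R f x < \<infinity>" if "x \<in> space M" for x using R_finite_E[OF f that] .
  show "(\<lambda>x. enn2real (R f x)) \<in> E" using f eq by simp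
  show "enn2real (luxemburg P f) = enn2real (luxemburg P (\<lambda>x. enn2real (R f x)))" using eq by simp
qed

end

section \<open>Non-integrable weights and the two concrete spaces\<close>

context orlicz
begin

lemma phi_ratio_mono: "0 < u \<Longrightarrow> u \<le> v \<Longrightarrow> \<phi> u / u \<le> \<phi> v / v"
  using phi_convex[of v 0 "u / v" "1 - u / v"] by (simp add: field_simps)

text \<open>The ratio is increasing, so a zero infimum would be its limit at 0.\<close>

lemma phi_ratio_bound_pos:
  assumes "\<not> ((\<lambda>u. \<phi> u / u) \<longlongrightarrow> 0) (at_right 0)"
  shows "0 < (INF u\<in>{0<..}. \<phi> u / u)"
proof (rule ccontr)
  have nn: "0 \<le> (INF u\<in>{0<..}. \<phi> u / u)" by (intro cINF_greatest) auto
  assume "\<not> 0 < (INF u\<in>{0<..}. \<phi> u / u)"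
  then have 0: "(INF u\<in>{0<..}. \<phi> u / u) = 0" using nn by simp
  have "((\<lambda>u. \<phi> u / u) \<longlongrightarrow> 0) (at_right 0)"
  proof (rule order_tendstoI)
    fix e :: real assume "e < 0"
    have "\<forall>\<^sub>F u in at_right 0. 0 < (u::real)" by (rule eventually_at_right_less)
    then show "\<forall>\<^sub>F u in at_right 0. e < \<phi> u / u"
    proof eventually_elim
      case (elim u)
      then have "0 \<le> \<phi> u / u" by simp
      then show ?case using \<open>e < 0\<close> by linarith
    qed
  next
    fix e :: real assume "0 < e"
    then obtain v where v: "0 < v" "\<phi> v / v < e"
      using cInf_lessD[of "(\<lambda>u. \<phi> u / u) ` {0<..}" e] 0 by auto
    have "\<forall>\<^sub>F u in at_right 0. u \<in> {0<..<v}" using v by (intro eventually_at_right_real)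
    then show "\<forall>\<^sub>F u in at_right 0. \<phi> u / u < e"
    proof eventually_elim
      case (elim u)
      then show ?case using phi_ratio_mono[of u v] v by simp
    qed
  qed
  with assms show False by contradiction
qed

text \<open>For y \<noteq> 0, \<open>\<Phi> y v\<close> is \<open>\<bar>y\<bar>\<close> times
  \<open>\<phi> u / u\<close> with \<open>u = \<bar>y\<bar> / v\<close>. One nearly optimal u, used
  at all points through \<open>v = \<bar>g\<bar> / u\<close>, shows that the modular is c times the
  integral of \<open>\<bar>g\<bar>\<close>; being homogeneous, it equals its Luxemburg
  functional.\<close>

lemma luxemburg_unrestricted:
  fixes f :: "'a \<Rightarrow> real"
  assumes f[measurable]: "f \<in> borel_measurable M"
    and P: "\<And>g. g \<in> borel_measurable M \<Longrightarrow>
      P g = (INF v\<in>{v \<in> borel_measurable M. \<forall>x\<in>space M. 0 \<le> v x}. \<integral>\<^sup>+x. \<Phi> (g x) (v x) \<partial>M)"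
    and c: "c = (INF u\<in>{0<..}. \<phi> u / u)" "0 < c"
  shows "luxemburg P f = ennreal c * (\<integral>\<^sup>+x. ennreal \<bar>f x\<bar> \<partial>M)"
proof -
  have bdd: "bdd_below ((\<lambda>u. \<phi> u / u) ` {0<..})" by (intro bdd_belowI[of _ 0]) auto
  have c_le: "c \<le> \<phi> u / u" if "0 < u" for u unfolding c(1) using that by (intro cINF_lower bdd) simp
  have Phi_ge: "ennreal c * ennreal \<bar>y\<bar> \<le> \<Phi> y v" if "0 \<le> v" for y v
  proof (cases "v = 0 \<or> y = 0")
    case False
    then have v: "0 < v" "0 < \<bar>y\<bar> / v" using that by auto
    have "c * \<bar>y\<bar> \<le> (\<phi> (\<bar>y\<bar> / v) / (\<bar>y\<bar> / v)) * \<bar>y\<bar>" using c_le[OF v(2)] by (intro mult_right_mono) auto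
    also have "\<dots> = \<phi> \<bar>y / v\<bar> * v" using v False by simp
    finally show ?thesis using v c by (simp add: Phi_pos ennreal_mult[symmetric] ennreal_leI)
  qed (auto simp: orlicz_term_def)
  have P_eq: "P g = ennreal c * (\<integral>\<^sup>+x. ennreal \<bar>g x\<bar> \<partial>M)" if g[measurable]: "g \<in> borel_measurable M" for g
  proof (rule antisym)
    show "ennreal c * (\<integral>\<^sup>+x. ennreal \<bar>g x\<bar> \<partial>M) \<le> P g"
      unfolding P[OF g]
    proof (rule INF_greatest)
      fix v :: "'a \<Rightarrow> real"
      assume "v \<in> {v \<in> borel_measurable M. \<forall>x\<in>space M. 0 \<le> v x}"
      then have "(\<integral>\<^sup>+x. ennreal c * ennreal \<bar>g x\<bar> \<partial>M) \<le> (\<integral>\<^sup>+x. \<Phi> (g x) (v x) \<partial>M)"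
        by (intro nn_integral_mono Phi_ge) auto
      then show "ennreal c * (\<integral>\<^sup>+x. ennreal \<bar>g x\<bar> \<partial>M) \<le> (\<integral>\<^sup>+x. \<Phi> (g x) (v x) \<partial>M)"
        by (simp add: nn_integral_cmult)
    qed
    show "P g \<le> ennreal c * (\<integral>\<^sup>+x. ennreal \<bar>g x\<bar> \<partial>M)"
    proof (cases "\<integral>\<^sup>+x. ennreal \<bar>g x\<bar> \<partial>M")
      case top
      then show ?thesis using c by (simp add: ennreal_mult_top)
    next
      case (real I)
      show ?thesis
      proof (rule ennreal_le_epsilon)
        fix e :: real assume e: "0 < e"
        \<comment> \<open>The error is divided by \<open>I + 1\<close> so that, multiplied by I, it
          stays below e.\<close>
        obtain u where u: "0 < u" "\<phi> u / u < c + e / (I + 1)"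
          using cInf_lessD[of "(\<lambda>u. \<phi> u / u) ` {0<..}" "c + e / (I + 1)"] c e real by auto
        have "P g \<le> (\<integral>\<^sup>+x. \<Phi> (g x) (\<bar>g x\<bar> / u) \<partial>M)"
          unfolding P[OF g] using u by (intro INF_lower) auto
        also have "\<dots> = (\<integral>\<^sup>+x. ennreal (\<phi> u / u) * ennreal \<bar>g x\<bar> \<partial>M)"
        proof (rule nn_integral_cong)
          fix x
          show "\<Phi> (g x) (\<bar>g x\<bar> / u) = ennreal (\<phi> u / u) * ennreal \<bar>g x\<bar>"
            using u by (cases "g x = 0") (auto simp: orlicz_term_def ennreal_mult[symmetric])
        qed
        also have "\<dots> = ennreal (\<phi> u / u) * ennreal I" by (simp add: nn_integral_cmult real)
        also have "\<dots> \<le> ennreal (c + e / (I + 1)) * ennreal I"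
          using u by (intro mult_right_mono ennreal_leI) auto
        also have "\<dots> = ennreal (c * I + e * (I / (I + 1)))"
          using c e real by (simp add: ennreal_mult[symmetric] distrib_right)
        also have "\<dots> \<le> ennreal (c * I + e * 1)"
          using e real by (intro ennreal_leI add_left_mono mult_left_mono) auto
        also have "\<dots> = ennreal c * ennreal I + ennreal e"
          using c e real by (simp add: ennreal_mult)
        finally show "P g \<le> ennreal c * (\<integral>\<^sup>+x. ennreal \<bar>g x\<bar> \<partial>M) + ennreal e" by (simp add: real)
      qed
    qed
  qed
  have P_div: "P (\<lambda>x. f x / k) = ennreal c * (\<integral>\<^sup>+x. ennreal \<bar>f x\<bar> \<partial>M) * ennreal (1 / k)" if k: "0 < k" for k
  proof -
    have "(\<integral>\<^sup>+x. ennreal \<bar>f x / k\<bar> \<partial>M) = (\<integral>\<^sup>+x. ennreal \<bar>f x\<bar> * ennreal (1 / k) \<partial>M)"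
      using k by (intro nn_integral_cong) (simp add: ennreal_mult[symmetric] abs_divide)
    then show ?thesis using P_eq[of "\<lambda>x. f x / k"] by (simp add: nn_integral_multc mult.assoc)
  qed
  show ?thesis
  proof (cases "ennreal c * (\<integral>\<^sup>+x. ennreal \<bar>f x\<bar> \<partial>M)")
    case (real b)
    have iff: "P (\<lambda>x. f x / k) \<le> 1 \<longleftrightarrow> b \<le> k" if "0 < k" for k
      using P_div[OF that] real that by (simp add: ennreal_mult[symmetric] divide_le_eq ennreal_1[symmetric] del: ennreal_1)
    have "luxemburg P f = ennreal b"
    proof (rule antisym)
      show "ennreal b \<le> luxemburg P f"
        unfolding luxemburg_def using iff by (intro Inf_greatest) (auto intro: ennreal_leI)
      show "luxemburg P f \<le> ennreal b"
      proof (rule ennreal_le_epsilon)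
        fix e :: real assume e: "0 < e"
        have "luxemburg P f \<le> ennreal (b + e)"
          unfolding luxemburg_def using iff[of "b + e"] e real by (intro Inf_lower image_eqI[where x = "b + e"]) auto
        then show "luxemburg P f \<le> ennreal b + ennreal e" using e real by simp
      qed
    qed
    then show ?thesis using real by simp
  next
    case top
    have "\<not> P (\<lambda>x. f x / k) \<le> 1" if "0 < k" for k
      using P_div[OF that] top that by (simp add: ennreal_top_mult top_unique)
    then have "luxemburg P f = top" unfolding luxemburg_def by auto
    then show ?thesis using top by simp
  qed
qed

end

section \<open>Multiples of the norm of L1\<close>

lemma fatou_norm_L1:
  assumes c: "0 < c"
    and rho: "\<And>f. f \<in> borel_measurable M \<Longrightarrow> \<rho> f = ennreal c * (\<integral>\<^sup>+x. ennreal \<bar>f x\<bar> \<partial>M)"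
  shows "fatou_norm M \<rho>"
proof
  show "\<rho> (\<lambda>_. 0) = 0" by (simp add: rho)
next
  fix f g :: "'a \<Rightarrow> real" assume [measurable]: "f \<in> borel_measurable M" "g \<in> borel_measurable M"
  have "(\<integral>\<^sup>+x. ennreal \<bar>f x + g x\<bar> \<partial>M) \<le> (\<integral>\<^sup>+x. ennreal \<bar>f x\<bar> + ennreal \<bar>g x\<bar> \<partial>M)"
    by (intro nn_integral_mono) (simp add: ennreal_plus[symmetric] ennreal_leI del: ennreal_plus)
  also have "\<dots> = (\<integral>\<^sup>+x. ennreal \<bar>f x\<bar> \<partial>M) + (\<integral>\<^sup>+x. ennreal \<bar>g x\<bar> \<partial>M)" by (simp add: nn_integral_add)
  finally have "ennreal c * (\<integral>\<^sup>+x. ennreal \<bar>f x + g x\<bar> \<partial>M)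
      \<le> ennreal c * ((\<integral>\<^sup>+x. ennreal \<bar>f x\<bar> \<partial>M) + (\<integral>\<^sup>+x. ennreal \<bar>g x\<bar> \<partial>M))" by (rule mult_left_mono) simp
  then show "\<rho> (\<lambda>t. f t + g t) \<le> \<rho> f + \<rho> g" by (simp add: rho distrib_left)
next
  fix f :: "'a \<Rightarrow> real" and k :: real assume [measurable]: "f \<in> borel_measurable M"
  have "(\<integral>\<^sup>+x. ennreal \<bar>k * f x\<bar> \<partial>M) = (\<integral>\<^sup>+x. ennreal \<bar>k\<bar> * ennreal \<bar>f x\<bar> \<partial>M)"
    by (simp add: abs_mult ennreal_mult)
  then show "\<rho> (\<lambda>t. k * f t) = ennreal \<bar>k\<bar> * \<rho> f" by (simp add: rho nn_integral_cmult mult.left_commute)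
next
  fix f g :: "'a \<Rightarrow> real"
  assume [measurable]: "f \<in> borel_measurable M" "g \<in> borel_measurable M" and le: "AE t in M. \<bar>g t\<bar> \<le> \<bar>f t\<bar>"
  have "(\<integral>\<^sup>+x. ennreal \<bar>g x\<bar> \<partial>M) \<le> (\<integral>\<^sup>+x. ennreal \<bar>f x\<bar> \<partial>M)"
    using le by (intro nn_integral_mono_AE) (auto intro: ennreal_leI)
  then show "\<rho> g \<le> \<rho> f" by (simp add: rho mult_left_mono)
next
  fix F and f :: "'a \<Rightarrow> real" and K
  assume [measurable]: "\<And>n. F n \<in> borel_measurable M" "f \<in> borel_measurable M"
    and inc: "AE t in M. incseq (\<lambda>n. F n t) \<and> (\<lambda>n. F n t) \<longlonglongrightarrow> f t"
    and K: "\<And>n. \<rho> (F n) \<le> ennreal K"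
  have "(\<integral>\<^sup>+x. ennreal c * ennreal \<bar>f x\<bar> \<partial>M) \<le> (\<integral>\<^sup>+x. liminf (\<lambda>n. ennreal c * ennreal \<bar>F n x\<bar>) \<partial>M)"
  proof (rule nn_integral_mono_AE)
    show "AE x in M. ennreal c * ennreal \<bar>f x\<bar> \<le> liminf (\<lambda>n. ennreal c * ennreal \<bar>F n x\<bar>)"
      using inc
    proof eventually_elim
      case (elim x)
      then have "(\<lambda>n. ennreal c * ennreal \<bar>F n x\<bar>) \<longlonglongrightarrow> ennreal c * ennreal \<bar>f x\<bar>"
        by (intro ennreal_tendsto_cmult tendsto_intros) auto
      then have "liminf (\<lambda>n. ennreal c * ennreal \<bar>F n x\<bar>) = ennreal c * ennreal \<bar>f x\<bar>"
        by (intro lim_imp_Liminf) auto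
      then show ?case by simp
    qed
  qed
  also have "\<dots> \<le> liminf (\<lambda>n. \<integral>\<^sup>+x. ennreal c * ennreal \<bar>F n x\<bar> \<partial>M)"
    by (rule nn_integral_liminf) measurable
  also have "\<dots> \<le> limsup (\<lambda>n. \<integral>\<^sup>+x. ennreal c * ennreal \<bar>F n x\<bar> \<partial>M)"
    by (intro Liminf_le_Limsup) simp
  also have "\<dots> \<le> ennreal K"
    using K by (intro Limsup_bounded always_eventually allI) (simp add: nn_integral_cmult rho)
  finally show "\<rho> f \<le> ennreal K" by (simp add: nn_integral_cmult rho)
next
  fix s d :: real assume s: "0 < s" and d: "0 < d"
  have "distribution_fun M f s \<le> ennreal d"
    if [measurable]: "f \<in> borel_measurable M" and r: "\<rho> f < ennreal (c * (s * d))" for f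
  proof -
    let ?A = "{t \<in> space M. s < \<bar>f t\<bar>}"
    have "ennreal (c * s) * emeasure M ?A = ennreal c * (\<integral>\<^sup>+x. ennreal s * indicator ?A x \<partial>M)"
      using c s by (simp add: nn_integral_cmult_indicator ennreal_mult mult.assoc)
    also have "\<dots> \<le> \<rho> f"
      unfolding rho[OF that(1)]
      by (intro mult_left_mono nn_integral_mono) (auto simp: indicator_def intro: ennreal_leI)
    also have "\<dots> \<le> ennreal (c * s) * ennreal d" using r c s d by (simp add: ennreal_mult[symmetric] mult.assoc)
    finally show ?thesis
      unfolding distribution_fun_def using c s by (subst (asm) ennreal_mult_le_mult_iff) auto
  qed
  then show "\<exists>e>0. \<forall>f\<in>borel_measurable M. \<rho> f < ennreal e \<longrightarrow> distribution_fun M f s \<le> ennreal d"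
    using c s d by (intro exI[of _ "c * (s * d)"]) auto
qed

lemma (in rearrangement_space) rearrangement_invariant_L1:
  assumes c: "0 < c"
    and rho: "\<And>f. f \<in> borel_measurable M \<Longrightarrow> \<rho> f = ennreal c * (\<integral>\<^sup>+x. ennreal \<bar>f x\<bar> \<partial>M)"
  shows "rearrangement_invariant M R {f \<in> borel_measurable M. \<rho> f < \<infinity>} (\<lambda>f. enn2real (\<rho> f))"
  unfolding rearrangement_invariant_def
proof (intro ballI conjI)
  fix f assume "f \<in> {f \<in> borel_measurable M. \<rho> f < \<infinity>}"
  then have f[measurable]: "f \<in> borel_measurable M" and fin: "\<rho> f < \<infinity>" by auto
  show Rf: "R f x < \<infinity>" if "x \<in> space M" for x
  proof (rule R_finite[OF f that])
    fix d :: real assume d: "0 < d"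
    obtain I where I: "0 \<le> I" "\<rho> f = ennreal I" using fin by (cases "\<rho> f") auto
    \<comment> \<open>Then \<open>c * s * d = I + 1\<close> exceeds the norm, and Markov's
      inequality bounds the level set by d.\<close>
    define s where "s = (I + 1) / (c * d)"
    have s: "0 < s" using c d I by (simp add: s_def)
    let ?A = "{t \<in> space M. s < \<bar>f t\<bar>}"
    have "ennreal (c * s) * emeasure M ?A = ennreal c * (\<integral>\<^sup>+x. ennreal s * indicator ?A x \<partial>M)"
      using c s by (simp add: nn_integral_cmult_indicator ennreal_mult mult.assoc)
    also have "\<dots> \<le> \<rho> f"
      unfolding rho[OF f]
      by (intro mult_left_mono nn_integral_mono) (auto simp: indicator_def intro: ennreal_leI)
    also have "\<dots> \<le> ennreal (c * s) * ennreal d"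
      using I c d s by (simp add: ennreal_mult[symmetric] s_def ennreal_leI)
    finally have "emeasure M ?A \<le> ennreal d"
      using c s by (subst (asm) ennreal_mult_le_mult_iff) auto
    then show "\<exists>s\<ge>0. distribution_fun M f s \<le> ennreal d"
      unfolding distribution_fun_def using s by (intro exI[of _ s]) auto
  qed
  have m: "(\<lambda>x. enn2real (R f x)) \<in> borel_measurable M" by measurable
  have "(\<integral>\<^sup>+x. ennreal \<bar>enn2real (R f x)\<bar> \<partial>M) = (\<integral>\<^sup>+x. R f x \<partial>M)"
    using Rf by (intro nn_integral_cong) simp
  then have eq: "\<rho> (\<lambda>x. enn2real (R f x)) = \<rho> f" using nn_integral_R[OF f] by (simp add: rho m)
  show "(\<lambda>x. enn2real (R f x)) \<in> {f \<in> borel_measurable M. \<rho> f < \<infinity>}" using m eq fin by simp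
  show "enn2real (\<rho> f) = enn2real (\<rho> (\<lambda>x. enn2real (R f x)))" using eq by simp
qed

section \<open>The interval (0,a)\<close>

lemma sigma_finite_lebesgue: "sigma_finite_measure (lebesgue :: real measure)"
proof
  show "\<exists>A. countable A \<and> A \<subseteq> sets (lebesgue :: real measure) \<and> \<Union> A = space lebesgue \<and>
      (\<forall>a\<in>A. emeasure lebesgue a \<noteq> \<infinity>)"
  proof (intro exI conjI)
    show "countable (range (\<lambda>n. {- real n .. real n}))" by simp
    have "x \<in> (\<Union>n. {- real n .. real n})" for x :: real
    proof -
      obtain n where "\<bar>x\<bar> \<le> real n" using real_arch_simple by blast
      then show ?thesis by (auto intro!: exI[of _ n])
    qed
    then show "\<Union> (range (\<lambda>n. {- real n .. real n})) = space lebesgue" by auto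
  qed auto
qed

lemma ival_down: "0 < s \<Longrightarrow> s \<le> t \<Longrightarrow> t \<in> ival a \<Longrightarrow> s \<in> ival a"
  by (auto simp: ival_def) (meson ereal_less_eq(3) le_less_trans)

text \<open>If some x below b were missing from the interval, the whole interval, and A with it,
  would have measure at most x.\<close>

lemma initial_interval_ival:
  assumes A: "A \<subseteq> ival a" "A \<in> sets lebesgue" and b: "ennreal b \<le> emeasure lebesgue A"
  shows "{x \<in> ival a. x < b} = {0<..<b}"
proof -
  have "x \<in> ival a" if x: "0 < x" "x < b" for x
  proof (rule ccontr)
    assume "x \<notin> ival a"
    have "ival a \<subseteq> {0..x}"
    proof
      fix y assume y: "y \<in> ival a"
      then have "\<not> x \<le> y" using ival_down[of x y a] x \<open>x \<notin> ival a\<close> by blast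
      then show "y \<in> {0..x}" using y by (simp add: ival_def)
    qed
    then have "emeasure lebesgue A \<le> emeasure lebesgue {0..x}" using A by (intro emeasure_mono) auto
    also have "\<dots> = ennreal x" using x by simp
    finally have "ennreal b \<le> ennreal x" using b by (rule order_trans[rotated])
    then show False using x by simp
  qed
  then show ?thesis by (auto simp: ival_def)
qed

lemma rearrangement_space_ival: "rearrangement_space (lebesgue_on (ival a)) ennreal (ennreal ` ival a)"
proof -
  let ?M = "lebesgue_on (ival a)"
  have iv: "ival a \<inter> space lebesgue \<in> sets lebesgue" using ival_lebesgue by simp
  interpret sigma_finite_measure ?M
    by (rule sigma_finite_measure_restrict_space[OF sigma_finite_lebesgue ival_lebesgue])
  show ?thesis
  proof
    show "ennreal \<in> borel_measurable ?M"
      by (intro measurable_restrict_space1 measurable_completion) simp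
  next
    fix A assume A: "A \<in> sets ?M"
    then have AI: "A \<subseteq> ival a" "A \<in> sets lebesgue" "emeasure ?M A = emeasure lebesgue A"
      using iv ival_lebesgue by (auto simp: sets_restrict_space_iff emeasure_restrict_space)
    show "emeasure ?M {x \<in> space ?M. ennreal x < emeasure ?M A} = emeasure ?M A"
    proof (cases "emeasure ?M A")
      case (real b)
      have eq: "{x \<in> ival a. x < b} = {0<..<b}"
        by (rule initial_interval_ival[of A]) (use AI real in auto)
      then have sub: "{0<..<b} \<subseteq> ival a" by blast
      have "{x \<in> space ?M. ennreal x < ennreal b} = {x \<in> ival a. x < b}"
        by (auto simp: ival_def ennreal_less_iff)
      then have "{x \<in> space ?M. ennreal x < ennreal b} = {0<..<b}" using eq by (rule trans)
      then show ?thesis using real ival_lebesgue sub by (simp add: emeasure_restrict_space)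
    next
      case top
      have "emeasure ?M A \<le> emeasure ?M (space ?M)" by (rule emeasure_space)
      then show ?thesis using top by (simp add: top_unique ennreal_less_top)
    qed
  next
    fix t assume "t \<in> ennreal ` ival a"
    then obtain b where b: "t = ennreal b" "b \<in> ival a" by blast
    have "{x \<in> space ?M. ennreal x < t} = {0<..<b}"
      using b ival_down[of _ b a] by (auto simp: ival_def ennreal_less_iff)
    moreover have "{0<..<b} \<subseteq> ival a" using b ival_down[of _ b a] by auto
    ultimately show "0 < t \<and> t < \<infinity> \<and> emeasure ?M {x \<in> space ?M. ennreal x < t} = t"
      using b ival_lebesgue by (auto simp: emeasure_restrict_space ival_def)
  next
    fix x assume "x \<in> space ?M"
    then show "\<exists>d>0. \<forall>A\<in>sets ?M. emeasure ?M A \<le> ennreal d \<longrightarrow> emeasure ?M A \<le> ennreal x"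
      by (intro exI[of _ x]) (auto simp: ival_def)
  qed
qed

lemma weight_fun_measurable:
  assumes w: "weight_fun a w" shows "w \<in> borel_measurable (lebesgue_on (ival a))"
proof -
  have "mono_on (ival a) (\<lambda>t. - w t)" using w unfolding weight_fun_def monotone_on_def by auto
  then have "(\<lambda>t. - w t) \<in> borel_measurable (restrict_space borel (ival a))"
    by (rule borel_measurable_mono_on_fnc)
  then have "(\<lambda>t. - (- w t)) \<in> borel_measurable (restrict_space borel (ival a))"
    by (rule borel_measurable_uminus)
  then show ?thesis
    by (simp add: measurable_def space_restrict_space sets_restrict_space)
      (smt (verit, best) image_iff sets_completionI_sets sets_lborel)
qed

theorem fun_space_properties:
  assumes \<phi>: "orlicz_function \<phi>" and w: "weight_fun a w" "\<forall>t\<in>ival a. 0 < w t" and nd: "nondegenerate a \<phi> w"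
  shows "banach_function_space (lebesgue_on (ival a)) (fun_space a \<phi> w) (fun_norm a \<phi> w) \<and>
    rearrangement_invariant (lebesgue_on (ival a)) (rearr a) (fun_space a \<phi> w) (fun_norm a \<phi> w) \<and>
    fatou_property (lebesgue_on (ival a)) (fun_space a \<phi> w) (fun_norm a \<phi> w)"
proof -
  let ?M = "lebesgue_on (ival a)"
  have wm: "w \<in> borel_measurable ?M" by (rule weight_fun_measurable[OF w(1)])
  interpret orlicz \<phi> by standard (rule \<phi>)
  interpret rearrangement_space ?M ennreal "ennreal ` ival a" by (rule rearrangement_space_ival)
  have R: "rearr a = R" unfolding rearr_def R_def decreasing_inverse_def by (intro ext) simp
  have W: "W v (ennreal t) = (\<integral>\<^sup>+s\<in>{0<..<t}. rearr a v s \<partial>lebesgue)" if t: "t \<in> ival a" for v t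
  proof -
    have "W v (ennreal t) = (\<integral>\<^sup>+x. R v x * indicator {x \<in> ival a. ennreal x < ennreal t} x * indicator (ival a) x \<partial>lebesgue)"
      unfolding W_def using ival_lebesgue by (simp add: nn_integral_restrict_space)
    also have "\<dots> = (\<integral>\<^sup>+s\<in>{0<..<t}. rearr a v s \<partial>lebesgue)"
      using ival_down[of _ t a] t
      by (intro nn_integral_cong) (auto simp: R indicator_def ival_def ennreal_less_iff)
    finally show ?thesis .
  qed
  have submaj: "submaj a v w \<longleftrightarrow> (\<forall>t\<in>ennreal ` ival a. W v t \<le> W w t)" for v
    unfolding submaj_def by (simp add: W)
  have norm: "fun_norm a \<phi> w = (\<lambda>f. enn2real (luxemburg (fun_modular a \<phi> w) f))"
    by (intro ext) (simp add: fun_norm_def)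
  show ?thesis
  proof (cases "\<exists>t\<in>ennreal ` ival a. W w t < \<infinity>")
    case True
    interpret weighted_space ?M ennreal "ennreal ` ival a" \<phi> w
      using wm w(2) True by unfold_locales auto
    have "fun_modular a \<phi> w = P"
      unfolding fun_modular_def P_def J_def unfolding V_def submaj
      by (intro ext arg_cong[where f = Inf]) auto
    then show ?thesis
      using banach_function_space rearrangement_invariant fatou_property
      unfolding R norm fun_space_def by simp
  next
    case False
    have all: "submaj a v w" for v
      unfolding submaj using False by (auto simp: not_less top_unique)
    \<comment> \<open>A decreasing w exceeds \<open>w s\<close> only to the left of s. Thus a
      rearrangement with infinite partial integrals forces the same for w itself, and
      \<open>nondegenerate\<close> leaves only its condition on \<phi>.\<close>
    have Rw: "R w s \<le> ennreal (w s)" if s: "s \<in> ival a" for s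
    proof -
      have "{x \<in> space ?M. w s < \<bar>w x\<bar>} \<subseteq> {0<..<s}"
      proof
        fix x assume "x \<in> {x \<in> space ?M. w s < \<bar>w x\<bar>}"
        then have x: "x \<in> ival a" "w s < w x" using w(2) by (auto simp: abs_of_pos)
        have "\<not> s \<le> x" using w(1) x s unfolding weight_fun_def monotone_on_def by (meson not_le)
        then show "x \<in> {0<..<s}" using x by (auto simp: ival_def)
      qed
      moreover have sub: "{0<..<s} \<subseteq> ival a" using s ival_down[of _ s a] by auto
      ultimately have "distribution_fun ?M w (w s) \<le> emeasure ?M {0<..<s}"
        unfolding distribution_fun_def using ival_lebesgue
        by (intro emeasure_mono) (auto simp: sets_restrict_space_iff)
      also have "\<dots> = ennreal s" using ival_lebesgue sub s by (simp add: emeasure_restrict_space ival_def)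
      finally have "distribution_fun ?M w (w s) \<le> ennreal s" .
      moreover have "0 \<le> w s" using w(2) s by (simp add: less_imp_le)
      ultimately show ?thesis using less_R_iff[OF wm, of "w s" s] by (meson leD leI)
    qed
    have "\<not> (\<exists>t\<in>ival a. (\<integral>\<^sup>+s\<in>{0<..<t}. ennreal (w s) \<partial>lebesgue) < \<infinity>)"
    proof
      assume "\<exists>t\<in>ival a. (\<integral>\<^sup>+s\<in>{0<..<t}. ennreal (w s) \<partial>lebesgue) < \<infinity>"
      then obtain t where t: "t \<in> ival a" "(\<integral>\<^sup>+s\<in>{0<..<t}. ennreal (w s) \<partial>lebesgue) < \<infinity>" by blast
      have "W w (ennreal t) \<le> (\<integral>\<^sup>+s\<in>{0<..<t}. ennreal (w s) \<partial>lebesgue)"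
        unfolding W[OF t(1)] R using Rw ival_down[of _ t a] t(1)
        by (intro nn_integral_mono) (auto simp: indicator_def)
      then have "W w (ennreal t) < \<infinity>" using t(2) by (rule le_less_trans)
      then show False using False t(1) by blast
    qed
    then have c: "0 < (INF u\<in>{0<..}. \<phi> u / u)"
      using nd unfolding nondegenerate_def by (intro phi_ratio_bound_pos) blast
    have lux: "luxemburg (fun_modular a \<phi> w) f = ennreal (INF u\<in>{0<..}. \<phi> u / u) * (\<integral>\<^sup>+x. ennreal \<bar>f x\<bar> \<partial>?M)"
      if "f \<in> borel_measurable ?M" for f
    proof (rule luxemburg_unrestricted[OF that _ refl c])
      show "fun_modular a \<phi> w g =
          (INF v\<in>{v \<in> borel_measurable ?M. \<forall>x\<in>space ?M. 0 \<le> v x}. \<integral>\<^sup>+x. \<Phi> (g x) (v x) \<partial>?M)" for g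
        unfolding fun_modular_def using all by (intro arg_cong[where f = Inf]) auto
    qed
    interpret fatou_norm ?M "luxemburg (fun_modular a \<phi> w)" by (rule fatou_norm_L1[OF c lux])
    show ?thesis
      using banach_function_space rearrangement_invariant_L1[OF c lux] fatou_property
      unfolding R norm fun_space_def by simp
  qed
qed

section \<open>Sequences\<close>

lemma emeasure_count_space_nat_less:
  "emeasure (count_space UNIV) {i :: nat. of_nat i < (of_nat m :: ennreal)} = of_nat m"
proof -
  have "{i :: nat. of_nat i < (of_nat m :: ennreal)} = {..<m}" by auto
  then show ?thesis by simp
qed

lemma rearrangement_space_nat:
  "rearrangement_space (count_space (UNIV :: nat set)) of_nat (of_nat ` {1..})"
proof -
  let ?M = "count_space (UNIV :: nat set)"
  interpret sigma_finite_measure ?M by (rule sigma_finite_measure_count_space)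
  show ?thesis
  proof
    show "of_nat \<in> borel_measurable ?M" by simp
  next
    fix A :: "nat set"
    show "emeasure ?M {x \<in> space ?M. of_nat x < emeasure ?M A} = emeasure ?M A"
    proof (cases "finite A")
      case True
      then show ?thesis using emeasure_count_space_nat_less[of "card A"] by simp
    next
      case False
      then show ?thesis by (simp add: of_nat_less_top)
    qed
  next
    fix t :: ennreal assume "t \<in> of_nat ` {1..}"
    then show "0 < t \<and> t < \<infinity> \<and> emeasure ?M {x \<in> space ?M. of_nat x < t} = t"
      using emeasure_count_space_nat_less by (auto simp: of_nat_less_top)
  next
    fix x :: nat
    \<comment> \<open>Any bound below 1 would do: only the empty set is that small, and the position
      0 demands measure 0.\<close>
    have "A = {}" if "emeasure ?M A \<le> ennreal (1/2)" for A
    proof (rule ccontr)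
      assume "A \<noteq> {}"
      then obtain i where "i \<in> A" by blast
      then have "emeasure ?M {i} \<le> emeasure ?M A" by (intro emeasure_mono) auto
      then have "ennreal 1 \<le> ennreal (1/2)" using that by simp
      then show False by (subst (asm) ennreal_le_iff) auto
    qed
    then have "emeasure ?M A \<le> of_nat x" if "emeasure ?M A \<le> ennreal (1/2)" for A
      using that by (metis emeasure_empty zero_le)
    then show "\<exists>d>0. \<forall>A\<in>sets ?M. emeasure ?M A \<le> ennreal d \<longrightarrow> emeasure ?M A \<le> of_nat x"
      by (intro exI[of _ "1/2"] conjI ballI impI) simp
  qed
qed

theorem seq_space_properties:
  assumes \<phi>: "orlicz_function \<phi>" and w: "weight_seq w" "\<forall>i. 0 < w i"
  shows "banach_function_space (count_space UNIV) (seq_space \<phi> w) (seq_norm \<phi> w) \<and>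
    rearrangement_invariant (count_space UNIV) seq_rearr (seq_space \<phi> w) (seq_norm \<phi> w) \<and>
    fatou_property (count_space UNIV) (seq_space \<phi> w) (seq_norm \<phi> w)"
proof -
  let ?M = "count_space (UNIV :: nat set)" and ?T = "of_nat ` {1..} :: ennreal set"
  interpret orlicz \<phi> by standard (rule \<phi>)
  interpret rearrangement_space ?M of_nat ?T by (rule rearrangement_space_nat)
  have R: "seq_rearr x i = R x i" for x i
  proof (rule ennreal_eqI_less)
    fix s :: real assume s: "0 \<le> s"
    have "R x i \<le> seq_rearr x i"
      unfolding R_def decreasing_inverse_def seq_rearr_def by (intro Inf_superset_mono image_mono) auto
    moreover have "seq_rearr x i \<le> R x i"
      unfolding R_def decreasing_inverse_def
    proof (rule Inf_greatest, clarify)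
      fix r :: real assume r: "0 \<le> r" "distribution_fun ?M x r \<le> of_nat i"
      show "seq_rearr x i \<le> ennreal r"
      proof (rule ennreal_le_epsilon)
        fix e :: real assume e: "0 < e"
        have "distribution_fun ?M x (r + e) \<le> of_nat i"
          using distribution_fun_antimono[of x ?M r "r + e"] e r by (auto intro: order_trans)
        then have "seq_rearr x i \<le> ennreal (r + e)"
          unfolding seq_rearr_def using r e by (intro Inf_lower image_eqI[where x = "r + e"]) auto
        then show "seq_rearr x i \<le> ennreal r + ennreal e" using r e by simp
      qed
    qed
    ultimately show "ennreal s < seq_rearr x i \<longleftrightarrow> ennreal s < R x i" by simp
  qed
  have W: "W v (of_nat m) = (\<Sum>i<m. seq_rearr v i)" for v m
  proof -
    have "W v (of_nat m) = (\<Sum>i. R v i * indicator {x. of_nat x < (of_nat m :: ennreal)} i)"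
      unfolding W_def by (simp add: nn_integral_count_space_nat)
    also have "\<dots> = (\<Sum>i<m. R v i * indicator {x. of_nat x < (of_nat m :: ennreal)} i)"
      by (rule suminf_finite) auto
    finally show ?thesis by (simp add: R)
  qed
  have submaj: "seq_submaj v w \<longleftrightarrow> (\<forall>t\<in>?T. W v t \<le> W w t)" for v
  proof -
    \<comment> \<open>The case m = 0, absent from \<open>?T\<close>, is a comparison of empty
      sums.\<close>
    have "(\<forall>m. (\<Sum>i<m. seq_rearr v i) \<le> (\<Sum>i<m. seq_rearr w i)) \<longleftrightarrow>
        (\<forall>m\<ge>1. (\<Sum>i<m. seq_rearr v i) \<le> (\<Sum>i<m. seq_rearr w i))"
      by (metis less_one linorder_not_le lessThan_0 order_refl sum.empty)
    then show ?thesis by (auto simp: seq_submaj_def W)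
  qed
  \<comment> \<open>A decreasing sequence is bounded by its first entry, so the value at m = 1 is
    finite.\<close>
  have "\<exists>t\<in>?T. W w t < \<infinity>"
  proof (rule bexI)
    have "w i \<le> w 0" for i using w(1) unfolding weight_seq_def monotone_def by simp
    then have "{i. w 0 < \<bar>w i\<bar>} = {}" using w(2) by (simp add: abs_of_pos not_less)
    then have "distribution_fun ?M w (w 0) = 0" by (simp add: distribution_fun_def)
    moreover have "0 \<le> w 0" using w(2) by (simp add: less_imp_le)
    ultimately have "R w 0 \<le> ennreal (w 0)" using less_R_iff[of w "w 0" 0] by (simp add: not_less)
    then have "R w 0 < \<infinity>" by (rule le_less_trans) simp
    then show "W w (of_nat 1) < \<infinity>" unfolding W by (simp add: R)
  qed auto
  then interpret weighted_space ?M of_nat ?T \<phi> w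
    using w(2) by unfold_locales auto
  have "seq_modular \<phi> w = P"
    unfolding seq_modular_def P_def J_def unfolding V_def submaj nn_integral_count_space_nat
    by (intro ext arg_cong[where f = Inf]) auto
  moreover have "seq_rearr = R" by (intro ext) (rule R)
  moreover have "seq_norm \<phi> w = (\<lambda>f. enn2real (luxemburg (seq_modular \<phi> w) f))"
    by (intro ext) (simp add: seq_norm_def)
  ultimately show ?thesis
    using banach_function_space rearrangement_invariant fatou_property
    unfolding seq_space_def by simp
qed

theorem theorem4p7:
  fixes \<phi> :: "real \<Rightarrow> real"
  assumes "orlicz_function \<phi>"
  shows "(\<forall>a w. 0 < a \<and> weight_fun a w \<and> (\<forall>t\<in>ival a. 0 < w t) \<and> nondegenerate a \<phi> w \<longrightarrow>
            banach_function_space (lebesgue_on (ival a)) (fun_space a \<phi> w) (fun_norm a \<phi> w) \<and>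
            rearrangement_invariant (lebesgue_on (ival a)) (rearr a)
              (fun_space a \<phi> w) (fun_norm a \<phi> w) \<and>
            fatou_property (lebesgue_on (ival a)) (fun_space a \<phi> w) (fun_norm a \<phi> w)) \<and>
         (\<forall>w. weight_seq w \<and> (\<forall>i. 0 < w i) \<longrightarrow>
            banach_function_space (count_space UNIV) (seq_space \<phi> w) (seq_norm \<phi> w) \<and>
            rearrangement_invariant (count_space UNIV) seq_rearr
              (seq_space \<phi> w) (seq_norm \<phi> w) \<and>
            fatou_property (count_space UNIV) (seq_space \<phi> w) (seq_norm \<phi> w))"
  using fun_space_properties[OF assms] seq_space_properties[OF assms] by blast

end
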